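(* Let $\Lambda=(\Lambda_i)_{i\le\kappa}$ be a Delone $\kappa$-set in $\mathbb{R}^d$ and let $\{F_n\}_{n\ge1}$ be a van Hove sequence. Suppose that $\Lambda$ has uniform cluster frequencies (UCF) relative to $\{F_n\}_{n\ge 1}$ and that, in addition, for all $m\ge m_0$ and all $\alpha=1,\dots,N_m$: for every $\epsilon>0$ there exists $k_0\in\mathbb{N}$ such that for all $n\ge k_0$ and all $h\in\mathbb{R}^d$, $$\sum_{j=k_0}^{\infty}\frac{\mathrm{Vol}(V^{(m,\alpha)}_j)\,L_{G_j^{(m,\alpha)}}(h+F_n,\Lambda)}{\mathrm{Vol}(F_n)}\le\epsilon.$$ Then the topological dynamical system $(X_\Lambda,\mathbb{R}^d)$ is uniquely ergodic.
   Context: A $\kappa$-set $\Lambda=(\Lambda_i)_{i\le\kappa}$ is a tuple of pairwise disjoint subsets of $\mathbb{R}^d$, identified with $\{(x,i):x\in\Lambda_i\}\subset\mathbb{R}^d\times\{1,\dots,\kappa\}$ ($i$ is the colour of $x$); $\mathrm{supp}(\Lambda)=\bigcup_i\Lambda_i$. It is a Delone $\kappa$-set if each $\Lambda_i$ and $\mathrm{supp}(\Lambda)$ are Delone (relatively dense and uniformly discrete). A cluster is a finite nonempty $\kappa$-set $G=(G_i)_{i\le\kappa}$; it is a cluster of $\Lambda$ if $G_i\subset\Lambda_i$ for all $i$ (written $G\subset\Lambda$). Translates are taken coordinatewise, keeping colours. Dynamical system: let $X$ be the collection of all Delone $\kappa$-sets in $\mathbb{R}^d$. For $\Gamma\in X$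 and $B\subset\mathbb{R}^d$ put $\Gamma+B=\{(x+t,i):x\in\Gamma_i,t\in B\}$, and for $B\subset \mathbb{R}^d$ let $\Gamma\cap B=(\Gamma_i\cap B)_{i\le \kappa}$. Equip $X$ with the metric $d(\Gamma,\Gamma')=\min\{\tilde d(\Gamma,\Gamma'),2^{-1/2}\}$, where $\tilde d(\Gamma,\Gamma')=\inf\{\epsilon>0: B_{1/\epsilon}(0)\cap\Gamma'\subset\Gamma+B_\epsilon(0)\text{ and }B_{1/\epsilon}(0)\cap\Gamma\subset\Gamma'+B_\epsilon(0)\}$. $X_\Lambda$ is the closure in $X$ of the orbit $\{\Lambda-g:g\in\mathbb{R}^d\}$; it is compact, and $\mathbb{R}^d$ acts on it by $\Gamma\mapsto\Gamma-g$. Van Hove sequence: bounded measurable sets $F_n\subset\mathbb{R}^d$ with $\lim_{n}\mathrm{Vol}((\partial F_n)^{+r})/\mathrm{Vol}(F_n)=0$ for all $r>0$, where $F^{+r}=\{x:\mathrm{dist}(x,F)\le r\}$. Frequencies: for a cluster $G$ and bounded $F$, $L_G(F,\Lambda)=\#\{g\in\mathbb{R}^d:g+G\subset\Lambda,\ g+\mathrm{supp}(G)\subset F\}$. $\Lambda$ has UCF relative to $\{F_n\}$ if for every cluster $G$ the limit $\mathrm{freq}(G,\Lambda)=\lim_n L_G(x+F_n,\Lambda)/\mathrm{Vol}(F_n)$ exists uniformly in $x\in\mathbb{R}^d$. Grid: choose $\eta(\Lambda)>0$ such that every ball of radius $\eta(\Lambda)/2$ (in the $\ell^\infty$ metric)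 contains at most one point of $\mathrm{supp}(\Lambda)$, and $m_0$ with $2^{-m_0}<\eta(\Lambda)/2$. For $m\ge m_0$ subdivide $[-2^m,2^m)^d$ into the half-open cubes $\prod_{i=1}^d[\frac{k_i}{2^m},\frac{k_i+1}{2^m})$, $k_i\in[-4^m,4^m)\cap\mathbb{Z}$; each such cube contains at most one point of $\mathrm{supp}(\Lambda)$. $\Delta_m$ is the finite set of all coloured cubes $C=(B,i)$ with $B$ such a cube and $1\le i\le\kappa$; write $\mathrm{supp}(C)=B$ and identify $C$ with $B\times\{i\}$. Let $\Delta_{m,\alpha}$, $\alpha=1,\dots,N_m$, enumerate all nonempty subsets of $\Delta_m$ in which distinct elements have disjoint supports (each cube is used at most once). $U_{m,\alpha}$ is the family of finite sets $P\subset[-2^m,2^m)^d\times\{1,\dots,\kappa\}$ such that $P\cap C$ is exactly one coloured point for each $C\in\Delta_{m,\alpha}$, and $P\cap C'=\emptyset$ for each $C'\in\Delta_m\setminus\Delta_{m,\alpha}$. Let $\mathcal{G}_{m,\alpha}=\{G\in U_{m,\alpha}:\exists x\in\mathbb{R}^d,\ G-x\subset\Lambda\}$. Choose one representative from each translational equivalence class in $\mathcal{G}_{m,\alpha}$ and fix an enumeration $G_1^{(m,\alpha)},G_2^{(m,\alpha)},\dots$ of these (countably many) representatives; if there are only finitely many, sums over $j$ are over those only. $V_j^{(m,\alpha)}=\{t\in\mathbb{R}^d:G_j^{(m,\alpha)}+t\in U_{m,\alpha}\}$. *)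

theory Defs
  imports "HOL-Analysis.Analysis" "HOL-Probability.Probability_Measure"
begin

section \<open>Coloured point sets\<close>

text \<open>
  A \<open>\<kappa>\<close>-set is represented by its set of coloured points \<open>(x, i)\<close>. The colours form a finite type
  \<open>'k\<close>, so \<open>\<kappa>\<close> is \<open>CARD('k)\<close>, and the ambient space is \<^typ>\<open>real^'d\<close> with \<open>d = CARD('d)\<close>.
\<close>

type_synonym ('d, 'k) coloured = "((real^'d) \<times> 'k) set"

definition colour_class :: "('d::finite, 'k::finite) coloured \<Rightarrow> 'k \<Rightarrow> (real^'d) set" where
  "colour_class P i = {x. (x, i) \<in> P}"

definition support :: "('d::finite, 'k::finite) coloured \<Rightarrow> (real^'d) set" where
  "support P = (\<Union>i. colour_class P i)"

definition kset :: "('d::finite, 'k::finite) coloured \<Rightarrow> bool" where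
  "kset P \<longleftrightarrow> (\<forall>i j. i \<noteq> j \<longrightarrow> colour_class P i \<inter> colour_class P j = {})"

definition translate :: "real^'d \<Rightarrow> ('d::finite, 'k::finite) coloured \<Rightarrow> ('d, 'k) coloured" where
  "translate t P = (\<lambda>(x, i). (x + t, i)) ` P"

definition relatively_dense :: "'a::metric_space set \<Rightarrow> bool" where
  "relatively_dense S \<longleftrightarrow> (\<exists>R>0. \<forall>x. \<exists>y\<in>S. dist x y \<le> R)"

definition delone :: "'a::metric_space set \<Rightarrow> bool" where
  "delone S \<longleftrightarrow> relatively_dense S \<and> uniform_discrete S"

definition delone_kset :: "('d::finite, 'k::finite) coloured \<Rightarrow> bool" where
  "delone_kset P \<longleftrightarrow> kset P \<and> (\<forall>i. delone (colour_class P i)) \<and> delone (support P)"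

definition cluster :: "('d::finite, 'k::finite) coloured \<Rightarrow> bool" where
  "cluster G \<longleftrightarrow> kset G \<and> finite G \<and> G \<noteq> {}"


section \<open>The dynamical system of a Delone set\<close>

definition thicken ::
  "('d::finite, 'k::finite) coloured \<Rightarrow> (real^'d) set \<Rightarrow> ('d, 'k) coloured" where
  "thicken P B = {(x + t, i) | x t i. (x, i) \<in> P \<and> t \<in> B}"

definition restrict_to ::
  "('d::finite, 'k::finite) coloured \<Rightarrow> (real^'d) set \<Rightarrow> ('d, 'k) coloured" where
  "restrict_to P B = {(x, i). (x, i) \<in> P \<and> x \<in> B}"

definition eps_close ::
  "real \<Rightarrow> ('d::finite, 'k::finite) coloured \<Rightarrow> ('d, 'k) coloured \<Rightarrow> bool" where
  "eps_close \<epsilon> P Q \<longleftrightarrow>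
     restrict_to Q (ball 0 (1 / \<epsilon>)) \<subseteq> thicken P (ball 0 \<epsilon>) \<and>
     restrict_to P (ball 0 (1 / \<epsilon>)) \<subseteq> thicken Q (ball 0 \<epsilon>)"

text \<open>
  The value outside the Delone \<open>\<kappa>\<close>-sets is irrelevant for the topology below; it is set to 0
  because the locale \<^locale>\<open>Metric_space\<close> requires non-negativity on the whole type. On
  Delone \<open>\<kappa>\<close>-sets the infimum is over a nonempty set, by relative density.
\<close>

definition delone_dist ::
  "('d::finite, 'k::finite) coloured \<Rightarrow> ('d, 'k) coloured \<Rightarrow> real" where
  "delone_dist P Q =
     (if delone_kset P \<and> delone_kset Q
      then min (Inf {\<epsilon>. \<epsilon> > 0 \<and> eps_close \<epsilon> P Q}) (2 powr (- 1 / 2)) else 0)"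

lemma Metric_space_delone_dist:
  "Metric_space {P :: ('d::finite, 'k::finite) coloured. delone_kset P} delone_dist"
proof -
  define c :: real where "c = 2 powr (- 1 / 2)"
  have c0: "c > 0" by (simp add: c_def)
  have c2: "c * c = 1 / 2"
    unfolding c_def by (simp add: powr_add [symmetric] powr_minus_divide)
  define E where "E = (\<lambda>P Q :: ('d, 'k) coloured. {\<epsilon>. \<epsilon> > 0 \<and> eps_close \<epsilon> P Q})"
  have close_iff: "eps_close e P Q \<longleftrightarrow>
      (\<forall>x i. (x, i) \<in> Q \<and> norm x < 1 / e \<longrightarrow> (\<exists>y. (y, i) \<in> P \<and> dist x y < e)) \<and>
      (\<forall>x i. (x, i) \<in> P \<and> norm x < 1 / e \<longrightarrow> (\<exists>y. (y, i) \<in> Q \<and> dist x y < e))"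
    for e and P Q :: "('d, 'k) coloured"
  proof -
    have thick: "(x, i) \<in> thicken R (ball 0 e) \<longleftrightarrow> (\<exists>y. (y, i) \<in> R \<and> dist x y < e)"
      for x i and R :: "('d, 'k) coloured"
    proof
      assume "\<exists>y. (y, i) \<in> R \<and> dist x y < e"
      then obtain y where "(y, i) \<in> R" "norm (x - y) < e" by (auto simp: dist_norm)
      then have "(x, i) = (y + (x - y), i) \<and> (y, i) \<in> R \<and> x - y \<in> ball 0 e"
        by simp
      then show "(x, i) \<in> thicken R (ball 0 e)"
        unfolding thicken_def by blast
    qed (auto simp: thicken_def dist_norm)
    show ?thesis
      unfolding eps_close_def restrict_to_def subset_iff split_paired_All
      by (auto simp: thick)
  qed
  have E_ne: "E P Q \<noteq> {}" if "delone_kset P" "delone_kset Q" for P Q :: "('d, 'k) coloured"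
  proof -
    define r where "r = (\<lambda>(S :: ('d, 'k) coloured) i.
        SOME R::real. R > 0 \<and> (\<forall>x. \<exists>y. (y, i) \<in> S \<and> dist x y \<le> R))"
    have r: "r S i > 0 \<and> (\<forall>x. \<exists>y. (y, i) \<in> S \<and> dist x y \<le> r S i)"
      if "delone_kset S" for S i
    proof -
      have "\<exists>R>0. \<forall>x. \<exists>y. (y, i) \<in> S \<and> dist x y \<le> R"
        using that
        by (fastforce simp: delone_kset_def delone_def relatively_dense_def colour_class_def)
      then show ?thesis unfolding r_def by (rule someI_ex)
    qed
    define e where "e = (\<Sum>i\<in>UNIV. r P i) + (\<Sum>i\<in>UNIV. r Q i) + 1"
    have rnn: "0 \<le> r P i" "0 \<le> r Q i" for i
      using r[OF that(1), of i] r[OF that(2), of i] by linarith+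
    have s: "0 \<le> (\<Sum>i\<in>UNIV. r P i)" "0 \<le> (\<Sum>i\<in>UNIV. r Q i)"
      by (simp_all add: sum_nonneg rnn)
    have m: "r P i \<le> (\<Sum>i\<in>UNIV. r P i)" "r Q i \<le> (\<Sum>i\<in>UNIV. r Q i)" for i
      by (simp_all add: member_le_sum rnn)
    have e: "r P i < e" "r Q i < e" for i
      using s m[of i] unfolding e_def by linarith+
    have e0: "e > 0" using s by (simp add: e_def)
    have "eps_close e P Q"
      unfolding close_iff
    proof (intro conjI allI impI)
      show "\<exists>y. (y, i) \<in> P \<and> dist x y < e" for x i
        using r[OF that(1), of i] e(1)[of i] le_less_trans by blast
      show "\<exists>y. (y, i) \<in> Q \<and> dist x y < e" for x i
        using r[OF that(2), of i] e(2)[of i] le_less_trans by blast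
    qed
    then show ?thesis using e0 by (auto simp: E_def)
  qed
  have E_sym: "E P Q = E Q P" for P Q
    by (auto simp: E_def eps_close_def)
  have E_bdd: "bdd_below (E P Q)" for P Q
    by (rule bdd_belowI[of _ 0]) (auto simp: E_def)
  have E_inf: "Inf (E P Q) \<ge> 0" if "delone_kset P" "delone_kset Q" for P Q
    by (rule cInf_greatest) (use E_ne[OF that] in \<open>auto simp: E_def\<close>)
  have d: "delone_dist P Q = min (Inf (E P Q)) c" if "delone_kset P" "delone_kset Q" for P Q
    using that by (simp add: delone_dist_def E_def c_def)
  have E_up: "b \<in> E P Q" if "a \<in> E P Q" "a \<le> b" for a b P Q
  proof -
    have "1 / b \<le> 1 / a" using that by (auto simp: E_def intro!: divide_left_mono)
    moreover have "a > 0" and cl: "eps_close a P Q" using that by (auto simp: E_def)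
    moreover have "eps_close b P Q"
      unfolding close_iff
    proof (intro conjI allI impI; elim conjE)
      show "\<exists>y. (y, i) \<in> P \<and> dist x y < b" if "(x, i) \<in> Q" "norm x < 1 / b" for x i
        using that cl[unfolded close_iff] \<open>1 / b \<le> 1 / a\<close> \<open>a \<le> b\<close>
          less_le_trans[of "norm x" "1 / b" "1 / a"] less_le_trans[of _ a b] by blast
      show "\<exists>y. (y, i) \<in> Q \<and> dist x y < b" if "(x, i) \<in> P" "norm x < 1 / b" for x i
        using that cl[unfolded close_iff] \<open>1 / b \<le> 1 / a\<close> \<open>a \<le> b\<close>
          less_le_trans[of "norm x" "1 / b" "1 / a"] less_le_trans[of _ a b] by blast
    qed
    ultimately show ?thesis using \<open>a \<le> b\<close> by (simp add: E_def)
  qed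
  have sub: "P \<subseteq> Q" if P: "delone_kset P" and Q: "delone_kset Q"
    and z: "Inf (E P Q) = 0" for P Q
  proof clarify
    fix x i assume x: "(x, i) \<in> P"
    have "closed (colour_class Q i)"
      using Q by (auto simp: delone_kset_def delone_def intro: uniform_discrete_imp_closed)
    moreover have "x \<in> closure (colour_class Q i)"
      unfolding closure_approachable
    proof (intro allI impI)
      fix e :: real assume e: "e > 0"
      define f where "f = min e (1 / (norm x + 1))"
      have f: "f > 0" using e by (simp add: f_def add_nonneg_pos)
      then obtain a where a: "a \<in> E P Q" "a < f"
        using z cInf_lessD[OF E_ne[OF P Q], of f] by auto
      have "f \<in> E P Q" using E_up[OF a(1)] a(2) by simp
      moreover have "norm x < 1 / f"
      proof -
        have "norm x + 1 \<le> 1 / f"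
          using divide_left_mono[of f "1 / (norm x + 1)" 1] f
          by (simp add: f_def add_nonneg_pos)
        then show ?thesis by simp
      qed
      ultimately obtain y where "(y, i) \<in> Q" "dist x y < f"
        using x unfolding E_def mem_Collect_eq close_iff by blast
      then show "\<exists>y\<in>colour_class Q i. dist y x < e"
        by (auto simp: colour_class_def f_def dist_commute)
    qed
    ultimately show "(x, i) \<in> Q" by (simp add: colour_class_def)
  qed
  have comp: "a + b \<in> E P R" if ab: "a \<in> E P Q" "b \<in> E Q R" "a + b < c" for a b P Q R
  proof -
    have pos: "a > 0" "b > 0" using ab by (auto simp: E_def)
    have sq: "(a + b) * (a + b) \<le> 1"
      using mult_strict_mono[of "a + b" c "a + b" c] ab(3) pos c0 c2 by simp
    have key: "1 / (a + b) + u \<le> 1 / v" if "u > 0" "v > 0" "u + v = a + b" for u v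
    proof -
      have "v * (u + v) \<le> 1"
      proof -
        have "v * (u + v) \<le> (u + v) * (u + v)"
          using that by (intro mult_right_mono) auto
        then show ?thesis using sq unfolding that(3)[symmetric] by linarith
      qed
      then have "u * (v * (u + v)) \<le> u" using that(1) by (simp add: mult_left_le)
      then show ?thesis using that(1,2) unfolding that(3)[symmetric]
        by (simp add: field_simps)
    qed
    have half: "\<exists>y. (y, i) \<in> P' \<and> dist x y < u + v"
      if cl: "\<And>x i. (x, i) \<in> R' \<Longrightarrow> norm x < 1 / u \<Longrightarrow> \<exists>y. (y, i) \<in> Q' \<and> dist x y < u"
        "\<And>x i. (x, i) \<in> Q' \<Longrightarrow> norm x < 1 / v \<Longrightarrow> \<exists>y. (y, i) \<in> P' \<and> dist x y < v"
        and uv: "u > 0" "v > 0" "u + v = a + b" and x: "(x, i) \<in> R'" "norm x < 1 / (a + b)"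
      for P' Q' R' :: "('d, 'k) coloured" and u v x i
    proof -
      have "1 / (a + b) \<le> 1 / u" using uv by (intro divide_left_mono) auto
      then obtain y where y: "(y, i) \<in> Q'" "dist x y < u" using cl(1)[OF x(1)] x(2) by auto
      have "norm y \<le> norm x + dist x y"
        using norm_triangle_sub[of y x] by (simp add: dist_norm norm_minus_commute)
      then have "norm y < 1 / v" using key[OF uv] y(2) x(2) by linarith
      then obtain z where z: "(z, i) \<in> P'" "dist y z < v" using cl(2)[OF y(1)] by auto
      then have "dist x z < u + v" using y(2) dist_triangle[of x z y] by linarith
      then show ?thesis using z(1) by blast
    qed
    have "eps_close (a + b) P R"
      unfolding close_iff
    proof (intro conjI allI impI; elim conjE)
      fix x i assume "(x, i) \<in> R" "norm x < 1 / (a + b)"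
      then show "\<exists>y. (y, i) \<in> P \<and> dist x y < a + b"
        using half[of R b Q a P x i] ab pos
        unfolding E_def mem_Collect_eq close_iff by (simp add: add.commute)
    next
      fix x i assume "(x, i) \<in> P" "norm x < 1 / (a + b)"
      then show "\<exists>y. (y, i) \<in> R \<and> dist x y < a + b"
        using half[of P a Q b R x i] ab pos
        unfolding E_def mem_Collect_eq close_iff by simp
    qed
    then show ?thesis using pos by (simp add: E_def)
  qed
  show ?thesis
  proof (unfold_locales, goal_cases)
    case (1 P Q)
    show ?case
    proof (cases "delone_kset P \<and> delone_kset Q")
      case True
      then show ?thesis using d E_inf c0 by simp
    qed (auto simp: delone_dist_def)
  next
    case (2 P Q)
    show ?case
      by (simp add: delone_dist_def E_sym[of P Q, unfolded E_def] conj_commute)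
  next
    case (3 P Q)
    then have PQ: "delone_kset P" "delone_kset Q" by auto
    show ?case
    proof
      assume "delone_dist P Q = 0"
      then have "Inf (E P Q) = 0" "Inf (E Q P) = 0"
        using d[OF PQ] c0 E_sym[of P Q] by (auto simp: min_def split: if_splits)
      then show "P = Q" using sub PQ by blast
    next
      assume "P = Q"
      have "eps_close e P P" if "e > 0" for e
        unfolding close_iff
      proof (intro conjI allI impI; elim conjE)
        show "\<exists>y. (y, i) \<in> P \<and> dist x y < e" if "(x, i) \<in> P" for x i
          using that \<open>e > 0\<close> by (intro exI[of _ x]) simp
        then show "\<exists>y. (y, i) \<in> P \<and> dist x y < e" if "(x, i) \<in> P" for x i
          using that .
      qed
      then have "E P Q = {0<..}" using \<open>P = Q\<close> by (auto simp: E_def)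
      then show "delone_dist P Q = 0" using d[OF PQ] c0 by simp
    qed
  next
    case (4 P Q R)
    then have PQR: "delone_kset P" "delone_kset Q" "delone_kset R" by auto
    let ?p = "Inf (E P Q)" and ?q = "Inf (E Q R)"
    have nn: "?p \<ge> 0" "?q \<ge> 0" using E_inf PQR by auto
    show ?case
    proof (cases "?p + ?q < c")
      case False
      then show ?thesis using d PQR nn c0 by (simp add: min_def)
    next
      case True
      have "Inf (E P R) \<le> ?p + ?q"
      proof (rule field_le_epsilon)
        fix e :: real assume e: "e > 0"
        define f where "f = min e (c - (?p + ?q)) / 2"
        have f: "f > 0" "2 * f \<le> e" "2 * f \<le> c - (?p + ?q)" using e True by (auto simp: f_def)
        obtain a where a: "a \<in> E P Q" "a < ?p + f"
          using cInf_lessD[OF E_ne[OF PQR(1,2)], of "?p + f"] f by auto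
        obtain b where b: "b \<in> E Q R" "b < ?q + f"
          using cInf_lessD[OF E_ne[OF PQR(2,3)], of "?q + f"] f by auto
        have "a + b \<in> E P R" using comp[OF a(1) b(1)] a b f by linarith
        then have "Inf (E P R) \<le> a + b" by (rule cInf_lower) (rule E_bdd)
        then show "Inf (E P R) \<le> ?p + ?q + e" using a b f by linarith
      qed
      then show ?thesis using d PQR nn True by (simp add: min_def)
    qed
  qed
qed

definition delone_topology :: "('d::finite, 'k::finite) coloured topology" where
  "delone_topology = Metric_space.mtopology {P. delone_kset P} delone_dist"

definition orbit_closure :: "('d::finite, 'k::finite) coloured \<Rightarrow> ('d, 'k) coloured set" where
  "orbit_closure P = delone_topology closure_of (range (\<lambda>g. translate (- g) P))"

definition borel_sigma :: "'x topology \<Rightarrow> 'x measure" where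
  "borel_sigma X = sigma (topspace X) {U. openin X U}"

definition invariant_prob ::
  "'x topology \<Rightarrow> ('g \<Rightarrow> 'x \<Rightarrow> 'x) \<Rightarrow> 'x measure \<Rightarrow> bool" where
  "invariant_prob X act \<mu> \<longleftrightarrow>
     prob_space \<mu> \<and> sets \<mu> = sets (borel_sigma X) \<and>
     (\<forall>g. act g \<in> measurable \<mu> \<mu> \<and> distr \<mu> \<mu> (act g) = \<mu>)"

definition uniquely_ergodic :: "'x topology \<Rightarrow> ('g \<Rightarrow> 'x \<Rightarrow> 'x) \<Rightarrow> bool" where
  "uniquely_ergodic X act \<longleftrightarrow> (\<exists>!\<mu>. invariant_prob X act \<mu>)"


section \<open>Van Hove sequences and cluster frequencies\<close>

text \<open>
  Positivity of the volumes is implicit in the quotients; it has to be explicit here because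
  division by zero yields 0.
\<close>

definition van_hove :: "(nat \<Rightarrow> (real^'d::finite) set) \<Rightarrow> bool" where
  "van_hove F \<longleftrightarrow>
     (\<forall>n. bounded (F n) \<and> F n \<in> sets lebesgue \<and> measure lebesgue (F n) > 0) \<and>
     (\<forall>r>0. (\<lambda>n. measure lebesgue {x. infdist x (frontier (F n)) \<le> r} / measure lebesgue (F n))
        \<longlonglongrightarrow> 0)"

text \<open>
  For nonempty \<open>G\<close>, bounded \<open>F\<close> and \<open>P\<close> with uniformly discrete support, the set counted here is
  finite, so \<^const>\<open>card\<close> is the true number of occurrences.
\<close>

definition occurrences ::
  "('d::finite, 'k::finite) coloured \<Rightarrow> (real^'d) set \<Rightarrow> ('d, 'k) coloured \<Rightarrow> nat" where
  "occurrences G F P = card {g. translate g G \<subseteq> P \<and> (\<lambda>x. g + x) ` support G \<subseteq> F}"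

definition uniform_cluster_frequencies ::
  "(nat \<Rightarrow> (real^'d) set) \<Rightarrow> ('d::finite, 'k::finite) coloured \<Rightarrow> bool" where
  "uniform_cluster_frequencies F P \<longleftrightarrow>
     (\<forall>G. cluster G \<longrightarrow> (\<exists>freq::real. uniform_limit UNIV
        (\<lambda>n x. real (occurrences G ((\<lambda>y. x + y) ` F n) P) / measure lebesgue (F n))
        (\<lambda>x. freq) sequentially))"


section \<open>Grids of coloured cubes\<close>

definition big_cube :: "nat \<Rightarrow> (real^'d::finite) set" where
  "big_cube m = {x. \<forall>i. - (2 ^ m) \<le> x $ i \<and> x $ i < 2 ^ m}"

definition grid_cube :: "nat \<Rightarrow> ('d \<Rightarrow> int) \<Rightarrow> (real^'d::finite) set" where
  "grid_cube m k = {x. \<forall>i. of_int (k i) / 2 ^ m \<le> x $ i \<and> x $ i < (of_int (k i) + 1) / 2 ^ m}"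

definition grid_cubes :: "nat \<Rightarrow> (real^'d::finite) set set" where
  "grid_cubes m = {grid_cube m k | k. \<forall>i. - (4 ^ m) \<le> k i \<and> k i < 4 ^ m}"

text \<open>A coloured cube is a pair \<open>(B, i)\<close>; its points are those of \<open>B \<times> {i}\<close>.\<close>

definition coloured_cubes :: "nat \<Rightarrow> ((real^'d::finite) set \<times> 'k::finite) set" where
  "coloured_cubes m = grid_cubes m \<times> UNIV"

definition cube_points :: "(real^'d::finite) set \<times> 'k::finite \<Rightarrow> ('d, 'k) coloured" where
  "cube_points C = fst C \<times> {snd C}"

definition cube_families :: "nat \<Rightarrow> ((real^'d::finite) set \<times> 'k::finite) set set" where
  "cube_families m =
     {D. D \<subseteq> coloured_cubes m \<and> D \<noteq> {} \<and> pairwise (\<lambda>C C'. fst C \<inter> fst C' = {}) D}"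

definition patterns ::
  "nat \<Rightarrow> ((real^'d::finite) set \<times> 'k::finite) set \<Rightarrow> ('d, 'k) coloured set" where
  "patterns m D =
     {P. finite P \<and> P \<subseteq> big_cube m \<times> UNIV \<and>
         (\<forall>C\<in>D. \<exists>p. P \<inter> cube_points C = {p}) \<and>
         (\<forall>C\<in>coloured_cubes m - D. P \<inter> cube_points C = {})}"

definition occurring_patterns ::
  "('d::finite, 'k::finite) coloured \<Rightarrow> nat \<Rightarrow> ((real^'d) set \<times> 'k) set \<Rightarrow> ('d, 'k) coloured set"
where
  "occurring_patterns \<Lambda> m D = {G \<in> patterns m D. \<exists>x. translate (- x) G \<subseteq> \<Lambda>}"

text \<open>
  \<open>G\<close>, restricted to the index set \<open>J\<close>, enumerates one representative of each translational
  equivalence class in \<open>\<G>\<close>. The index set is a proper initial segment of the naturals if there are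
  only finitely many classes.
\<close>

definition enumerates_representatives ::
  "('d::finite, 'k::finite) coloured set \<Rightarrow> nat set \<Rightarrow> (nat \<Rightarrow> ('d, 'k) coloured) \<Rightarrow> bool" where
  "enumerates_representatives \<G> J G \<longleftrightarrow>
     (J = UNIV \<or> (\<exists>N. J = {..<N})) \<and> G ` J \<subseteq> \<G> \<and>
     (\<forall>P\<in>\<G>. \<exists>!j. j \<in> J \<and> (\<exists>t. P = translate t (G j)))"

definition admissible_shifts ::
  "nat \<Rightarrow> ((real^'d::finite) set \<times> 'k::finite) set \<Rightarrow> ('d, 'k) coloured \<Rightarrow> (real^'d) set" where
  "admissible_shifts m D G = {t. translate t G \<in> patterns m D}"

end

theory Submission
  imports Defs
begin

text \<open>
  For continuous \<open>f\<close> on the orbit closure put \<open>\<phi> h = f (\<Lambda> - h)\<close>. Unique ergodicity follows once the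
  averages of \<open>\<phi>\<close> over \<open>h + F n\<close> become constant, uniformly in \<open>h\<close>. Indeed the limits form an invariant
  mean \<open>I\<close>; since the averages are uniform limits of finite convex combinations of translates of \<open>f\<close>,
  every invariant probability measure integrates \<open>f\<close> to \<open>I f\<close>. An invariant measure exists because
  \<open>A \<mapsto> inf {\<Sum>n. I (f n) | f n \<ge> 0 continuous, \<Sum>n. f n \<ge> 1 on A}\<close> is an invariant outer measure
  for which open sets are Caratheodory measurable.

  Up to a small uniform error, \<open>\<phi> h\<close> depends only on the set of coloured cubes of side \<open>1 / 2 ^ m\<close> that
  \<open>\<Lambda> - h\<close> meets, hence is a linear combination of indicators of the events that \<open>\<Lambda> - h\<close> meets all
  cubes of a family \<open>D\<close>. This event is the disjoint union of the sets \<open>g - V j\<close> over all occurrences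
  \<open>g + G j \<subseteq> \<Lambda>\<close>. Up to a collar of the boundary, its volume in \<open>h + F n\<close> is therefore
  \<open>\<Sum>j. Vol (V j) * L (G j) (h + F n)\<close>: finitely many terms are controlled by the cluster
  frequencies, the rest by the tail condition.
\<close>

section \<open>Invariant measures on compact metrizable spaces\<close>

text \<open>Indicators of cube events are discontinuous on the orbit closure, so uniform means are
  set up for bounded Borel functions of the base point \<open>h\<close>, and estimates along the
  orbit pass to its closure only at the end, where continuous functions are back. The event attached
  to \<open>D\<close> leaves the cubes outside \<open>D\<close> free: it can then be counted through
  occurrences of clusters, whereas prescribing empty cubes is no cluster condition. Exact codes are
  recovered afterwards by inclusion-exclusion. The main obstacle is that the patterns of one family
  may form infinitely many translation classes. Frequencies exist class by class with no uniformity
  in the class, so mass could escape to large indices and no upper bound on the volume would follow;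
  the tail condition excludes this. The sets \<open>g - V j\<close> are disjoint because the grid is
  finer than the separation of \<open>\<Lambda>\<close>: a cube holds at most one point, so the
  pattern seen from \<open>h\<close> is forced by \<open>D\<close>. Finite convex combinations are
  used because invariance of a measure applies to one translate at a time.\<close>

lemma openin_indicator_approx:
  assumes "metrizable_space X" "openin X E"
  shows "\<exists>u :: nat \<Rightarrow> 'x \<Rightarrow> real. \<forall>k. continuous_map X euclideanreal (u k) \<and>
    (\<forall>x\<in>topspace X. 0 \<le> u k x \<and> u k x \<le> u (Suc k) x \<and> u k x \<le> 1 \<and> (x \<notin> E \<longrightarrow> u k x = 0)) \<and>
    (\<forall>x\<in>E. \<forall>\<^sub>F k in sequentially. u k x = 1)"
proof -
  obtain M d where M: "Metric_space M d" "X = Metric_space.mtopology M d"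
    using assms(1) unfolding metrizable_space_def by blast
  interpret Metric_space M d by fact
  have top: "topspace X = M" by (simp add: M)
  have EM: "E \<subseteq> M" using openin_subset[OF assms(2)] top by simp
  show ?thesis
  proof (cases "E = M")
    case True
    then show ?thesis by (intro exI[of _ "\<lambda>k x. 1"]) (auto simp: top)
  next
    case False
    then obtain z where z: "z \<in> M - E" using EM by blast
    \<comment> \<open>Distance to the complement of \<open>E\<close>: 1-Lipschitz, zero off
      \<open>E\<close>, positive on \<open>E\<close>. The case \<open>E = M\<close> is treated apart
      because the infimum would range over the empty set.\<close>
    define g where "g = (\<lambda>x. INF y\<in>M - E. d x y)"
    have bdd: "bdd_below (d x ` (M - E))" for x
      by (rule bdd_belowI[of _ 0]) auto
    have g_nonneg: "0 \<le> g x" for x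
      unfolding g_def by (rule cINF_greatest) (use z in auto)
    have g_lip: "g x \<le> g y + d x y" if "x \<in> M" "y \<in> M" for x y
    proof -
      have "g x - d x y \<le> d y w" if "w \<in> M - E" for w
        using cINF_lower[OF bdd that, of x] triangle[of x y w] that \<open>x \<in> M\<close> \<open>y \<in> M\<close>
        unfolding g_def by auto
      then have "g x - d x y \<le> g y"
        unfolding g_def by (intro cINF_greatest) (use z in auto)
      then show ?thesis by simp
    qed
    have g_zero: "g x = 0" if "x \<in> M" "x \<notin> E" for x
      using cINF_lower[OF bdd, of x x] that g_nonneg[of x] by (simp add: g_def)
    have g_pos: "g x > 0" if x: "x \<in> E" for x
    proof -
      obtain r where r: "r > 0" "mball x r \<subseteq> E"
        using assms(2) x unfolding M openin_mtopology by blast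
      have "r \<le> g x"
        unfolding g_def
      proof (rule cINF_greatest)
        show "M - E \<noteq> {}" using z by auto
        show "r \<le> d x w" if "w \<in> M - E" for w
          using that r x EM by (force simp: mball_def not_le[symmetric])
      qed
      then show ?thesis using r by simp
    qed
    have cont: "continuous_map X euclideanreal g"
      unfolding M metric_continuous_map[OF Met_TC.Metric_space_axioms, simplified mtopology_is_euclidean]
    proof safe
      fix a e :: real and x assume "x \<in> M" "e > 0"
      then show "\<exists>\<delta>>0. \<forall>y. y \<in> M \<and> d x y < \<delta> \<longrightarrow> dist (g x) (g y) < e"
        using g_lip commute by (intro exI[of _ e]) (smt (verit) dist_real_def)
    qed auto
    \<comment> \<open>Truncation at 1 makes the values on \<open>E\<close> eventually equal to 1,
      not merely convergent to 1.\<close>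
    define u where "u = (\<lambda>k x. min 1 (real k * g x))"
    have "\<forall>\<^sub>F k in sequentially. u k x = 1" if "x \<in> E" for x
    proof -
      obtain n where n: "1 / g x < real n" using reals_Archimedean2 by blast
      have "u k x = 1" if "k \<ge> n" for k
      proof -
        have "1 / g x < real k" using n that by linarith
        then show ?thesis using g_pos[OF \<open>x \<in> E\<close>] by (simp add: u_def field_simps)
      qed
      then show ?thesis by (auto simp: eventually_sequentially)
    qed
    moreover have "continuous_map X euclideanreal (u k)" for k
      unfolding u_def by (intro continuous_intros cont)
    moreover have "u k x \<le> u (Suc k) x" for k x
      using g_nonneg[of x] by (simp add: u_def min_def algebra_simps)
    ultimately show ?thesis
      using g_zero g_nonneg by (intro exI[of _ u]) (auto simp: u_def top)
  qed
qed

text \<open>Functions live on the whole type, but only their values on \<open>topspace X\<close>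
  matter: \<open>I_nonneg\<close> applied to both differences gives equal means to functions that
  agree there. The index type of \<open>act\<close> carries no group structure.\<close>

locale invariant_mean =
  fixes X :: "'x topology" and act :: "'g \<Rightarrow> 'x \<Rightarrow> 'x" and I :: "('x \<Rightarrow> real) \<Rightarrow> real"
  assumes compact: "compact_space X"
    and metrizable: "metrizable_space X"
    and act_cont: "\<And>g. continuous_map X X (act g)"
    and I_add: "\<And>f h. continuous_map X euclideanreal f \<Longrightarrow> continuous_map X euclideanreal h \<Longrightarrow>
      I (\<lambda>x. f x + h x) = I f + I h"
    and I_scale: "\<And>c f. continuous_map X euclideanreal f \<Longrightarrow> I (\<lambda>x. c * f x) = c * I f"
    and I_nonneg: "\<And>f. continuous_map X euclideanreal f \<Longrightarrow> (\<And>x. x \<in> topspace X \<Longrightarrow> 0 \<le> f x) \<Longrightarrow> 0 \<le> I f"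
    and I_one: "I (\<lambda>_. 1) = 1"
    and I_act: "\<And>g f. continuous_map X euclideanreal f \<Longrightarrow> I (\<lambda>x. f (act g x)) = I f"
begin

definition nonneg_cont :: "('x \<Rightarrow> real) \<Rightarrow> bool" where
  "nonneg_cont f \<longleftrightarrow> continuous_map X euclideanreal f \<and> (\<forall>x\<in>topspace X. 0 \<le> f x)"

text \<open>The sum is taken in \<open>ennreal\<close>, so that a divergent series covers a point as
  well.\<close>

definition covers :: "'x set \<Rightarrow> (nat \<Rightarrow> 'x \<Rightarrow> real) set" where
  "covers A = {f. (\<forall>n. nonneg_cont (f n)) \<and> (\<forall>x\<in>A. 1 \<le> (\<Sum>n. ennreal (f n x)))}"

text \<open>Daniell's upper integral of the indicator of \<open>A\<close>. Open covers are replaced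
  by countable sums of continuous functions because \<open>I\<close> is controlled on continuous
  functions only.\<close>

definition outer :: "'x set \<Rightarrow> ennreal" where
  "outer A = (INF f\<in>covers A. \<Sum>n. ennreal (I (f n)))"

lemma I_mono:
  assumes "continuous_map X euclideanreal f" "continuous_map X euclideanreal h"
    and "\<And>x. x \<in> topspace X \<Longrightarrow> f x \<le> h x"
  shows "I f \<le> I h"
proof -
  have "0 \<le> I (\<lambda>x. h x + (-1) * f x)"
    using assms by (intro I_nonneg continuous_intros) auto
  also have "\<dots> = I h + (-1) * I f"
    using assms(1,2) I_add[OF assms(2), of "\<lambda>x. (-1) * f x"] I_scale[OF assms(1), of "-1"]
    by (simp add: continuous_map_real_mult_left)
  finally show ?thesis by simp
qed

lemma I_const: "I (\<lambda>_. c) = c"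
  using I_scale[of "\<lambda>_. 1" c] by (simp add: I_one)

lemma nonneg_cont_mult: "nonneg_cont f \<Longrightarrow> nonneg_cont h \<Longrightarrow> nonneg_cont (\<lambda>x. f x * h x)"
  by (auto simp: nonneg_cont_def intro!: continuous_map_real_mult)

lemma I_nonneg_cont: "nonneg_cont f \<Longrightarrow> 0 \<le> I f"
  by (auto simp: nonneg_cont_def intro: I_nonneg)

lemma outer_le: "f \<in> covers A \<Longrightarrow> outer A \<le> (\<Sum>n. ennreal (I (f n)))"
  unfolding outer_def by (rule INF_lower)

lemma outer_mono: "A \<subseteq> B \<Longrightarrow> outer A \<le> outer B"
  unfolding outer_def by (rule INF_superset_mono) (auto simp: covers_def)

text \<open>A double sequence becomes a single cover along the pairing bijection; the rearrangement
  is free for sums in \<open>ennreal\<close>. Both countable subadditivity and the splitting along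
  an open set produce covers of this shape.\<close>

lemma outer_le_double:
  assumes "\<And>i n. nonneg_cont (f i n)" and "\<And>x. x \<in> A \<Longrightarrow> 1 \<le> (\<Sum>i. \<Sum>n. ennreal (f i n x))"
  shows "outer A \<le> (\<Sum>i. \<Sum>n. ennreal (I (f i n)))"
proof -
  define h where "h = (\<lambda>k. case prod_decode k of (i, n) \<Rightarrow> f i n)"
  have sums: "(\<Sum>k. (case prod_decode k of (i, n) \<Rightarrow> F i n)) = (\<Sum>i. \<Sum>n. F i n)"
    for F :: "nat \<Rightarrow> nat \<Rightarrow> ennreal"
    using suminf_ennreal_2dimen[of "\<lambda>i. \<Sum>n. F i n" "case_prod F"] by (simp add: o_def)
  have "(\<Sum>k. ennreal (h k x)) = (\<Sum>i. \<Sum>n. ennreal (f i n x))" for x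
    unfolding sums[symmetric] h_def by (simp add: split_def)
  then have "h \<in> covers A"
    using assms by (auto simp: covers_def h_def split: prod.split)
  then have "outer A \<le> (\<Sum>k. ennreal (I (h k)))" by (rule outer_le)
  also have "\<dots> = (\<Sum>i. \<Sum>n. ennreal (I (f i n)))"
    unfolding sums[symmetric] h_def by (simp add: split_def)
  finally show ?thesis .
qed

lemma outer_measure_space_outer: "outer_measure_space (Pow (topspace X)) outer"
  unfolding outer_measure_space_def
proof (intro conjI)
  have "outer {} \<le> 0"
    using outer_le[of "\<lambda>_ _. 0" "{}"] by (simp add: covers_def nonneg_cont_def I_const)
  then show "positive (Pow (topspace X)) outer" by (simp add: positive_def)
  show "increasing (Pow (topspace X)) outer" by (auto simp: increasing_def outer_mono)
  show "countably_subadditive (Pow (topspace X)) outer"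
    unfolding countably_subadditive_def
  proof (intro allI impI)
    fix A :: "nat \<Rightarrow> 'x set"
    show "outer (\<Union>i. A i) \<le> (\<Sum>n. outer (A n))"
    proof (rule ennreal_le_epsilon)
      fix e :: real assume "0 < e" "(\<Sum>n. outer (A n)) < top"
      then have *: "outer (A n) < outer (A n) + e * (1/2)^Suc n" for n
        by (auto simp add: less_top dest!: ennreal_suminf_lessD)
      have "\<exists>f\<in>covers (A n). (\<Sum>k. ennreal (I (f k))) < outer (A n) + e * (1/2)^Suc n" for n
        using *[of n] unfolding outer_def[of "A n"] INF_less_iff by blast
      then obtain B where B: "\<And>n. B n \<in> covers (A n)"
        and Ble: "\<And>n. (\<Sum>k. ennreal (I (B n k))) \<le> outer (A n) + e * (1/2)^Suc n"
        by (metis less_imp_le)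
      have "1 \<le> (\<Sum>i. \<Sum>n. ennreal (B i n x))" if x: "x \<in> (\<Union>i. A i)" for x
      proof -
        obtain j where "x \<in> A j" using x by blast
        then have "1 \<le> (\<Sum>n. ennreal (B j n x))" using B[of j] by (auto simp: covers_def)
        also have "\<dots> \<le> (\<Sum>i. \<Sum>n. ennreal (B i n x))"
          using sum_le_suminf[of "\<lambda>i. \<Sum>n. ennreal (B i n x)" "{j}"] by simp
        finally show ?thesis .
      qed
      then have "outer (\<Union>i. A i) \<le> (\<Sum>i. \<Sum>n. ennreal (I (B i n)))"
        using B by (intro outer_le_double) (auto simp: covers_def)
      also have "\<dots> \<le> (\<Sum>n. outer (A n) + e * (1/2) ^ Suc n)"
        by (intro suminf_le Ble) auto
      also have "... = (\<Sum>n. outer (A n)) + (\<Sum>n. ennreal e * ennreal ((1/2) ^ Suc n))"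
        using \<open>0 < e\<close> by (subst suminf_add)
          (auto simp del: ennreal_suminf_cmult simp add: ennreal_mult[symmetric])
      also have "\<dots> = (\<Sum>n. outer (A n)) + e"
        unfolding ennreal_suminf_cmult
        by (subst suminf_ennreal_eq[OF zero_le_power power_half_series]) auto
      finally show "outer (\<Union>i. A i) \<le> (\<Sum>n. outer (A n)) + e" .
    qed
  qed
qed

text \<open>Splitting a cover \<open>(f n)\<close> of \<open>A\<close> along \<open>u k \<up> indicator E\<close>: the increments
  \<open>f n * (u (k + 1) - u k)\<close> cover \<open>A \<inter> E\<close>, and for each \<open>k\<close> the remainders \<open>f n * (1 - u k)\<close>
  cover \<open>A - E\<close>.\<close>

lemma outer_split_open:
  assumes E: "openin X E" and A: "A \<subseteq> topspace X"
  shows "outer (A \<inter> E) + outer (A - E) \<le> outer A"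
  unfolding outer_def[of A]
proof (rule INF_greatest)
  fix f assume f: "f \<in> covers A"
  obtain u :: "nat \<Rightarrow> 'x \<Rightarrow> real" where u: "\<And>k. continuous_map X euclideanreal (u k)"
    "\<And>k x. x \<in> topspace X \<Longrightarrow> 0 \<le> u k x \<and> u k x \<le> u (Suc k) x \<and> u k x \<le> 1"
    "\<And>k x. x \<in> topspace X \<Longrightarrow> x \<notin> E \<Longrightarrow> u k x = 0"
    "\<And>x. x \<in> E \<Longrightarrow> \<forall>\<^sub>F k in sequentially. u k x = 1"
    using openin_indicator_approx[OF metrizable E] by metis
  \<comment> \<open>A zero is put in front of the \<open>u k\<close>, so that the increments
    telescope from 0 and the remainder at stage 0 is the whole cover.\<close>
  define w where "w = (\<lambda>k. case k of 0 \<Rightarrow> (\<lambda>_. 0) | Suc j \<Rightarrow> u j)"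
  define v where "v = (\<lambda>k x. w (Suc k) x - w k x)"
  have w: "continuous_map X euclideanreal (w k)" for k
    by (cases k) (auto simp: w_def u)
  have w_bd: "0 \<le> w k x" "w k x \<le> w (Suc k) x" "w k x \<le> 1" if "x \<in> topspace X" for k x
    using u(2)[OF that] by (auto simp: w_def split: nat.split)
  have nonneg_cont_v: "nonneg_cont (v k)" and nonneg_cont_w: "nonneg_cont (\<lambda>x. 1 - w k x)" for k
    using w_bd by (auto simp: nonneg_cont_def v_def intro!: continuous_map_diff w)
  have nonneg_cont_f: "nonneg_cont (f n)" for n using f by (auto simp: covers_def)
  have v_sum: "(\<Sum>k. ennreal (v k x)) = 1" if "x \<in> E" for x
  proof -
    have "x \<in> topspace X" using that openin_subset[OF E] by blast
    have "\<forall>\<^sub>F k in sequentially. w (Suc k) x = 1" using u(4)[OF that] by (simp add: w_def)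
    then have "\<forall>\<^sub>F k in sequentially. w k x = 1" by (subst (asm) eventually_sequentially_Suc)
    then have "(\<lambda>k. w k x) \<longlonglongrightarrow> 1" by (rule tendsto_eventually)
    then have "(\<lambda>k. v k x) sums (1 - w 0 x)" unfolding v_def by (rule telescope_sums)
    then have "(\<lambda>k. v k x) sums 1" by (simp add: w_def)
    then show ?thesis
      using nonneg_cont_v \<open>x \<in> topspace X\<close> by (subst suminf_ennreal_eq[of _ 1]) (auto simp: nonneg_cont_def)
  qed
  have "outer (A \<inter> E) \<le> (\<Sum>k. \<Sum>n. ennreal (I (\<lambda>x. v k x * f n x)))"
  proof (rule outer_le_double)
    show "nonneg_cont (\<lambda>x. v k x * f n x)" for k n by (rule nonneg_cont_mult[OF nonneg_cont_v nonneg_cont_f])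
    fix x assume x: "x \<in> A \<inter> E"
    have "(\<Sum>k. \<Sum>n. ennreal (v k x * f n x)) = (\<Sum>k. ennreal (v k x)) * (\<Sum>n. ennreal (f n x))"
      using nonneg_cont_v nonneg_cont_f x A by (subst ennreal_mult) (auto simp: nonneg_cont_def)
    also have "\<dots> = (\<Sum>n. ennreal (f n x))" using v_sum x by simp
    also have "\<dots> \<ge> 1" using f x by (auto simp: covers_def)
    finally show "1 \<le> (\<Sum>k. \<Sum>n. ennreal (v k x * f n x))" .
  qed
  moreover have "(\<Sum>k. \<Sum>n. ennreal (I (\<lambda>x. v k x * f n x))) + outer (A - E) \<le> (\<Sum>n. ennreal (I (f n)))"
  \<comment> \<open>It suffices to bound each partial sum over \<open>k < N\<close>. At every stage
    the increments so far and the remainder add up exactly to the cost of \<open>f\<close>, and the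
    remainder still covers \<open>A - E\<close> because \<open>w N\<close> vanishes off
    \<open>E\<close>.\<close>
  proof (rule ennreal_suminf_bound_add)
    fix N
    have eq: "(\<Sum>k<N. \<Sum>n. ennreal (I (\<lambda>x. v k x * f n x))) +
        (\<Sum>n. ennreal (I (\<lambda>x. (1 - w N x) * f n x))) = (\<Sum>n. ennreal (I (f n)))"
    proof (induction N)
      case 0
      then show ?case by (simp add: w_def)
    next
      case (Suc N)
      have "ennreal (I (\<lambda>x. (1 - w N x) * f n x)) =
          ennreal (I (\<lambda>x. v N x * f n x)) + ennreal (I (\<lambda>x. (1 - w (Suc N) x) * f n x))" for n
      proof -
        have "I (\<lambda>x. (1 - w N x) * f n x) = I (\<lambda>x. v N x * f n x + (1 - w (Suc N) x) * f n x)"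
          by (rule arg_cong[of _ _ I]) (simp add: v_def algebra_simps)
        also have "\<dots> = I (\<lambda>x. v N x * f n x) + I (\<lambda>x. (1 - w (Suc N) x) * f n x)"
          using nonneg_cont_mult[OF nonneg_cont_v nonneg_cont_f] nonneg_cont_mult[OF nonneg_cont_w nonneg_cont_f]
          by (intro I_add) (auto simp: nonneg_cont_def)
        finally show ?thesis
          using I_nonneg_cont[OF nonneg_cont_mult[OF nonneg_cont_v nonneg_cont_f]] I_nonneg_cont[OF nonneg_cont_mult[OF nonneg_cont_w nonneg_cont_f]]
          by (simp add: ennreal_plus)
      qed
      then have "(\<Sum>n. ennreal (I (\<lambda>x. (1 - w N x) * f n x))) =
          (\<Sum>n. ennreal (I (\<lambda>x. v N x * f n x))) + (\<Sum>n. ennreal (I (\<lambda>x. (1 - w (Suc N) x) * f n x)))"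
        by (simp add: suminf_add)
      then show ?case using Suc by (simp add: add.assoc)
    qed
    have "outer (A - E) \<le> (\<Sum>n. ennreal (I (\<lambda>x. (1 - w N x) * f n x)))"
    proof (rule outer_le)
      have "w N x = 0" if "x \<in> A - E" for x
        using u(3)[of x] that A by (auto simp: w_def split: nat.split)
      then show "(\<lambda>n x. (1 - w N x) * f n x) \<in> covers (A - E)"
        using f nonneg_cont_mult[OF nonneg_cont_w nonneg_cont_f] by (auto simp: covers_def)
    qed
    then show "(\<Sum>k<N. \<Sum>n. ennreal (I (\<lambda>x. v k x * f n x))) + outer (A - E) \<le> (\<Sum>n. ennreal (I (f n)))"
      unfolding eq[symmetric] by (rule add_left_mono)
  qed
  ultimately show "outer (A \<inter> E) + outer (A - E) \<le> (\<Sum>n. ennreal (I (f n)))"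
    by (meson add_right_mono order_trans)
qed

text \<open>Dini's argument: by compactness some partial sum of a cover exceeds \<open>1 - e\<close> everywhere.\<close>

lemma outer_space: "outer (topspace X) = 1"
proof (rule antisym)
  define f where "f = (\<lambda>n::nat. if n = 0 then (\<lambda>_::'x. 1::real) else (\<lambda>_. 0))"
  have s: "(\<Sum>n::nat. if n = 0 then 1 else (0::ennreal)) = 1"
    using suminf_finite[of "{0}" "\<lambda>n. if n = 0 then 1 else (0::ennreal)"] by simp
  have e: "ennreal (f n x) = (if n = 0 then 1 else 0)" "ennreal (I (f n)) = (if n = 0 then 1 else 0)" for n x
    by (auto simp: f_def I_const)
  have "f \<in> covers (topspace X)" unfolding covers_def mem_Collect_eq e s by (auto simp: f_def nonneg_cont_def)
  from outer_le[OF this] show "outer (topspace X) \<le> 1" by (simp only: e s)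
  show "1 \<le> outer (topspace X)"
    unfolding outer_def
  proof (rule INF_greatest)
    fix f assume f: "f \<in> covers (topspace X)"
    have nonneg_cont_f: "nonneg_cont (f n)" for n using f by (auto simp: covers_def)
    show "1 \<le> (\<Sum>n. ennreal (I (f n)))"
    proof (rule ennreal_le_epsilon)
      fix e :: real assume e: "e > 0"
      define S where "S = (\<lambda>N x. \<Sum>n<N. f n x)"
      define U where "U = (\<lambda>N. {x \<in> topspace X. S N x \<in> {1 - e<..}})"
      have contS: "continuous_map X euclideanreal (S N)" for N
        unfolding S_def using nonneg_cont_f by (intro continuous_intros) (auto simp: nonneg_cont_def)
      have opU: "openin X (U N)" for N
        unfolding U_def by (rule openin_continuous_map_preimage[OF contS]) auto
      have Smono: "S N x \<le> S N' x" if "x \<in> topspace X" "N \<le> N'" for x N N'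
        unfolding S_def using that nonneg_cont_f by (intro sum_mono2) (auto simp: nonneg_cont_def)
      have cov: "topspace X \<subseteq> \<Union>(range U)"
      proof
        fix x assume x: "x \<in> topspace X"
        have pos: "0 \<le> f n x" for n using nonneg_cont_f x by (auto simp: nonneg_cont_def)
        have "\<exists>N. 1 - e < S N x"
        proof (rule ccontr)
          assume "\<nexists>N. 1 - e < S N x"
          then have le: "S N x \<le> 1 - e" for N by (simp add: not_less)
          have "(\<Sum>n<N. ennreal (f n x)) \<le> ennreal (1 - e)" for N
            using le[of N] pos by (simp add: S_def sum_ennreal ennreal_leI)
          then have "(\<Sum>n. ennreal (f n x)) \<le> ennreal (1 - e)"
            by (intro suminf_le_const) auto
          moreover have "1 \<le> (\<Sum>n. ennreal (f n x))" using f x by (auto simp: covers_def)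
          ultimately have "ennreal 1 \<le> ennreal (1 - e)" by (metis ennreal_1 order_trans)
          then show False using e by (subst (asm) ennreal_le_iff2) auto
        qed
        then show "x \<in> \<Union>(range U)" using x by (auto simp: U_def)
      qed
      obtain \<F> where F: "finite \<F>" "\<F> \<subseteq> range U" "topspace X \<subseteq> \<Union>\<F>"
        using compact cov opU unfolding compact_space_alt
        by (metis (no_types, lifting) image_iff)
      then obtain K where K: "finite K" "\<F> = U ` K" by (meson finite_subset_image)
      define N where "N = Max (insert 0 K)"
      have "1 - e \<le> S N x" if x: "x \<in> topspace X" for x
      proof -
        obtain k where "k \<in> K" "x \<in> U k" using F K x by blast
        then show ?thesis using Smono[OF x, of k N] K(1) by (auto simp: U_def N_def)
      qed
      then have "I (\<lambda>_. 1 - e) \<le> I (S N)" by (intro I_mono contS) auto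
      also have "I (S N) = (\<Sum>n<N. I (f n))"
      proof (induction N)
        case 0
        then show ?case by (simp add: S_def I_const)
      next
        case (Suc N)
        have "S (Suc N) = (\<lambda>x. S N x + f N x)" by (simp add: S_def)
        then show ?case using Suc contS nonneg_cont_f[of N] by (simp add: I_add nonneg_cont_def)
      qed
      finally have "1 \<le> (\<Sum>n<N. I (f n)) + e" by (simp add: I_const)
      then have "ennreal 1 \<le> ennreal ((\<Sum>n<N. I (f n)) + e)" by (rule ennreal_leI)
      also have "\<dots> = (\<Sum>n<N. ennreal (I (f n))) + ennreal e"
        using e I_nonneg_cont[OF nonneg_cont_f] by (simp add: sum_nonneg sum_ennreal)
      also have "\<dots> \<le> (\<Sum>n. ennreal (I (f n))) + ennreal e"
        by (intro add_right_mono sum_le_suminf) auto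
      finally show "1 \<le> (\<Sum>n. ennreal (I (f n))) + ennreal e" by simp
    qed
  qed
qed

text \<open>Composition with \<open>act g\<close> turns a cover of \<open>A\<close> into a cover of
  the preimage, and \<open>I_act\<close> keeps its cost. Only one inequality results, since covers
  of the preimage need not arise by composition.\<close>

lemma outer_act: "outer (act g -` A \<inter> topspace X) \<le> outer A"
  unfolding outer_def[of A]
proof (rule INF_greatest)
  fix f assume f: "f \<in> covers A"
  have act: "x \<in> topspace X \<Longrightarrow> act g x \<in> topspace X" for x
    using act_cont[of g] by (auto simp: continuous_map_def)
  have cf: "continuous_map X euclideanreal (f n)" for n
    using f by (auto simp: covers_def nonneg_cont_def)
  have "nonneg_cont (\<lambda>x. f n (act g x))" for n
    using continuous_map_compose[OF act_cont cf] f act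
    by (auto simp: nonneg_cont_def covers_def o_def)
  then have "(\<lambda>n x. f n (act g x)) \<in> covers (act g -` A \<inter> topspace X)"
    using f by (auto simp: covers_def)
  from outer_le[OF this] show "outer (act g -` A \<inter> topspace X) \<le> (\<Sum>n. ennreal (I (f n)))"
    by (simp add: I_act cf)
qed

theorem exists_invariant_prob: "\<exists>\<mu>. invariant_prob X act \<mu>"
proof -
  let ?\<Omega> = "topspace X"
  let ?L = "lambda_system ?\<Omega> (Pow ?\<Omega>) outer"
  have ms: "measure_space ?\<Omega> ?L outer"
    using sigma_algebra.caratheodory_lemma[OF sigma_algebra_Pow outer_measure_space_outer] .
  then have saL: "sigma_algebra ?\<Omega> ?L" by (simp add: measure_space_def)
  have subadd: "outer A \<le> outer (A \<inter> E) + outer (A - E)" if "A \<subseteq> ?\<Omega>" for A E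
  proof -
    have "subadditive (Pow ?\<Omega>) outer"
      using outer_measure_space_outer
      by (intro ring_of_sets.countably_subadditive_subadditive[OF ring_of_sets_Pow])
        (auto simp: outer_measure_space_def)
    then have "outer ((A \<inter> E) \<union> (A - E)) \<le> outer (A \<inter> E) + outer (A - E)"
      by (rule subadditiveD) (use that in auto)
    then show ?thesis by (simp add: Int_Diff_Un)
  qed
  have "U \<in> ?L" if "openin X U" for U
    using openin_subset[OF that] outer_split_open[OF that] subadd
    by (auto simp: algebra.lambda_system_eq[OF algebra_Pow] intro!: antisym)
  then have sub: "sigma_sets ?\<Omega> {U. openin X U} \<subseteq> ?L"
    by (intro sigma_algebra.sigma_sets_subset[OF saL]) auto
  define \<mu> where "\<mu> = measure_of ?\<Omega> {U. openin X U} outer"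
  have Po: "{U. openin X U} \<subseteq> Pow ?\<Omega>" using openin_subset by auto
  \<comment> \<open>Caratheodory's theorem gives a measure on the larger class \<open>?L\<close>.
    Restricting it to the Borel sets ensures that \<open>measure_of\<close> returns
    \<open>outer\<close> there; for a set function that is not a measure it would default to
    0.\<close>
  have ms2: "measure_space ?\<Omega> (sigma_sets ?\<Omega> {U. openin X U}) outer"
    by (rule measure_down[OF ms sigma_algebra_sigma_sets[OF Po] sub])
  have sp: "space \<mu> = ?\<Omega>" by (simp add: \<mu>_def space_measure_of[OF Po])
  have sets: "sets \<mu> = sigma_sets ?\<Omega> {U. openin X U}" by (simp add: \<mu>_def sets_measure_of[OF Po])
  have em: "emeasure \<mu> A = outer A" if "A \<in> sets \<mu>" for A
    using emeasure_measure_of_sigma[of ?\<Omega> "sigma_sets ?\<Omega> {U. openin X U}" outer A] ms2 that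
    unfolding sets by (simp add: \<mu>_def measure_space_def emeasure_measure_of_conv sigma_sets_sigma_sets_eq[OF Po])
  have prob: "prob_space \<mu>"
    using em[of ?\<Omega>] sets.top[of \<mu>] by (intro prob_spaceI) (simp add: sp outer_space)
  interpret prob_space \<mu> by (rule prob)
  have meas: "act g \<in> measurable \<mu> \<mu>" for g
  proof (rule measurable_sigma_sets[OF sets Po])
    show "act g \<in> space \<mu> \<rightarrow> ?\<Omega>"
      using act_cont[of g] by (auto simp: sp continuous_map_def)
    show "act g -` U \<inter> space \<mu> \<in> sets \<mu>" if "U \<in> {U. openin X U}" for U
    proof -
      have "openin X {x \<in> ?\<Omega>. act g x \<in> U}"
        using openin_continuous_map_preimage[OF act_cont] that by blast
      moreover have "{x \<in> ?\<Omega>. act g x \<in> U} = act g -` U \<inter> space \<mu>" by (auto simp: sp)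
      ultimately show ?thesis unfolding sets by (auto intro: sigma_sets.Basic)
    qed
  qed
  have le: "prob (act g -` A \<inter> space \<mu>) \<le> prob A" if "A \<in> sets \<mu>" for g A
  proof -
    have "emeasure \<mu> (act g -` A \<inter> space \<mu>) \<le> emeasure \<mu> A"
      using outer_act[of g A] em[OF that] em[OF measurable_sets[OF meas that, of g]] by (simp add: sp)
    then show ?thesis by (simp add: emeasure_eq_measure)
  qed
  \<comment> \<open>The reverse inequality is \<open>le\<close> for the complement, since the total
    mass is 1.\<close>
  have eq: "prob (act g -` A \<inter> space \<mu>) = prob A" if "A \<in> sets \<mu>" for g A
  proof (rule antisym[OF le[OF that]])
    have "act g -` (space \<mu> - A) \<inter> space \<mu> = space \<mu> - (act g -` A \<inter> space \<mu>)"
      using measurable_space[OF meas] by auto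
    then have "1 - prob (act g -` A \<inter> space \<mu>) \<le> 1 - prob A"
      using le[of "space \<mu> - A" g] that measurable_sets[OF meas that, of g]
      by (simp add: prob_compl)
    then show "prob A \<le> prob (act g -` A \<inter> space \<mu>)" by simp
  qed
  have "distr \<mu> \<mu> (act g) = \<mu>" for g
    by (rule measure_eqI) (auto simp: emeasure_distr meas emeasure_eq_measure eq)
  then have "invariant_prob X act \<mu>"
    using prob meas by (simp add: invariant_prob_def borel_sigma_def sets sets_measure_of[OF Po])
  then show ?thesis ..
qed

end

section \<open>Borel probability measures and integrals of continuous functions\<close>

lemma borel_sigma_measurable:
  assumes "sets \<mu> = sets (borel_sigma X)" "continuous_map X euclideanreal f"
  shows "f \<in> borel_measurable \<mu>"
proof -
  have Po: "{U. openin X U} \<subseteq> Pow (topspace X)" using openin_subset by auto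
  have sets: "sets \<mu> = sigma_sets (topspace X) {U. openin X U}"
    using assms(1) by (simp add: borel_sigma_def sets_measure_of[OF Po])
  then have sp: "space \<mu> = topspace X"
    using sets_eq_imp_space_eq[OF assms(1)] by (simp add: borel_sigma_def space_measure_of[OF Po])
  show ?thesis
  proof (rule borel_measurableI)
    fix S :: "real set" assume "open S"
    then have "openin X {x \<in> topspace X. f x \<in> S}"
      using openin_continuous_map_preimage[OF assms(2)] by simp
    moreover have "{x \<in> topspace X. f x \<in> S} = f -` S \<inter> space \<mu>" by (auto simp: sp)
    ultimately show "f -` S \<inter> space \<mu> \<in> sets \<mu>" unfolding sets by (auto intro: sigma_sets.Basic)
  qed
qed

text \<open>Open sets form an intersection-stable generator, and the indicator of an open set is a
  pointwise limit of continuous functions with values in the unit interval; dominated convergence by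
  the constant 1 transfers the equality of integrals.\<close>

lemma prob_eqI_integral_continuous:
  assumes X: "metrizable_space X"
    and \<mu>: "prob_space \<mu>" "sets \<mu> = sets (borel_sigma X)"
    and \<nu>: "prob_space \<nu>" "sets \<nu> = sets (borel_sigma X)"
    and eq: "\<And>f. continuous_map X euclideanreal f \<Longrightarrow> (\<And>x. x \<in> topspace X \<Longrightarrow> 0 \<le> f x \<and> f x \<le> 1) \<Longrightarrow>
      integral\<^sup>L \<mu> f = integral\<^sup>L \<nu> f"
  shows "\<mu> = \<nu>"
proof -
  have Po: "{U. openin X U} \<subseteq> Pow (topspace X)" using openin_subset by auto
  have sets: "sets (borel_sigma X) = sigma_sets (topspace X) {U. openin X U}"
    by (simp add: borel_sigma_def sets_measure_of[OF Po])
  have space: "space \<rho> = topspace X" if "sets \<rho> = sets (borel_sigma X)" for \<rho> :: "'a measure"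
    using sets_eq_imp_space_eq[OF that] by (simp add: borel_sigma_def space_measure_of[OF Po])
  have lim: "(\<lambda>k. integral\<^sup>L \<rho> (u k)) \<longlonglongrightarrow> measure \<rho> U"
    if "prob_space \<rho>" and s: "sets \<rho> = sets (borel_sigma X)" and U: "openin X U"
      and u: "\<And>k. continuous_map X euclideanreal (u k)"
       "\<And>k x. x \<in> topspace X \<Longrightarrow> 0 \<le> u k x \<and> u k x \<le> 1 \<and> (x \<notin> U \<longrightarrow> u k x = 0)"
       "\<And>x. x \<in> U \<Longrightarrow> \<forall>\<^sub>F k in sequentially. u k x = 1"
    for \<rho> U and u :: "nat \<Rightarrow> 'a \<Rightarrow> real"
  proof -
    interpret prob_space \<rho> by fact
    have "U \<in> sets \<rho>" unfolding s sets using U by (auto intro: sigma_sets.Basic)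
    have "(\<lambda>k. integral\<^sup>L \<rho> (u k)) \<longlonglongrightarrow> integral\<^sup>L \<rho> (indicator U)"
    proof (rule integral_dominated_convergence[where w = "\<lambda>_. 1"])
      show "indicat_real U \<in> borel_measurable \<rho>" using \<open>U \<in> sets \<rho>\<close> by simp
      show "u k \<in> borel_measurable \<rho>" for k using borel_sigma_measurable[OF s u(1)] .
      show "AE x in \<rho>. (\<lambda>k. u k x) \<longlonglongrightarrow> indicat_real U x"
      proof (rule AE_I2)
        fix x assume x: "x \<in> space \<rho>"
        have "\<forall>\<^sub>F k in sequentially. u k x = indicat_real U x"
          using u(2,3)[of x] x by (cases "x \<in> U") (auto simp: space[OF s])
        then show "(\<lambda>k. u k x) \<longlonglongrightarrow> indicat_real U x" by (rule tendsto_eventually)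
      qed
      show "AE x in \<rho>. norm (u k x) \<le> 1" for k
        using u(2) by (intro AE_I2) (auto simp: space[OF s])
    qed simp
    then show ?thesis using \<open>U \<in> sets \<rho>\<close> by simp
  qed
  show ?thesis
  proof (rule measure_eqI_generator_eq[where \<Omega> = "topspace X" and E = "{U. openin X U}" and A = "\<lambda>_. topspace X"])
    show "Int_stable {U. openin X U}" by (auto simp: Int_stable_def)
    fix U assume "U \<in> {U. openin X U}"
    then have U: "openin X U" by simp
    obtain u :: "nat \<Rightarrow> 'a \<Rightarrow> real" where u: "\<And>k. continuous_map X euclideanreal (u k)"
       "\<And>k x. x \<in> topspace X \<Longrightarrow> 0 \<le> u k x \<and> u k x \<le> 1 \<and> (x \<notin> U \<longrightarrow> u k x = 0)"
       "\<And>x. x \<in> U \<Longrightarrow> \<forall>\<^sub>F k in sequentially. u k x = 1"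
      using openin_indicator_approx[OF X U] by metis
    have "integral\<^sup>L \<mu> (u k) = integral\<^sup>L \<nu> (u k)" for k using u by (intro eq) auto
    then have "measure \<mu> U = measure \<nu> U"
      using lim[OF \<mu> U u] lim[OF \<nu> U u] by (simp add: LIMSEQ_unique)
    then show "emeasure \<mu> U = emeasure \<nu> U"
      using \<mu>(1) \<nu>(1) by (simp add: finite_measure.emeasure_eq_measure prob_space.finite_measure)
  next
    show "emeasure \<mu> (topspace X) \<noteq> \<infinity>" for i :: nat
      using \<mu> prob_space.emeasure_space_1[of \<mu>] by (simp add: space)
  qed (use \<mu> \<nu> sets Po in auto)
qed

section \<open>The grid\<close>

text \<open>The integer parts of the scaled coordinates determine the cube of a point; covering and
  disjointness of the half-open cubes both reduce to this.\<close>

lemma grid_cube_iff: "x \<in> grid_cube m k \<longleftrightarrow> k = (\<lambda>i. \<lfloor>2 ^ m * x $ i\<rfloor>)"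
proof -
  have "(of_int a / 2 ^ m \<le> y \<and> y < (of_int a + 1) / 2 ^ m) \<longleftrightarrow> a = \<lfloor>2 ^ m * y\<rfloor>" for a and y :: real
  proof -
    have "of_int a / 2 ^ m \<le> y \<and> y < (of_int a + 1) / 2 ^ m \<longleftrightarrow> of_int a \<le> 2 ^ m * y \<and> 2 ^ m * y < of_int a + 1"
      by (simp add: field_simps)
    also have "\<dots> \<longleftrightarrow> a = \<lfloor>2 ^ m * y\<rfloor>" using floor_eq_iff[of "2 ^ m * y" a] by auto
    finally show ?thesis .
  qed
  then show ?thesis by (auto simp: grid_cube_def)
qed

lemma big_cube_iff:
  "x \<in> big_cube m \<longleftrightarrow> (\<forall>i. - (4 ^ m) \<le> \<lfloor>2 ^ m * x $ i\<rfloor> \<and> \<lfloor>2 ^ m * x $ i\<rfloor> < 4 ^ m)"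
proof -
  have 4: "(4::real) ^ m = 2 ^ m * 2 ^ m" by (simp add: power_mult_distrib[symmetric])
  have "- (2 ^ m) \<le> y \<and> y < 2 ^ m \<longleftrightarrow> - (4 ^ m) \<le> \<lfloor>2 ^ m * y\<rfloor> \<and> \<lfloor>2 ^ m * y\<rfloor> < 4 ^ m" for y :: real
  proof -
    have "- (2 ^ m) \<le> y \<longleftrightarrow> 2 ^ m * (- (2 ^ m)) \<le> 2 ^ m * y" by (subst mult_le_cancel_left_pos) auto
    also have "\<dots> \<longleftrightarrow> - (4 ^ m) \<le> \<lfloor>2 ^ m * y\<rfloor>" by (simp add: le_floor_iff 4)
    finally have 1: "- (2 ^ m) \<le> y \<longleftrightarrow> - (4 ^ m) \<le> \<lfloor>2 ^ m * y\<rfloor>" .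
    have "y < 2 ^ m \<longleftrightarrow> 2 ^ m * y < 2 ^ m * 2 ^ m" by (subst mult_less_cancel_left_pos) auto
    also have "\<dots> \<longleftrightarrow> \<lfloor>2 ^ m * y\<rfloor> < 4 ^ m" by (simp add: floor_less_iff 4)
    finally show ?thesis using 1 by simp
  qed
  then show ?thesis by (simp add: big_cube_def)
qed

lemma Union_grid_cubes: "\<Union>(grid_cubes m) = big_cube m"
proof (rule set_eqI)
  fix x :: "real^'a"
  have "x \<in> \<Union>(grid_cubes m) \<longleftrightarrow> (\<exists>k. (\<forall>i. - (4 ^ m) \<le> k i \<and> k i < 4 ^ m) \<and> x \<in> grid_cube m k)"
    unfolding grid_cubes_def by blast
  then show "x \<in> \<Union>(grid_cubes m) \<longleftrightarrow> x \<in> big_cube m"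
    by (simp add: grid_cube_iff big_cube_iff)
qed

lemma grid_cubes_eq: "B \<in> grid_cubes m \<Longrightarrow> B' \<in> grid_cubes m \<Longrightarrow> x \<in> B \<Longrightarrow> x \<in> B' \<Longrightarrow> B = B'"
  by (auto simp: grid_cubes_def grid_cube_iff)

lemma finite_grid_cubes: "finite (grid_cubes m :: (real^'d::finite) set set)"
proof -
  have "{k :: 'd \<Rightarrow> int. \<forall>i. - (4 ^ m) \<le> k i \<and> k i < 4 ^ m} = PiE UNIV (\<lambda>_. {- (4 ^ m)..<4 ^ m})"
    by (auto simp: PiE_def Pi_def)
  then have "finite {k :: 'd \<Rightarrow> int. \<forall>i. - (4 ^ m) \<le> k i \<and> k i < 4 ^ m}" by (simp add: finite_PiE)
  then show ?thesis by (simp add: grid_cubes_def setcompr_eq_image)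
qed

lemma grid_cube_component_less:
  assumes "B \<in> grid_cubes m" "x \<in> B" "y \<in> B"
  shows "\<bar>x $ i - y $ i\<bar> < 1 / 2 ^ m"
proof -
  obtain k where k: "B = grid_cube m k" using assms(1) by (auto simp: grid_cubes_def)
  have "of_int (k i) / 2 ^ m \<le> z $ i \<and> z $ i < of_int (k i) / 2 ^ m + 1 / 2 ^ m" if "z \<in> B" for z
    using that unfolding k grid_cube_def by (simp add: add_divide_distrib)
  from this[OF assms(2)] this[OF assms(3)] show ?thesis by linarith
qed

lemma infnorm_grid_cube:
  assumes "B \<in> grid_cubes m" "x \<in> B" "y \<in> B"
  shows "infnorm (x - y) < 1 / 2 ^ m"
proof -
  have "infnorm (x - y) = Max (range (\<lambda>i. \<bar>(x - y) $ i\<bar>))"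
    by (simp add: infnorm_cart full_SetCompr_eq cSup_eq_Max)
  also have "\<dots> < 1 / 2 ^ m" using grid_cube_component_less[OF assms] by (subst Max_less_iff) auto
  finally show ?thesis .
qed

lemma dist_grid_cube:
  fixes x y :: "real^'d::finite"
  assumes "B \<in> grid_cubes m" "x \<in> B" "y \<in> B"
  shows "dist x y \<le> CARD('d) / 2 ^ m"
proof -
  have "dist x y \<le> (\<Sum>i\<in>UNIV. \<bar>(x - y) $ i\<bar>)" unfolding dist_norm by (rule norm_le_l1_cart)
  also have "\<dots> \<le> (\<Sum>i\<in>(UNIV::'d set). 1 / 2 ^ m)"
    using grid_cube_component_less[OF assms] by (intro sum_mono) (simp add: less_imp_le)
  finally show ?thesis by simp
qed

lemma norm_big_cube:
  fixes x :: "real^'d::finite"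
  assumes "x \<in> big_cube m"
  shows "norm x \<le> CARD('d) * 2 ^ m"
proof -
  have "norm x \<le> (\<Sum>i\<in>UNIV. \<bar>x $ i\<bar>)" by (rule norm_le_l1_cart)
  also have "\<dots> \<le> (\<Sum>i\<in>(UNIV::'d set). 2 ^ m)"
    using assms by (intro sum_mono) (auto simp: big_cube_def abs_le_iff less_imp_le minus_le_iff)
  finally show ?thesis by simp
qed

lemma mem_big_cube: 
  assumes "norm x < 2 ^ m" shows "x \<in> big_cube m"
proof -
  have "- (2 ^ m) \<le> x $ i \<and> x $ i < 2 ^ m" for i
    using component_le_norm_cart[of x i] assms by linarith
  then show ?thesis by (simp add: big_cube_def)
qed

lemma grid_cube_borel: "B \<in> grid_cubes m \<Longrightarrow> B \<in> sets borel"
  by (auto simp: grid_cubes_def grid_cube_def)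

section \<open>Delone sets with fixed parameters\<close>

lemma mem_translate_iff: "(x, i) \<in> translate t P \<longleftrightarrow> (x - t, i) \<in> P"
  unfolding translate_def by (auto simp: image_iff intro!: bexI[of _ "(x - t, i)"])

lemma translate_translate: "translate s (translate t P) = translate (s + t) P"
  by (auto simp: mem_translate_iff set_eq_iff algebra_simps)

lemma translate_0: "translate 0 P = P"
  by (auto simp: mem_translate_iff set_eq_iff)

lemma eps_close_iff:
  "eps_close e P Q \<longleftrightarrow>
    (\<forall>x i. (x, i) \<in> Q \<and> norm x < 1 / e \<longrightarrow> (\<exists>y. (y, i) \<in> P \<and> dist x y < e)) \<and>
    (\<forall>x i. (x, i) \<in> P \<and> norm x < 1 / e \<longrightarrow> (\<exists>y. (y, i) \<in> Q \<and> dist x y < e))"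
proof -
  have thick: "(x, i) \<in> thicken R (ball 0 e) \<longleftrightarrow> (\<exists>y. (y, i) \<in> R \<and> dist x y < e)"
    for x i and R :: "('a, 'b) coloured"
  proof
    assume "\<exists>y. (y, i) \<in> R \<and> dist x y < e"
    then obtain y where "(y, i) \<in> R" "x - y \<in> ball 0 e"
      by (metis dist_norm dist_0_norm mem_ball)
    then show "(x, i) \<in> thicken R (ball 0 e)"
      unfolding thicken_def by (intro CollectI exI[of _ y] exI[of _ "x - y"] exI[of _ i]) simp
  qed (auto simp: thicken_def dist_norm)
  show ?thesis
    unfolding eps_close_def restrict_to_def subset_iff split_paired_All
    by (auto simp: thick)
qed

lemma eps_close_mono:
  assumes "eps_close a P Q" "0 < a" "a \<le> b"
  shows "eps_close b P Q"
proof -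
  have ab: "1 / b \<le> 1 / a" using assms by (auto intro!: divide_left_mono)
  then have "norm x < 1 / a" if "norm x < 1 / b" for x :: "real^'a" using that by linarith
  moreover have "dist x y < b" if "dist x y < a" for x y :: "real^'a" using that assms by linarith
  ultimately show ?thesis using assms(1) unfolding eps_close_iff by blast
qed

text \<open>Non-strict density radii are encoded as \<open>\<forall>s > R\<close>, which makes the class closed without any
  appeal to local finiteness.\<close>

definition delone_class :: "real \<Rightarrow> real \<Rightarrow> ('d::finite, 'k::finite) coloured set" where
  "delone_class r R = {P.
    (\<forall>y i z j. (y, i) \<in> P \<and> (z, j) \<in> P \<and> dist y z < r \<longrightarrow> y = z \<and> i = j) \<and>
    (\<forall>x i. \<forall>s>R. \<exists>y. (y, i) \<in> P \<and> dist x y < s)}"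

lemma delone_class_unique:
  "P \<in> delone_class r R \<Longrightarrow> (y, i) \<in> P \<Longrightarrow> (z, j) \<in> P \<Longrightarrow> dist y z < r \<Longrightarrow> y = z \<and> i = j"
  unfolding delone_class_def by blast

lemma delone_class_dense:
  "P \<in> delone_class r R \<Longrightarrow> R < s \<Longrightarrow> \<exists>y. (y, i) \<in> P \<and> dist x y < s"
  unfolding delone_class_def by blast

text \<open>\<open>R\<close> is the largest of the finitely many density radii of the colours.
  \<open>r\<close> separates the whole support, hence also points of different colours, and
  \<open>kset\<close> excludes two colours at one point.\<close>

lemma delone_kset_in_class:
  assumes "delone_kset P"
  obtains r R where "r > 0" "P \<in> delone_class r R"
proof -
  have ks: "kset P" and d: "\<And>i. delone (colour_class P i)" and ds: "delone (support P)"
    using assms by (auto simp: delone_kset_def)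
  have "\<exists>R. \<forall>x. \<exists>y. (y, i) \<in> P \<and> dist x y \<le> R" for i
    using d[of i] by (fastforce simp: delone_def relatively_dense_def colour_class_def)
  then obtain R where R: "\<And>i x. \<exists>y. (y, i) \<in> P \<and> dist x y \<le> R i" by metis
  obtain r where r: "r > 0" "\<And>x y. x \<in> support P \<Longrightarrow> y \<in> support P \<Longrightarrow> dist x y < r \<Longrightarrow> x = y"
    using ds by (auto simp: delone_def uniform_discrete_def)
  have "P \<in> delone_class r (Max (range R))"
    unfolding delone_class_def
  proof (intro CollectI conjI allI impI)
    fix y i z j assume *: "(y, i) \<in> P \<and> (z, j) \<in> P \<and> dist y z < r"
    then show "y = z" using r(2)[of y z] by (auto simp: support_def colour_class_def)
    then show "i = j" using ks * by (auto simp: kset_def colour_class_def)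
  next
    fix x i and s :: real assume s: "Max (range R) < s"
    have "R i \<le> Max (range R)" by simp
    then show "\<exists>y. (y, i) \<in> P \<and> dist x y < s" using R[of i x] s by (meson le_less_trans)
  qed
  then show thesis using that r(1) by blast
qed

lemma delone_class_delone:
  assumes "P \<in> delone_class r R" "r > 0"
  shows "delone_kset P"
proof -
  have dense: "relatively_dense (colour_class P i)" for i
    unfolding relatively_dense_def colour_class_def
    using delone_class_dense[OF assms(1), of "max R 0 + 1" i]
    by (intro exI[of _ "max R 0 + 1"]) (force intro: less_imp_le)
  moreover have "relatively_dense (support P)"
  proof -
    obtain R' where "R' > 0" "\<And>x. \<exists>y\<in>colour_class P undefined. dist x y \<le> R'"
      using dense[of undefined] unfolding relatively_dense_def by blast
    then show ?thesis unfolding relatively_dense_def support_def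
      by (intro exI[of _ R']) blast
  qed
  moreover have "uniform_discrete (support P)"
    unfolding uniform_discrete_def support_def colour_class_def
    using delone_class_unique[OF assms(1)] assms(2) by (intro exI[of _ r]) blast
  moreover have "uniform_discrete (colour_class P i)" for i
    using \<open>uniform_discrete (support P)\<close> by (rule uniform_discrete_subset) (auto simp: support_def)
  moreover have "kset P"
    using delone_class_unique[OF assms(1)] assms(2) unfolding kset_def colour_class_def by fastforce
  ultimately show ?thesis by (simp add: delone_kset_def delone_def)
qed

lemma translate_delone_class:
  assumes "P \<in> delone_class r R" shows "translate t P \<in> delone_class r R"
  unfolding delone_class_def mem_Collect_eq mem_translate_iff
proof (intro conjI allI impI)
  show "y = z" "i = j" if "(y - t, i) \<in> P \<and> (z - t, j) \<in> P \<and> dist y z < r" for y i z j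
    using delone_class_unique[OF assms, of "y - t" i "z - t" j] that by (auto simp: dist_norm)
next
  fix x i and s :: real assume "R < s"
  then obtain y where "(y, i) \<in> P" "dist (x - t) y < s"
    using delone_class_dense[OF assms] by blast
  then show "\<exists>y. (y - t, i) \<in> P \<and> dist x y < s"
    by (intro exI[of _ "y + t"]) (simp add: dist_norm algebra_simps)
qed

lemma delone_kset_translate: "delone_kset P \<Longrightarrow> delone_kset (translate t P)"
  by (rule delone_kset_in_class) (auto intro: delone_class_delone translate_delone_class)

lemma eps_close_exists:
  assumes "delone_kset P" "delone_kset Q"
  obtains e where "e > 0" "eps_close e P Q"
proof -
  obtain r R where P: "P \<in> delone_class r R" using delone_kset_in_class[OF assms(1)] .
  obtain r' R' where Q: "Q \<in> delone_class r' R'" using delone_kset_in_class[OF assms(2)] .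
  let ?e = "max 0 (max R R') + 1"
  have "eps_close ?e P Q"
    unfolding eps_close_iff
    using delone_class_dense[OF P, of ?e] delone_class_dense[OF Q, of ?e] by fastforce
  then show thesis using that[of ?e] by simp
qed

lemma delone_dist_le:
  assumes "delone_kset P" "delone_kset Q" "e > 0" "eps_close e P Q"
  shows "delone_dist P Q \<le> e"
proof -
  have "Inf {e. e > 0 \<and> eps_close e P Q} \<le> e"
    using assms by (intro cInf_lower bdd_belowI[of _ 0]) auto
  then show ?thesis using assms by (simp add: delone_dist_def)
qed

text \<open>The cut-off \<open>2 powr (- 1 / 2)\<close> exceeds 1/2, so below 1/2 the distance is
  the infimum itself; monotonicity of closeness then yields the parameter \<open>e\<close>.\<close>

lemma delone_dist_less_imp:
  assumes "delone_kset P" "delone_kset Q" "delone_dist P Q < e" "e \<le> 1 / 2"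
  shows "eps_close e P Q"
proof -
  have "(1 / 2 :: real) \<le> 2 powr (- 1 / 2)"
    using powr_mono[of "-1" "- 1 / 2" "2::real"] by (simp add: powr_minus_divide)
  then have "Inf {e. e > 0 \<and> eps_close e P Q} < e"
    using assms by (auto simp: delone_dist_def min_def split: if_splits)
  moreover have "{e. e > 0 \<and> eps_close e P Q} \<noteq> {}"
    using eps_close_exists[OF assms(1,2)] by auto
  ultimately obtain a where "a > 0" "eps_close a P Q" "a < e"
    by (metis (mono_tags, lifting) cInf_lessD mem_Collect_eq)
  then show ?thesis by (auto intro: eps_close_mono)
qed

interpretation delone: Metric_space "{P :: ('d::finite, 'k::finite) coloured. delone_kset P}" delone_dist
  by (rule Metric_space_delone_dist)

lemma topspace_delone: "topspace delone_topology = {P. delone_kset P}"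
  by (simp add: delone_topology_def)

lemma metrizable_delone: "metrizable_space delone_topology"
  by (simp add: delone_topology_def delone.metrizable_space_mtopology)

text \<open>A finite code of \<open>P\<close> at scale \<open>m\<close>. It takes finitely many
  values and determines \<open>P\<close> up to a small distance, which gives total boundedness here
  and the approximation of continuous functions later.\<close>

definition hit :: "nat \<Rightarrow> ('d::finite, 'k::finite) coloured \<Rightarrow> ((real^'d) set \<times> 'k) set" where
  "hit m P = {C \<in> coloured_cubes m. P \<inter> cube_points C \<noteq> {}}"

lemma finite_coloured_cubes: "finite (coloured_cubes m)"
  by (simp add: coloured_cubes_def finite_grid_cubes)

text \<open>Two points of one cube are at distance at most \<open>CARD('d) / 2 ^ m\<close>. The
  additional 1 in the numerator makes this strict and bounds \<open>1 / ?e\<close> by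
  \<open>2 ^ m\<close>, so the ball that has to be compared lies in the big cube.\<close>

lemma delone_dist_hit_eq:
  fixes P Q :: "('d::finite, 'k::finite) coloured"
  assumes "delone_kset P" "delone_kset Q" "hit m P = hit m Q"
  shows "delone_dist P Q \<le> (real CARD('d) + 1) / 2 ^ m"
proof (rule delone_dist_le)
  let ?e = "(real CARD('d) + 1) / 2 ^ m"
  have inv: "1 / ?e \<le> 2 ^ m" by (simp add: field_simps)
  have half: "\<exists>y. (y, i) \<in> Q' \<and> dist x y < ?e"
    if "(x, i) \<in> P'" and n: "norm x < 1 / ?e" and h: "hit m P' = hit m Q'"
    for P' Q' :: "('d, 'k) coloured" and x i
  proof -
    have "x \<in> big_cube m" using n inv by (intro mem_big_cube) linarith
    then obtain B where B: "B \<in> grid_cubes m" "x \<in> B" by (auto simp: Union_grid_cubes[symmetric])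
    then have "(B, i) \<in> hit m P'"
      using \<open>(x, i) \<in> P'\<close> by (auto simp: hit_def coloured_cubes_def cube_points_def)
    then obtain y where "(y, i) \<in> Q'" "y \<in> B"
      unfolding h by (auto simp: hit_def cube_points_def)
    moreover have "dist x y < ?e"
    proof -
      have "0 < 1 / (2 ^ m :: real)" by simp
      then show ?thesis using dist_grid_cube[OF B \<open>y \<in> B\<close>] unfolding add_divide_distrib by linarith
    qed
    ultimately show ?thesis by blast
  qed
  show "eps_close ?e P Q"
    unfolding eps_close_iff using half[of _ _ P Q] half[of _ _ Q P] assms(3) by metis
qed (use assms in \<open>auto simp: add_nonneg_pos\<close>)

section \<open>Compactness of Delone classes and of the orbit closure\<close>

lemma inverse_power2_tendsto: "(\<lambda>m. c / 2 ^ m :: real) \<longlonglongrightarrow> 0"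
  using tendsto_mult[OF tendsto_const[of c] LIMSEQ_inverse_realpow_zero[of 2]]
  by (simp add: divide_inverse power_inverse)

text \<open>One member of the class is chosen for each code that occurs. There are finitely many
  codes, and sets with the same code are within \<open>e\<close> once \<open>m\<close> is
  large.\<close>

lemma mtotally_bounded_delone_class:
  assumes "r > 0"
  shows "delone.mtotally_bounded (delone_class r R :: ('d::finite, 'k::finite) coloured set)"
  unfolding delone.mtotally_bounded_def
proof (intro allI impI)
  fix e :: real assume "e > 0"
  then obtain m where m: "(real CARD('d) + 1) / 2 ^ m < e"
    using order_tendstoD(2)[OF inverse_power2_tendsto, of e "real CARD('d) + 1"]
    by (auto simp: eventually_sequentially)
  let ?H = "delone_class r R :: ('d, 'k) coloured set"
  define rep where "rep = (\<lambda>S. SOME P. P \<in> ?H \<and> hit m P = S)"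
  have rep: "rep (hit m P) \<in> ?H \<and> hit m (rep (hit m P)) = hit m P" if "P \<in> ?H" for P
    unfolding rep_def by (rule someI[of _ P]) (use that in simp)
  have "finite (hit m ` ?H)"
    by (rule finite_subset[of _ "Pow (coloured_cubes m)"]) (auto simp: hit_def finite_coloured_cubes)
  then show "\<exists>K. finite K \<and> K \<subseteq> ?H \<and> ?H \<subseteq> (\<Union>x\<in>K. delone.mball x e)"
  proof (intro exI[of _ "rep ` hit m ` ?H"] conjI)
    show "?H \<subseteq> (\<Union>x\<in>rep ` hit m ` ?H. delone.mball x e)"
    proof
      fix P assume P: "P \<in> ?H"
      have "delone_kset P" "delone_kset (rep (hit m P))"
        using rep[OF P] P delone_class_delone[OF _ assms] by blast+
      then have "P \<in> delone.mball (rep (hit m P)) e"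
        using delone_dist_hit_eq[of "rep (hit m P)" P m] rep[OF P] m by simp
      then show "P \<in> (\<Union>x\<in>rep ` hit m ` ?H. delone.mball x e)" using P by blast
    qed
  qed (use rep in auto)
qed

text \<open>Completeness: a point of a Cauchy sequence of sets can be followed through the sequence,
  uniquely because of the hard core condition, and the limits of these trajectories form the
  limit set.\<close>

lemma mcomplete_delone_class:
  assumes r: "r > 0"
  shows "Metric_space.mcomplete (delone_class r R :: ('d::finite, 'k::finite) coloured set) delone_dist"
proof -
  let ?H = "delone_class r R :: ('d, 'k) coloured set"
  interpret H: Submetric "{P :: ('d, 'k) coloured. delone_kset P}" delone_dist ?H
    using delone_class_delone[OF _ r] by unfold_locales auto
  show ?thesis
    unfolding H.sub.mcomplete_def
  proof (intro allI impI)
    fix \<sigma> :: "nat \<Rightarrow> ('d, 'k) coloured" assume "H.sub.MCauchy \<sigma>"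
    then have \<sigma>: "\<sigma> n \<in> ?H" and cau: "\<And>e. e > 0 \<Longrightarrow> \<exists>N. \<forall>n n'. N \<le> n \<longrightarrow> N \<le> n' \<longrightarrow> delone_dist (\<sigma> n) (\<sigma> n') < e" for n
      by (auto simp: H.sub.MCauchy_def)
    have dk: "delone_kset (\<sigma> n)" for n using \<sigma> delone_class_delone[OF _ r] by blast
    have close: "\<exists>N. \<forall>n n'. N \<le> n \<longrightarrow> N \<le> n' \<longrightarrow> eps_close e (\<sigma> n) (\<sigma> n')" if "0 < e" "e \<le> 1 / 2" for e
      using cau[OF that(1)] delone_dist_less_imp[OF dk dk _ that(2)] by meson
    define L where "L = {(x, i). \<exists>s. (\<forall>\<^sub>F n in sequentially. (s n, i) \<in> \<sigma> n) \<and> s \<longlonglongrightarrow> x}"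
    have follow: "\<exists>z. (z, i) \<in> L \<and> dist y z \<le> e"
      if cl: "\<And>n n'. N \<le> n \<Longrightarrow> N \<le> n' \<Longrightarrow> eps_close e (\<sigma> n) (\<sigma> n')"
        and e: "0 < e" "e \<le> 1 / 2" "2 * e < r" and y: "(y, i) \<in> \<sigma> n" "N \<le> n" "norm y < 1 / e"
      for e y i n N
    proof -
      have "\<exists>w. (w, i) \<in> \<sigma> k \<and> dist y w < e" if "N \<le> k" for k
        using cl[OF that y(2)] y unfolding eps_close_iff by blast
      then obtain s where s: "\<And>k. N \<le> k \<Longrightarrow> (s k, i) \<in> \<sigma> k \<and> dist y (s k) < e" by metis
      have "Cauchy s"
        unfolding Cauchy_altdef2
      proof (intro allI impI)
        fix \<epsilon> :: real assume "\<epsilon> > 0"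
        \<comment> \<open>The bound \<open>r - 2 * e\<close> leaves room for hard core uniqueness:
          \<open>w\<close> and \<open>s ?M\<close> are closer than \<open>e2 + 2 * e\<close>, hence
          equal. The bound 1/2 allows distances to be read as closeness, and
          \<open>1 / (1 / e + e)\<close> keeps the whole trajectory, which stays within
          \<open>e\<close> of \<open>y\<close>, inside the ball of radius
          \<open>1 / e2\<close>.\<close>
        define e2 where "e2 = min (min \<epsilon> (r - 2 * e)) (min (1 / 2) (1 / (1 / e + e)))"
        have e2: "0 < e2" "e2 \<le> \<epsilon>" "e2 \<le> r - 2 * e"
          using e \<open>\<epsilon> > 0\<close> by (auto simp: e2_def add_pos_pos)
        have e2h: "e2 \<le> 1 / 2"
          unfolding e2_def by (meson min.cobounded1 min.cobounded2 order_trans)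
        have e2i: "1 / e + e \<le> 1 / e2"
        proof -
          have "e2 \<le> 1 / (1 / e + e)" by (simp add: e2_def)
          moreover have "0 < 1 / e + e" using e by (simp add: add_pos_pos)
          ultimately have "e2 * (1 / e + e) \<le> 1" by (simp only: pos_le_divide_eq)
          then show ?thesis using e2(1) by (simp only: pos_le_divide_eq mult.commute)
        qed
        obtain N2 where N2: "\<And>n n'. N2 \<le> n \<Longrightarrow> N2 \<le> n' \<Longrightarrow> eps_close e2 (\<sigma> n) (\<sigma> n')"
          using close[OF e2(1) e2h] by blast
        let ?M = "max N N2"
        have "dist (s l) (s ?M) < \<epsilon>" if "l \<ge> ?M" for l
        proof -
          have l: "N \<le> l" "N2 \<le> l" using that by auto
          have "norm (s l) < 1 / e + e"
            using s[OF l(1)] y(3) norm_triangle_ineq2[of "s l" y] by (simp add: dist_norm norm_minus_commute)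
          then have "norm (s l) < 1 / e2" using e2i by linarith
          then obtain w where w: "(w, i) \<in> \<sigma> ?M" "dist (s l) w < e2"
            using N2[OF l(2), of ?M] s[OF l(1)] unfolding eps_close_iff by fastforce
          have "dist w (s ?M) < r"
            using w(2) s[OF l(1)] s[of ?M] e2(3) dist_triangle[of w "s ?M" "s l"]
              dist_triangle[of "s l" "s ?M" y] by (simp add: dist_commute)
          then have "w = s ?M" using delone_class_unique[OF \<sigma> w(1)] s[of ?M] by auto
          then show ?thesis using w(2) e2(2) by simp
        qed
        then show "\<exists>M. \<forall>n\<ge>M. dist (s n) (s M) < \<epsilon>" by blast
      qed
      then obtain z where z: "s \<longlonglongrightarrow> z" using Cauchy_convergent convergent_def by blast
      have "\<forall>\<^sub>F k in sequentially. (s k, i) \<in> \<sigma> k"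
        using s by (auto simp: eventually_sequentially)
      then have "(z, i) \<in> L" using z by (auto simp: L_def)
      have "\<forall>\<^sub>F k in sequentially. dist y (s k) \<le> e"
        using s less_imp_le by (intro eventually_sequentiallyI[of N]) blast
      then have "dist y z \<le> e"
        using tendsto_upperbound[OF tendsto_dist[OF tendsto_const z]] sequentially_bot by blast
      then show ?thesis using \<open>(z, i) \<in> L\<close> by blast
    qed
    have LH: "L \<in> ?H"
      unfolding delone_class_def mem_Collect_eq
    proof (intro conjI allI impI)
      have both: "y = z \<and> i = j" if h: "(y, i) \<in> L \<and> (z, j) \<in> L \<and> dist y z < r" for y i z j
      proof -
        obtain s t where s: "\<forall>\<^sub>F n in sequentially. (s n, i) \<in> \<sigma> n" "s \<longlonglongrightarrow> y"
          and t: "\<forall>\<^sub>F n in sequentially. (t n, j) \<in> \<sigma> n" "t \<longlonglongrightarrow> z"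
          using h by (auto simp: L_def)
        have "\<forall>\<^sub>F n in sequentially. dist (s n) (t n) < r"
          using order_tendstoD(2)[OF tendsto_dist[OF s(2) t(2)]] h by blast
        then have ev: "\<forall>\<^sub>F n in sequentially. s n = t n \<and> i = j"
          using s(1) t(1) by eventually_elim (use delone_class_unique[OF \<sigma>] in blast)
        then have "i = j" using eventually_happens'[OF sequentially_bot] by blast
        moreover have "t \<longlonglongrightarrow> y"
          using ev by (intro Lim_transform_eventually[OF s(2)]) (auto elim: eventually_mono)
        ultimately show ?thesis using t(2) LIMSEQ_unique by blast
      qed
      show "y = z" "i = j" if "(y, i) \<in> L \<and> (z, j) \<in> L \<and> dist y z < r" for y i z j
        using both[OF that] by auto
    next
      fix x :: "real^'d" and i and s :: real assume s: "R < s"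
      define c where "c = norm x + \<bar>s\<bar> + 1"
      have c: "c > 0" by (simp add: c_def add_nonneg_pos)
      \<comment> \<open>The gap between \<open>R\<close> and \<open>s\<close> is shared: half of it
        goes to finding \<open>y\<close> near \<open>x\<close>, and \<open>(s - R) / 2\<close> to
        the move from \<open>y\<close> to its limit point. The bound \<open>1 / c\<close> puts
        \<open>y\<close> into the ball where closeness applies, and \<open>r / 3\<close> gives
        \<open>2 * e < r\<close> as \<open>follow\<close> requires.\<close>
      define e where "e = min (min ((s - R) / 2) (r / 3)) (min (1 / 2) (1 / c))"
      have e: "0 < e" "e \<le> 1 / 2" "2 * e < r"
        using s r c by (auto simp: e_def)
      have e4: "e \<le> (s - R) / 2"
        unfolding e_def by (meson min.cobounded1 order_trans)
      have "e \<le> 1 / c" by (simp add: e_def)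
      then have ec: "c \<le> 1 / e" using e(1) c by (simp add: field_simps)
      obtain N where N: "\<And>n n'. N \<le> n \<Longrightarrow> N \<le> n' \<Longrightarrow> eps_close e (\<sigma> n) (\<sigma> n')"
        using close[OF e(1,2)] by blast
      obtain y where y: "(y, i) \<in> \<sigma> N" "dist x y < (R + s) / 2"
        using delone_class_dense[OF \<sigma>, of "(R + s) / 2"] s by fastforce
      have "norm y \<le> norm x + dist x y"
        using norm_triangle_sub[of y x] by (simp add: dist_norm norm_minus_commute)
      then have "norm y < 1 / e" using ec y(2) s abs_ge_self[of s] unfolding c_def by (simp add: field_simps)
      then obtain z where "(z, i) \<in> L" "dist y z \<le> e"
        using follow[OF N e(1-3) y(1)] by blast
      moreover have "dist x z < s"
        using dist_triangle[of x z y] \<open>dist y z \<le> e\<close> y(2) e4 by (simp add: field_simps)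
      ultimately show "\<exists>y. (y, i) \<in> L \<and> dist x y < s" by blast
    qed
    have "limitin H.sub.mtopology \<sigma> L sequentially"
      unfolding H.sub.limitin_metric
    proof (intro conjI allI impI LH)
      fix \<epsilon> :: real assume "\<epsilon> > 0"
      define e where "e = min (\<epsilon> / 3) (min (1 / 2) (r / 3))"
      have e: "0 < e" "e \<le> 1 / 2" "2 * e < r" "2 * e < \<epsilon>" using r \<open>\<epsilon> > 0\<close> by (auto simp: e_def)
      \<comment> \<open>A point of norm below \<open>1 / (2 * e)\<close> must stay inside the ball
        of radius \<open>1 / e\<close> after a move by \<open>e\<close>; this is the reason for
        comparing at parameter \<open>2 * e\<close>.\<close>
      have e2: "1 / (2 * e) + e \<le> 1 / e"
      proof -
        have "e * e \<le> 1 / 2 * (1 / 2)" by (intro mult_mono) (use e in auto)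
        then show ?thesis using e(1) by (simp add: field_simps)
      qed
      obtain N where N: "\<And>n n'. N \<le> n \<Longrightarrow> N \<le> n' \<Longrightarrow> eps_close e (\<sigma> n) (\<sigma> n')"
        using close[OF e(1,2)] by blast
      have "\<sigma> n \<in> ?H \<and> delone_dist (\<sigma> n) L < \<epsilon>" if n: "N \<le> n" for n
      proof -
        have "eps_close (2 * e) (\<sigma> n) L"
          unfolding eps_close_iff
        proof (intro conjI allI impI; elim conjE)
          fix x i assume "(x, i) \<in> L" and x: "norm x < 1 / (2 * e)"
          then obtain s where s: "\<forall>\<^sub>F n in sequentially. (s n, i) \<in> \<sigma> n" "s \<longlonglongrightarrow> x" by (auto simp: L_def)
          have "\<forall>\<^sub>F k in sequentially. dist (s k) x < e" using tendstoD[OF s(2) e(1)] .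
          then have "\<forall>\<^sub>F k in sequentially. (s k, i) \<in> \<sigma> k \<and> dist (s k) x < e \<and> N \<le> k"
            using s(1) eventually_ge_at_top[of N] by eventually_elim blast
          then obtain k where k: "(s k, i) \<in> \<sigma> k" "dist (s k) x < e" "N \<le> k"
            using eventually_happens'[OF sequentially_bot] by blast
          have "norm (s k) \<le> norm x + dist (s k) x"
            using norm_triangle_sub[of "s k" x] by (simp add: dist_norm)
          then have "norm (s k) < 1 / e" using x k(2) e2 by linarith
          then obtain w where "(w, i) \<in> \<sigma> n" "dist (s k) w < e"
            using N[OF n k(3)] k(1) unfolding eps_close_iff by blast
          then show "\<exists>y. (y, i) \<in> \<sigma> n \<and> dist x y < 2 * e"
            using k(2) dist_triangle3[of x w "s k"] by (intro exI[of _ w]) auto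
        next
          fix y i assume y: "(y, i) \<in> \<sigma> n" "norm y < 1 / (2 * e)"
          then have "norm y < 1 / e" using e2 e(1) by linarith
          then obtain z where "(z, i) \<in> L" "dist y z \<le> e"
            using follow[OF N e(1-3) y(1) n] by blast
          then show "\<exists>z. (z, i) \<in> L \<and> dist y z < 2 * e" using e(1) by (intro exI[of _ z]) auto
        qed
        then have "delone_dist (\<sigma> n) L \<le> 2 * e"
          using e(1) delone_class_delone[OF LH r] by (intro delone_dist_le dk) auto
        then show ?thesis using e(4) \<sigma> by simp
      qed
      then show "\<forall>\<^sub>F n in sequentially. \<sigma> n \<in> ?H \<and> delone_dist (\<sigma> n) L < \<epsilon>"
        by (auto simp: eventually_sequentially)
    qed
    then show "\<exists>L. limitin H.sub.mtopology \<sigma> L sequentially" ..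
  qed
qed

lemma compactin_delone_class:
  assumes r: "r > 0"
  shows "compactin delone_topology (delone_class r R :: ('d::finite, 'k::finite) coloured set)"
proof -
  let ?H = "delone_class r R :: ('d, 'k) coloured set"
  have sub: "?H \<subseteq> {P. delone_kset P}" using delone_class_delone[OF _ r] by auto
  interpret H: Submetric "{P :: ('d, 'k) coloured. delone_kset P}" delone_dist ?H
    by unfold_locales (rule sub)
  have "compact_space H.sub.mtopology"
    unfolding H.sub.compact_space_eq_mcomplete_mtotally_bounded
    using mcomplete_delone_class[OF r] delone.mtotally_bounded_submetric[OF mtotally_bounded_delone_class[OF r] _ sub]
    by blast
  then show ?thesis
    using sub by (simp add: H.mtopology_submetric delone_topology_def compactin_subspace)
qed

text \<open>A compact subset of a Hausdorff space is closed, and the class is invariant under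
  translations; so the parameters of \<open>P\<close> are shared by all its limits.\<close>

lemma orbit_closure_subset_class:
  assumes r: "r > 0" and P: "P \<in> delone_class r R"
  shows "orbit_closure P \<subseteq> delone_class r R"
proof -
  have "Hausdorff_space delone_topology"
    using metrizable_delone by (rule metrizable_imp_Hausdorff_space)
  then have "closedin delone_topology (delone_class r R)"
    using compactin_delone_class[OF r] compactin_imp_closedin by blast
  then show ?thesis
    unfolding orbit_closure_def
    by (rule closure_of_minimal[rotated]) (use translate_delone_class[OF P] in auto)
qed

lemma compact_space_orbit_closure:
  assumes "delone_kset P"
  shows "compact_space (subtopology delone_topology (orbit_closure P))"
proof -
  obtain r R where r: "r > 0" and P: "P \<in> delone_class r R" using delone_kset_in_class[OF assms] .
  have "closedin delone_topology (orbit_closure P)" by (simp add: orbit_closure_def)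
  then have "compactin delone_topology (orbit_closure P)"
    using closed_compactin[OF compactin_delone_class[OF r] orbit_closure_subset_class[OF r P]] by blast
  then show ?thesis by (simp add: compact_space_subtopology)
qed

section \<open>Continuity of the action\<close>

lemma delone_dist_translate:
  assumes "delone_kset P" "norm (s - t) < e"
  shows "delone_dist (translate s P) (translate t P) \<le> e"
proof (rule delone_dist_le)
  show "e > 0" using assms(2) norm_ge_zero[of "s - t"] by linarith
  have half: "\<exists>y. (y, i) \<in> translate t' P \<and> dist x y < e" if "(x, i) \<in> translate s' P" "norm (s' - t') < e" for x i s' t'
    using that by (intro exI[of _ "x - s' + t'"]) (simp add: mem_translate_iff dist_norm)
  show "eps_close e (translate s P) (translate t P)"
    unfolding eps_close_iff using half[of _ _ s t] half[of _ _ t s] assms(2)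
    by (simp add: norm_minus_commute)
qed (use assms delone_kset_translate in auto)

lemma continuous_map_translate:
  "continuous_map delone_topology delone_topology (translate g :: ('d::finite, 'k::finite) coloured \<Rightarrow> _)"
  unfolding delone_topology_def delone.metric_continuous_map[OF Metric_space_delone_dist]
proof (intro conjI ballI allI impI)
  show "translate g ` {P. delone_kset P} \<subseteq> {P. delone_kset P}"
    using delone_kset_translate by auto
  fix P :: "('d, 'k) coloured" and \<epsilon> :: real assume "P \<in> {P. delone_kset P}" "\<epsilon> > 0"
  then have P: "delone_kset P" by simp
  define e where "e = min (\<epsilon> / 2) (1 / 2)"
  have e: "0 < e" "e \<le> 1 / 2" "e < \<epsilon>" using \<open>\<epsilon> > 0\<close> by (auto simp: e_def)
  \<comment> \<open>Translation by \<open>g\<close> displaces the ball of radius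
    \<open>1 / e\<close> by \<open>norm g\<close>; the radius \<open>1 / \<delta>\<close> is
    enlarged by exactly this amount.\<close>
  define \<delta> where "\<delta> = 1 / (1 / e + norm g)"
  have \<delta>: "0 < \<delta>" "1 / \<delta> = 1 / e + norm g" using e(1) by (auto simp: \<delta>_def add_pos_nonneg)
  have \<delta>e: "\<delta> \<le> e"
  proof -
    have "\<delta> \<le> 1 / (1 / e)"
      unfolding \<delta>_def using e(1) by (intro divide_left_mono mult_pos_pos add_pos_nonneg) auto
    then show ?thesis by simp
  qed
  have "delone_dist (translate g P) (translate g Q) < \<epsilon>" if Q: "delone_kset Q" and d: "delone_dist P Q < \<delta>" for Q
  proof -
    have cl: "eps_close \<delta> P Q" using delone_dist_less_imp[OF P Q d] \<delta>e e(2) by simp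
    have half: "\<exists>y. (y, i) \<in> translate g Q' \<and> dist x y < e"
      if near: "\<And>x i. (x, i) \<in> P' \<Longrightarrow> norm x < 1 / \<delta> \<Longrightarrow> \<exists>y. (y, i) \<in> Q' \<and> dist x y < \<delta>"
        and x: "(x, i) \<in> translate g P'" "norm x < 1 / e" for P' Q' :: "('d, 'k) coloured" and x i
    proof -
      have "norm (x - g) < 1 / \<delta>" using x(2) \<delta>(2) norm_triangle_ineq4[of x g] by linarith
      then obtain y where "(y, i) \<in> Q'" "dist (x - g) y < \<delta>"
        using near x(1) by (auto simp: mem_translate_iff)
      then show ?thesis using \<delta>e
        by (intro exI[of _ "y + g"]) (auto simp: mem_translate_iff dist_norm algebra_simps)
    qed
    have "eps_close e (translate g P) (translate g Q)"
      unfolding eps_close_iff using half[of P Q] half[of Q P] cl unfolding eps_close_iff by blast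
    then have "delone_dist (translate g P) (translate g Q) \<le> e"
      using P Q e(1) by (intro delone_dist_le delone_kset_translate)
    then show ?thesis using e(3) by simp
  qed
  then show "\<exists>\<delta>>0. \<forall>Q. Q \<in> {P. delone_kset P} \<and> delone_dist P Q < \<delta> \<longrightarrow>
      delone_dist (translate g P) (translate g Q) < \<epsilon>"
    using \<delta>(1) by blast
qed

lemma continuous_map_orbit_closure:
  "continuous_map (subtopology delone_topology (orbit_closure P)) (subtopology delone_topology (orbit_closure P)) (translate g)"
proof -
  have "translate g ` orbit_closure P \<subseteq> delone_topology closure_of (translate g ` range (\<lambda>g. translate (- g) P))"
    unfolding orbit_closure_def by (rule continuous_map_image_closure_subset[OF continuous_map_translate])
  also have "translate g ` range (\<lambda>g. translate (- g) P) \<subseteq> range (\<lambda>g. translate (- g) P)"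
  proof clarify
    fix h
    have "translate g (translate (- h) P) = translate (- (h - g)) P" by (simp add: translate_translate)
    then show "translate g (translate (- h) P) \<in> range (\<lambda>g. translate (- g) P)" by blast
  qed
  then have "delone_topology closure_of (translate g ` range (\<lambda>g. translate (- g) P)) \<subseteq> orbit_closure P"
    unfolding orbit_closure_def by (rule closure_of_mono)
  finally show ?thesis
    by (intro continuous_map_into_subtopology continuous_map_from_subtopology continuous_map_translate)
      (auto simp: topspace_subtopology)
qed

lemma compact_metric_uniform_continuity:
  fixes f :: "'a \<Rightarrow> real"
  assumes "Metric_space M d" "compact_space (Metric_space.mtopology M d)"
    and f: "continuous_map (Metric_space.mtopology M d) euclideanreal f" and "e > 0"
  shows "\<exists>\<delta>>0. \<forall>x\<in>M. \<forall>y\<in>M. d x y < \<delta> \<longrightarrow> \<bar>f x - f y\<bar> < e"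
proof (rule ccontr)
  interpret Metric_space M d by fact
  assume "\<not> ?thesis"
  then have "\<exists>x y. x \<in> M \<and> y \<in> M \<and> d x y < 1 / Suc n \<and> e \<le> \<bar>f x - f y\<bar>" for n
    by (metis not_less of_nat_0_less_iff zero_less_Suc zero_less_divide_1_iff)
  then obtain x y where xy: "\<And>n. x n \<in> M \<and> y n \<in> M \<and> d (x n) (y n) < 1 / Suc n \<and> e \<le> \<bar>f (x n) - f (y n)\<bar>"
    by metis
  then obtain l r where l: "l \<in> M" "strict_mono r" "limitin mtopology (x \<circ> r) l sequentially"
    using assms(2) unfolding compact_space_sequentially by (metis image_subsetI)
  have "limitin mtopology (y \<circ> r) l sequentially"
    unfolding limitin_metric
  proof (intro conjI allI impI l)
    fix \<epsilon> :: real assume "\<epsilon> > 0"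
    have 1: "\<forall>\<^sub>F n in sequentially. (x \<circ> r) n \<in> M \<and> d ((x \<circ> r) n) l < \<epsilon> / 2"
      using l(3) \<open>\<epsilon> > 0\<close> unfolding limitin_metric by (meson half_gt_zero)
    have 2: "\<forall>\<^sub>F n in sequentially. 1 / real (Suc n) < \<epsilon> / 2"
      using order_tendstoD(2)[OF LIMSEQ_inverse_real_of_nat, of "\<epsilon> / 2"] \<open>\<epsilon> > 0\<close> by (simp add: inverse_eq_divide)
    from 1 2 show "\<forall>\<^sub>F n in sequentially. (y \<circ> r) n \<in> M \<and> d ((y \<circ> r) n) l < \<epsilon>"
    proof eventually_elim
      case (elim n)
      have "n \<le> r n" using l(2) by (rule strict_mono_imp_increasing)
      then have "1 / real (Suc (r n)) \<le> 1 / real (Suc n)" by (intro divide_left_mono) auto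
      then have "d (x (r n)) (y (r n)) < \<epsilon> / 2" using xy[of "r n"] elim by linarith
      then show ?case
        using elim xy[of "r n"] triangle[of "y (r n)" "x (r n)" l] l(1) commute[of "x (r n)" "y (r n)"] by auto
    qed
  qed
  then have "(\<lambda>n. f (y (r n))) \<longlonglongrightarrow> f l" "(\<lambda>n. f (x (r n))) \<longlonglongrightarrow> f l"
    using continuous_map_limit[OF f] l(3) by (force simp: o_def)+
  then have "(\<lambda>n. \<bar>f (x (r n)) - f (y (r n))\<bar>) \<longlonglongrightarrow> \<bar>f l - f l\<bar>"
    by (intro tendsto_intros)
  then have "e \<le> \<bar>f l - f l\<bar>"
    by (rule tendsto_lowerbound) (use xy in auto)
  then show False using \<open>e > 0\<close> by simp
qed

section \<open>Averages over large sets\<close>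

definition set_avg :: "(real^'d::finite) set \<Rightarrow> (real^'d \<Rightarrow> real) \<Rightarrow> real^'d \<Rightarrow> real" where
  "set_avg A \<rho> h = (LINT x:A|lebesgue. \<rho> (h + x)) / measure lebesgue A"

definition bounded_borel :: "(real^'d::finite \<Rightarrow> real) \<Rightarrow> bool" where
  "bounded_borel \<rho> \<longleftrightarrow> \<rho> \<in> borel_measurable borel \<and> (\<exists>K. \<forall>x. \<bar>\<rho> x\<bar> \<le> K)"

definition averaging_set :: "(real^'d::finite) set \<Rightarrow> bool" where
  "averaging_set A \<longleftrightarrow> bounded A \<and> A \<in> sets lebesgue \<and> 0 < measure lebesgue A"

lemma bounded_borel_shift_integrable:
  assumes "bounded_borel \<rho>" "bounded A" "A \<in> sets lebesgue"
  shows "set_integrable lebesgue A (\<lambda>x. \<rho> (h + x))"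
proof -
  obtain K where K: "\<And>x. \<bar>\<rho> x\<bar> \<le> K" using assms by (auto simp: bounded_borel_def)
  have "\<rho> \<in> borel_measurable borel" using assms(1) by (simp add: bounded_borel_def)
  then have "(\<lambda>x. \<rho> (h + x)) \<in> borel_measurable borel"
    by (rule measurable_compose[rotated]) simp
  then have "(\<lambda>x. \<rho> (h + x)) \<in> borel_measurable lebesgue"
    by (intro measurable_completion) simp
  moreover have "emeasure lebesgue A < \<infinity>"
    using bounded_set_imp_lmeasurable[OF assms(2,3)] by (simp add: fmeasurable_def del: emeasure_completion)
  ultimately show ?thesis
    unfolding set_integrable_def
    using assms(3) K by (intro integrableI_bounded_set_indicator[where B = K]) auto
qed

lemma set_avg_bound:
  assumes A: "averaging_set A" and "bounded_borel \<rho>" "bounded_borel \<rho>'" and e: "\<And>x. \<bar>\<rho> x - \<rho>' x\<bar> \<le> e"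
  shows "\<bar>set_avg A \<rho> h - set_avg A \<rho>' h\<bar> \<le> e"
proof -
  have i: "set_integrable lebesgue A (\<lambda>x. \<rho> (h + x))" "set_integrable lebesgue A (\<lambda>x. \<rho>' (h + x))"
    using assms by (auto intro!: bounded_borel_shift_integrable simp: averaging_set_def)
  have c: "set_integrable lebesgue A (\<lambda>x. e)" and ce: "(LINT x:A|lebesgue. e) = e * measure lebesgue A"
    using A bounded_set_imp_lmeasurable[of A]
    by (auto simp: averaging_set_def set_integrable_def set_lebesgue_integral_def fmeasurable_def)
  have "\<bar>(LINT x:A|lebesgue. \<rho> (h + x)) - (LINT x:A|lebesgue. \<rho>' (h + x))\<bar> =
      \<bar>LINT x:A|lebesgue. \<rho> (h + x) - \<rho>' (h + x)\<bar>"
    using set_integral_diff[OF i] by simp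
  also have "\<dots> \<le> (LINT x:A|lebesgue. \<bar>\<rho> (h + x) - \<rho>' (h + x)\<bar>)"
    using set_integral_norm_bound[OF set_integral_diff(1)[OF i]] by simp
  also have "\<dots> \<le> (LINT x:A|lebesgue. e)"
    using set_integrable_abs[OF set_integral_diff(1)[OF i]] c e by (intro set_integral_mono) auto
  finally have "\<bar>(LINT x:A|lebesgue. \<rho> (h + x)) - (LINT x:A|lebesgue. \<rho>' (h + x))\<bar> \<le> e * measure lebesgue A"
    unfolding ce .
  then show ?thesis
    using A by (simp add: set_avg_def averaging_set_def diff_divide_distrib[symmetric] abs_divide pos_divide_le_eq)
qed

lemma set_avg_const: "averaging_set A \<Longrightarrow> set_avg A (\<lambda>_. c) h = c"
  using bounded_set_imp_lmeasurable[of A]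
  by (auto simp: set_avg_def averaging_set_def set_lebesgue_integral_def fmeasurable_def)

lemma set_avg_scale: "set_avg A (\<lambda>x. c * \<rho> x) h = c * set_avg A \<rho> h"
  by (simp add: set_avg_def)

lemma set_avg_add:
  assumes "averaging_set A" "bounded_borel \<rho>" "bounded_borel \<rho>'"
  shows "set_avg A (\<lambda>x. \<rho> x + \<rho>' x) h = set_avg A \<rho> h + set_avg A \<rho>' h"
  using assms by (simp add: set_avg_def averaging_set_def set_integral_add bounded_borel_shift_integrable add_divide_distrib)

lemma set_avg_nonneg:
  assumes "averaging_set A" "\<And>x. 0 \<le> \<rho> x" shows "0 \<le> set_avg A \<rho> h"
  using assms unfolding set_avg_def set_lebesgue_integral_def averaging_set_def
  by (intro divide_nonneg_pos integral_nonneg) auto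

lemma set_avg_shift: "set_avg A (\<lambda>x. \<rho> (x + g)) h = set_avg A \<rho> (h + g)"
  by (simp add: set_avg_def add_ac)

lemma bounded_borel_const [simp]: "bounded_borel (\<lambda>_. c)"
  by (auto simp: bounded_borel_def)

lemma bounded_borel_scale: "bounded_borel \<rho> \<Longrightarrow> bounded_borel (\<lambda>x. c * \<rho> x)"
proof -
  assume "bounded_borel \<rho>"
  then obtain K where "\<And>x. \<bar>\<rho> x\<bar> \<le> K" and m: "\<rho> \<in> borel_measurable borel" by (auto simp: bounded_borel_def)
  then have "\<bar>c * \<rho> x\<bar> \<le> \<bar>c\<bar> * K" for x by (simp add: abs_mult mult_left_mono)
  then show ?thesis using m unfolding bounded_borel_def by auto
qed

lemma bounded_borel_add: "bounded_borel \<rho> \<Longrightarrow> bounded_borel \<rho>' \<Longrightarrow> bounded_borel (\<lambda>x. \<rho> x + \<rho>' x)"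
proof -
  assume a: "bounded_borel \<rho>" "bounded_borel \<rho>'"
  then obtain K K' where "\<And>x. \<bar>\<rho> x\<bar> \<le> K" "\<And>x. \<bar>\<rho>' x\<bar> \<le> K'" by (auto simp: bounded_borel_def)
  then have "\<bar>\<rho> x + \<rho>' x\<bar> \<le> K + K'" for x by (meson abs_triangle_ineq add_mono order_trans)
  then show ?thesis using a unfolding bounded_borel_def by auto
qed

lemma bounded_borel_indicator: "A \<in> sets borel \<Longrightarrow> bounded_borel (indicator A)"
  by (auto simp: bounded_borel_def indicator_def intro!: exI[of _ 1])

text \<open>The constant may depend on \<open>\<epsilon>\<close>. In this form the notion passes to
  uniform limits directly, and for visits the constant only has to be a finite partial sum of
  weighted frequencies. A common limit is extracted in \<open>uniform_mean_limit\<close>.\<close>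

definition uniform_mean :: "(nat \<Rightarrow> (real^'d::finite) set) \<Rightarrow> (real^'d \<Rightarrow> real) \<Rightarrow> bool" where
  "uniform_mean F \<rho> \<longleftrightarrow> bounded_borel \<rho> \<and>
    (\<forall>\<epsilon>>0. \<exists>c. \<forall>\<^sub>F n in sequentially. \<forall>h. \<bar>set_avg (F n) \<rho> h - c\<bar> \<le> \<epsilon>)"

context
  fixes F :: "nat \<Rightarrow> (real^'d::finite) set"
  assumes F: "\<And>n. averaging_set (F n)"
begin

lemma uniform_mean_const: "uniform_mean F (\<lambda>_. c)"
  unfolding uniform_mean_def using set_avg_const[OF F] by (auto intro!: exI[of _ c])

lemma uniform_mean_scale:
  assumes "uniform_mean F \<rho>" shows "uniform_mean F (\<lambda>x. a * \<rho> x)"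
  unfolding uniform_mean_def
proof (intro conjI allI impI)
  show "bounded_borel (\<lambda>x. a * \<rho> x)" using assms by (simp add: uniform_mean_def bounded_borel_scale)
  fix \<epsilon> :: real assume "\<epsilon> > 0"
  then have "\<epsilon> / (\<bar>a\<bar> + 1) > 0" by (simp add: add_nonneg_pos)
  then obtain c where c: "\<forall>\<^sub>F n in sequentially. \<forall>h. \<bar>set_avg (F n) \<rho> h - c\<bar> \<le> \<epsilon> / (\<bar>a\<bar> + 1)"
    using assms unfolding uniform_mean_def by blast
  have "\<bar>a * s - a * c\<bar> \<le> \<epsilon>" if "\<bar>s - c\<bar> \<le> \<epsilon> / (\<bar>a\<bar> + 1)" for s
  proof -
    have "\<bar>a * s - a * c\<bar> = \<bar>a\<bar> * \<bar>s - c\<bar>" by (simp add: abs_mult[symmetric] algebra_simps)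
    also have "\<dots> \<le> (\<bar>a\<bar> + 1) * (\<epsilon> / (\<bar>a\<bar> + 1))" using that by (intro mult_mono) auto
    also have "\<dots> = \<epsilon>" by (simp add: add_nonneg_eq_0_iff)
    finally show ?thesis .
  qed
  then show "\<exists>c. \<forall>\<^sub>F n in sequentially. \<forall>h. \<bar>set_avg (F n) (\<lambda>x. a * \<rho> x) h - c\<bar> \<le> \<epsilon>"
    using c unfolding set_avg_scale by (intro exI[of _ "a * c"]) (auto elim!: eventually_mono)
qed

lemma uniform_mean_add:
  assumes "uniform_mean F \<rho>" "uniform_mean F \<rho>'" shows "uniform_mean F (\<lambda>x. \<rho> x + \<rho>' x)"
  unfolding uniform_mean_def
proof (intro conjI allI impI)
  have b: "bounded_borel \<rho>" "bounded_borel \<rho>'" using assms by (auto simp: uniform_mean_def)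
  then show "bounded_borel (\<lambda>x. \<rho> x + \<rho>' x)" by (rule bounded_borel_add)
  fix \<epsilon> :: real assume "\<epsilon> > 0"
  then have "\<epsilon> / 2 > 0" by simp
  obtain c where c: "\<forall>\<^sub>F n in sequentially. \<forall>h. \<bar>set_avg (F n) \<rho> h - c\<bar> \<le> \<epsilon> / 2"
    using assms(1) \<open>\<epsilon> / 2 > 0\<close> unfolding uniform_mean_def by blast
  obtain c' where c': "\<forall>\<^sub>F n in sequentially. \<forall>h. \<bar>set_avg (F n) \<rho>' h - c'\<bar> \<le> \<epsilon> / 2"
    using assms(2) \<open>\<epsilon> / 2 > 0\<close> unfolding uniform_mean_def by blast
  have "\<forall>\<^sub>F n in sequentially. \<forall>h. \<bar>set_avg (F n) (\<lambda>x. \<rho> x + \<rho>' x) h - (c + c')\<bar> \<le> \<epsilon>"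
    using c c'
  proof eventually_elim
    case (elim n)
    show ?case
    proof
      fix h
      have "\<bar>set_avg (F n) \<rho> h - c\<bar> \<le> \<epsilon> / 2" "\<bar>set_avg (F n) \<rho>' h - c'\<bar> \<le> \<epsilon> / 2" using elim by auto
      then show "\<bar>set_avg (F n) (\<lambda>x. \<rho> x + \<rho>' x) h - (c + c')\<bar> \<le> \<epsilon>"
        unfolding set_avg_add[OF F b] by linarith
    qed
  qed
  then show "\<exists>c. \<forall>\<^sub>F n in sequentially. \<forall>h. \<bar>set_avg (F n) (\<lambda>x. \<rho> x + \<rho>' x) h - c\<bar> \<le> \<epsilon>" ..
qed

lemma uniform_mean_sum:
  "finite S \<Longrightarrow> (\<And>i. i \<in> S \<Longrightarrow> uniform_mean F (\<rho> i)) \<Longrightarrow> uniform_mean F (\<lambda>x. \<Sum>i\<in>S. \<rho> i x)"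
  by (induction S rule: finite_induct) (auto intro: uniform_mean_add uniform_mean_const)

lemma uniform_mean_approx:
  assumes b: "bounded_borel \<rho>"
    and ap: "\<And>\<epsilon>. \<epsilon> > 0 \<Longrightarrow> \<exists>\<rho>'. uniform_mean F \<rho>' \<and> (\<forall>x. \<bar>\<rho> x - \<rho>' x\<bar> \<le> \<epsilon>)"
  shows "uniform_mean F \<rho>"
  unfolding uniform_mean_def
proof (intro conjI allI impI b)
  fix \<epsilon> :: real assume "\<epsilon> > 0"
  then have "\<epsilon> / 2 > 0" by simp
  then obtain \<rho>' where u: "uniform_mean F \<rho>'" and close: "\<And>x. \<bar>\<rho> x - \<rho>' x\<bar> \<le> \<epsilon> / 2" using ap by blast
  obtain c where c: "\<forall>\<^sub>F n in sequentially. \<forall>h. \<bar>set_avg (F n) \<rho>' h - c\<bar> \<le> \<epsilon> / 2"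
    using u \<open>\<epsilon> / 2 > 0\<close> unfolding uniform_mean_def by blast
  have le: "\<bar>set_avg (F n) \<rho> h - set_avg (F n) \<rho>' h\<bar> \<le> \<epsilon> / 2" for n h
    using u by (intro set_avg_bound F b close) (simp add: uniform_mean_def)
  have "\<bar>set_avg (F n) \<rho> h - c\<bar> \<le> \<epsilon>" if "\<bar>set_avg (F n) \<rho>' h - c\<bar> \<le> \<epsilon> / 2" for n h
    using le[of n h] that by linarith
  then show "\<exists>c. \<forall>\<^sub>F n in sequentially. \<forall>h. \<bar>set_avg (F n) \<rho> h - c\<bar> \<le> \<epsilon>"
    using c by (intro exI[of _ c]) (auto elim!: eventually_mono)
qed

text \<open>The averages at the single base point 0 form a Cauchy sequence. For each tolerance its
  limit is near the corresponding constant, hence near the averages at every base point.\<close>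

lemma uniform_mean_limit:
  assumes "uniform_mean F \<rho>"
  obtains c where "\<And>\<epsilon>. \<epsilon> > 0 \<Longrightarrow> \<forall>\<^sub>F n in sequentially. \<forall>h. \<bar>set_avg (F n) \<rho> h - c\<bar> \<le> \<epsilon>"
proof -
  have ev: "\<exists>c. \<forall>\<^sub>F n in sequentially. \<forall>h. \<bar>set_avg (F n) \<rho> h - c\<bar> \<le> \<epsilon>" if "\<epsilon> > 0" for \<epsilon>
    using assms that by (auto simp: uniform_mean_def)
  have "Cauchy (\<lambda>n. set_avg (F n) \<rho> 0)"
  proof (rule metric_CauchyI)
    fix e :: real assume "e > 0"
    then obtain c N where c: "\<And>n h. n \<ge> N \<Longrightarrow> \<bar>set_avg (F n) \<rho> h - c\<bar> \<le> e / 3"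
      using ev[of "e / 3"] by (auto simp: eventually_sequentially)
    have "dist (set_avg (F m) \<rho> 0) (set_avg (F n) \<rho> 0) < e" if "m \<ge> N" "n \<ge> N" for m n
      using c[OF that(1), of 0] c[OF that(2), of 0] \<open>e > 0\<close> unfolding dist_real_def by linarith
    then show "\<exists>M. \<forall>m\<ge>M. \<forall>n\<ge>M. dist (set_avg (F m) \<rho> 0) (set_avg (F n) \<rho> 0) < e" by blast
  qed
  then obtain l where l: "(\<lambda>n. set_avg (F n) \<rho> 0) \<longlonglongrightarrow> l" using Cauchy_convergent convergent_def by blast
  show thesis
  proof (rule that)
    fix e :: real assume "e > 0"
    then obtain c where c: "\<forall>\<^sub>F n in sequentially. \<forall>h. \<bar>set_avg (F n) \<rho> h - c\<bar> \<le> e / 3"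
      using ev[of "e / 3"] by auto
    have "\<forall>\<^sub>F n in sequentially. dist (set_avg (F n) \<rho> 0) l < e / 3" using tendstoD[OF l, of "e / 3"] \<open>e > 0\<close> by simp
    with c show "\<forall>\<^sub>F n in sequentially. \<forall>h. \<bar>set_avg (F n) \<rho> h - l\<bar> \<le> e"
    proof eventually_elim
      case (elim n)
      show ?case
      proof
        fix h
        have "\<bar>set_avg (F n) \<rho> h - c\<bar> \<le> e / 3" "\<bar>set_avg (F n) \<rho> 0 - c\<bar> \<le> e / 3" using elim by auto
        then show "\<bar>set_avg (F n) \<rho> h - l\<bar> \<le> e" using elim(2) unfolding dist_real_def by linarith
      qed
    qed
  qed
qed

end

text \<open>A Riemann sum over grid cubes: the weight of a cube is its share of \<open>A\<close>,
  and the sampling point is arbitrary. Uniform continuity makes the error independent of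
  \<open>h\<close>. The choice of \<open>p B\<close> is used only when some point of
  \<open>A\<close> lies in \<open>B\<close>, so a witness exists there.\<close>

lemma set_avg_discretize:
  fixes A :: "(real^'d::finite) set"
  assumes A: "averaging_set A" and b: "bounded_borel \<phi>"
    and uc: "\<And>e. e > 0 \<Longrightarrow> \<exists>\<delta>>0. \<forall>x y. dist x y < \<delta> \<longrightarrow> \<bar>\<phi> x - \<phi> y\<bar> < e" and e: "e > 0"
  shows "\<exists>S w (p :: (real^'d) set \<Rightarrow> real^'d). finite S \<and> (\<forall>B\<in>S. 0 \<le> w B) \<and> sum w S = 1 \<and>
    (\<forall>h. \<bar>(\<Sum>B\<in>S. w B * \<phi> (h + p B)) - set_avg A \<phi> h\<bar> \<le> e)"
proof -
  obtain \<delta> where \<delta>: "\<delta> > 0" "\<And>x y. dist x y < \<delta> \<Longrightarrow> \<bar>\<phi> x - \<phi> y\<bar> < e" using uc[OF e] by blast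
  obtain K where K: "\<And>x. x \<in> A \<Longrightarrow> norm x \<le> K" using A by (auto simp: averaging_set_def bounded_iff)
  obtain N where "K < 2 ^ N" using real_arch_pow[of 2 K] by auto
  have "K < (2::real) ^ n" if "n \<ge> N" for n
    using \<open>K < 2 ^ N\<close> power_increasing[OF that, of "2::real"] by linarith
  then have "\<forall>\<^sub>F m in sequentially. K < (2::real) ^ m"
    by (auto simp: eventually_sequentially)
  moreover have "\<forall>\<^sub>F m in sequentially. real CARD('d) / 2 ^ m < \<delta>"
    using order_tendstoD(2)[OF inverse_power2_tendsto \<delta>(1)] .
  ultimately have "\<forall>\<^sub>F m in sequentially. K < (2::real) ^ m \<and> real CARD('d) / 2 ^ m < \<delta>" by eventually_elim simp
  then obtain m where m: "K < (2::real) ^ m" "real CARD('d) / 2 ^ m < \<delta>"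
    using eventually_happens'[OF sequentially_bot] by blast
  let ?S = "grid_cubes m :: (real^'d) set set"
  have sub: "A \<subseteq> big_cube m" using K m(1) by (fastforce intro: mem_big_cube)
  have fin: "finite ?S" by (rule finite_grid_cubes)
  define V where "V = measure lebesgue A"
  have V: "V > 0" using A by (simp add: V_def averaging_set_def)
  define w where "w = (\<lambda>B. measure lebesgue (A \<inter> B) / V)"
  define p where "p = (\<lambda>B :: (real^'d) set. SOME x. x \<in> B)"
  have Bs: "B \<in> sets lebesgue" if "B \<in> ?S" for B using grid_cube_borel[OF that] by auto
  have AB: "A \<inter> B \<in> lmeasurable" if "B \<in> ?S" for B
    using A Bs[OF that] by (intro bounded_set_imp_lmeasurable) (auto simp: averaging_set_def intro: bounded_subset)
  have disj: "disjoint_family_on (\<lambda>B. A \<inter> B) ?S"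
    using grid_cubes_eq unfolding disjoint_family_on_def by blast
  have Un: "(\<Union>B\<in>?S. A \<inter> B) = A" using sub Union_grid_cubes by blast
  have "V = (\<Sum>B\<in>?S. measure lebesgue (A \<inter> B))"
    using measure_finite_Union[OF fin _ disj, of lebesgue] AB unfolding Un V_def
    by (auto simp: fmeasurable_def less_top simp del: emeasure_completion)
  then have w1: "sum w ?S = 1" using V by (simp add: w_def sum_divide_distrib[symmetric])
  have cl: "\<bar>w B * \<phi> (h + p B) - (LINT x:A \<inter> B|lebesgue. \<phi> (h + x)) / V\<bar> \<le> e * w B" if B: "B \<in> ?S" for B h
  proof -
    have i: "set_integrable lebesgue (A \<inter> B) (\<lambda>x. \<phi> (h + x))"
      using A Bs[OF B] by (intro bounded_borel_shift_integrable[OF b]) (auto simp: averaging_set_def intro: bounded_subset)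
    have c: "set_integrable lebesgue (A \<inter> B) (\<lambda>x. c)" "(LINT x:A \<inter> B|lebesgue. c) = c * measure lebesgue (A \<inter> B)" for c :: real
      using AB[OF B] by (auto simp: set_integrable_def set_lebesgue_integral_def fmeasurable_def)
    have "\<bar>\<phi> (h + p B) - \<phi> (h + x)\<bar> \<le> e" if "x \<in> A \<inter> B" for x
    proof -
      have "p B \<in> B" unfolding p_def by (rule someI[of _ x]) (use that in simp)
      then have "dist (h + p B) (h + x) < \<delta>" using dist_grid_cube[OF B, of "p B" x] that m(2) by simp
      then show ?thesis using \<delta>(2) less_imp_le by blast
    qed
    then have "\<bar>LINT x:A \<inter> B|lebesgue. \<phi> (h + p B) - \<phi> (h + x)\<bar> \<le> (LINT x:A \<inter> B|lebesgue. e)"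
      using set_integral_norm_bound[OF set_integral_diff(1)[OF c(1)[of "\<phi> (h + p B)"] i]]
        set_integral_mono[OF set_integrable_abs[OF set_integral_diff(1)[OF c(1)[of "\<phi> (h + p B)"] i]] c(1)[of e]]
      by fastforce
    then have "\<bar>\<phi> (h + p B) * measure lebesgue (A \<inter> B) - (LINT x:A \<inter> B|lebesgue. \<phi> (h + x))\<bar> \<le> e * measure lebesgue (A \<inter> B)"
      using set_integral_diff(2)[OF c(1)[of "\<phi> (h + p B)"] i] by (simp add: c(2))
    then have "\<bar>\<phi> (h + p B) * measure lebesgue (A \<inter> B) - (LINT x:A \<inter> B|lebesgue. \<phi> (h + x))\<bar> / V
        \<le> e * measure lebesgue (A \<inter> B) / V"
      using V by (intro divide_right_mono) auto
    moreover have "w B * \<phi> (h + p B) - (LINT x:A \<inter> B|lebesgue. \<phi> (h + x)) / V =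
        (\<phi> (h + p B) * measure lebesgue (A \<inter> B) - (LINT x:A \<inter> B|lebesgue. \<phi> (h + x))) / V"
      by (simp add: w_def diff_divide_distrib mult.commute)
    ultimately show ?thesis using V by (simp add: w_def abs_divide)
  qed
  have "\<bar>(\<Sum>B\<in>?S. w B * \<phi> (h + p B)) - set_avg A \<phi> h\<bar> \<le> e" for h
  proof -
    have "(LINT x:(\<Union>B\<in>?S. A \<inter> B)|lebesgue. \<phi> (h + x)) = (\<Sum>B\<in>?S. LINT x:A \<inter> B|lebesgue. \<phi> (h + x))"
    proof (rule set_integral_finite_Union[OF fin disj])
      show "set_integrable lebesgue (A \<inter> B) (\<lambda>x. \<phi> (h + x))" "A \<inter> B \<in> sets lebesgue" if "B \<in> ?S" for B
        using A Bs[OF that] by (auto simp: averaging_set_def intro!: bounded_borel_shift_integrable[OF b] intro: bounded_subset)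
    qed
    then have "set_avg A \<phi> h = (\<Sum>B\<in>?S. (LINT x:A \<inter> B|lebesgue. \<phi> (h + x)) / V)"
      unfolding Un set_avg_def V_def[symmetric] by (simp add: sum_divide_distrib)
    then have "\<bar>(\<Sum>B\<in>?S. w B * \<phi> (h + p B)) - set_avg A \<phi> h\<bar> =
        \<bar>\<Sum>B\<in>?S. (w B * \<phi> (h + p B) - (LINT x:A \<inter> B|lebesgue. \<phi> (h + x)) / V)\<bar>"
      by (simp add: sum_subtractf)
    also have "\<dots> \<le> (\<Sum>B\<in>?S. e * w B)" by (intro order_trans[OF sum_abs] sum_mono cl)
    also have "\<dots> = e" by (simp add: sum_distrib_left[symmetric] w1)
    finally show ?thesis .
  qed
  moreover have "\<forall>B\<in>?S. 0 \<le> w B" using V by (simp add: w_def)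
  ultimately show ?thesis using fin w1 by blast
qed

section \<open>Visits to a cube pattern\<close>

text \<open>The segment from a point of \<open>A\<close> to a point outside is connected and
  therefore meets the frontier.\<close>

lemma infdist_frontier_le:
  fixes x y :: "'a::euclidean_space"
  assumes "(x \<in> A) \<noteq> (y \<in> A)"
  shows "infdist x (frontier A) \<le> dist x y"
proof -
  have "closed_segment x y \<inter> frontier A \<noteq> {}"
    using assms ends_in_segment[of x y] by (intro connected_Int_frontier) auto
  then obtain z where z: "z \<in> closed_segment x y" "z \<in> frontier A" by blast
  then have "infdist x (frontier A) \<le> dist x z" by (simp add: infdist_le)
  also have "\<dots> \<le> dist x y" using dist_in_closed_segment(1)[OF z(1)] by (simp add: dist_commute)
  finally show ?thesis .
qed

definition boundary_collar :: "real \<Rightarrow> (real^'d::finite) set \<Rightarrow> (real^'d) set" where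
  "boundary_collar r A = {x. infdist x (frontier A) \<le> r}"

lemma boundary_collar_translation: "boundary_collar r ((+) h ` A) = (+) h ` boundary_collar r A"
proof -
  have "infdist x ((+) h ` S) = infdist (x - h) S" for x and S :: "(real^'a) set"
    by (simp add: infdist_def image_image dist_norm diff_diff_eq)
  then show ?thesis
    unfolding boundary_collar_def frontier_translation
    by (auto intro!: image_eqI[of _ _ "_ - h"])
qed

lemma boundary_collar_lmeasurable:
  assumes "averaging_set A"
  shows "boundary_collar r A \<in> lmeasurable"
proof (rule bounded_set_imp_lmeasurable)
  \<comment> \<open>For an empty frontier \<open>infdist\<close> would be 0 by convention and a
    collar with \<open>r \<ge> 0\<close> the whole space.\<close>
  have ne: "frontier A \<noteq> {}"
  proof
    assume "frontier A = {}"
    then have "A = {} \<or> A = UNIV" by (simp add: frontier_eq_empty)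
    then show False using assms not_bounded_UNIV[where 'a = "real^'a"] by (auto simp: averaging_set_def)
  qed
  obtain K where K: "\<And>y. y \<in> frontier A \<Longrightarrow> norm y \<le> K"
    using assms bounded_subset[OF bounded_closure, of A "frontier A"]
    by (auto simp: averaging_set_def bounded_iff frontier_def)
  have "norm x \<le> K + r" if "x \<in> boundary_collar r A" for x
  proof -
    obtain y where y: "y \<in> frontier A" "infdist x (frontier A) = dist x y"
      using infdist_attains_inf[OF frontier_closed ne] by blast
    then have "norm (x - y) \<le> r" using that by (simp add: boundary_collar_def dist_norm)
    then show ?thesis using K[OF y(1)] norm_triangle_sub[of x y] by linarith
  qed
  then show "bounded (boundary_collar r A)" by (auto simp: bounded_iff)
  have "closed (boundary_collar r A)"
    unfolding boundary_collar_def by (intro closed_Collect_le continuous_intros)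
  then have "boundary_collar r A \<in> sets borel" by (rule borel_closed)
  then show "boundary_collar r A \<in> sets lebesgue" by auto
qed

lemma averaging_set_translation: "averaging_set A \<Longrightarrow> averaging_set ((+) h ` A)"
  using measurable_translation[of A h] bounded_set_imp_lmeasurable[of A]
  by (auto simp: averaging_set_def measure_translation bounded_translation)

lemma set_avg_indicator:
  assumes "averaging_set A" "T \<in> sets borel"
  shows "set_avg A (indicator T) h = measure lebesgue (T \<inter> (+) h ` A) / measure lebesgue A"
proof -
  have T': "{x. h + x \<in> T} \<in> sets lebesgue"
  proof -
    have "{x. h + x \<in> T} = (\<lambda>x. h + x) -` T \<inter> space borel" by auto
    also have "\<dots> \<in> sets borel" using assms(2) by (intro measurable_sets[where A = borel]) auto
    finally show ?thesis by auto
  qed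
  have "(LINT x:A|lebesgue. indicat_real T (h + x)) = (LINT x|lebesgue. indicat_real (A \<inter> {x. h + x \<in> T}) x)"
    unfolding set_lebesgue_integral_def by (intro Bochner_Integration.integral_cong) (auto simp: indicator_def)
  also have "\<dots> = measure lebesgue (A \<inter> {x. h + x \<in> T})"
    using assms(1) T' by (auto simp: averaging_set_def)
  also have "\<dots> = measure lebesgue ((+) h ` (A \<inter> {x. h + x \<in> T}))" by (simp add: measure_translation)
  also have "(+) h ` (A \<inter> {x. h + x \<in> T}) = T \<inter> (+) h ` A" by auto
  finally show ?thesis by (simp add: set_avg_def)
qed

text \<open>The strict bound \<open>1 / 2 ^ m\<close> in the maximum norm is what two points of one
  half-open cube satisfy, so every cube holds at most one point of any translate of
  \<open>\<Lambda>\<close>.\<close>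

locale separated_delone =
  fixes \<Lambda> :: "('d::finite, 'k::finite) coloured" and m :: nat
  assumes delone: "delone_kset \<Lambda>"
    and sep: "\<And>y z. y \<in> support \<Lambda> \<Longrightarrow> z \<in> support \<Lambda> \<Longrightarrow> infnorm (y - z) < 1 / 2 ^ m \<Longrightarrow> y = z"
begin

lemma kset_unique: "(y, i) \<in> \<Lambda> \<Longrightarrow> (y, j) \<in> \<Lambda> \<Longrightarrow> i = j"
  using delone by (auto simp: delone_kset_def kset_def colour_class_def)

lemma same_cube_unique:
  assumes "(y, i) \<in> translate t \<Lambda>" "(z, j) \<in> translate t \<Lambda>" "B \<in> grid_cubes m" "y \<in> B" "z \<in> B"
  shows "y = z \<and> i = j"
proof -
  have "infnorm ((y - t) - (z - t)) < 1 / 2 ^ m" using infnorm_grid_cube[OF assms(3-5)] by simp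
  then have "y - t = z - t"
    using assms(1,2) by (intro sep) (auto simp: mem_translate_iff support_def colour_class_def)
  then show ?thesis using kset_unique assms(1,2) by (auto simp: mem_translate_iff)
qed

lemma same_coloured_cube_unique:
  assumes "p \<in> translate t \<Lambda>" "q \<in> translate t \<Lambda>" "p \<in> cube_points C" "q \<in> cube_points C"
    "fst C \<in> grid_cubes m"
  shows "p = q"
  using same_cube_unique[of "fst p" "snd p" t "fst q" "snd q" "fst C"] assms
  by (auto simp: cube_points_def mem_Times_iff prod_eq_iff)

lemma finite_bounded_part:
  assumes "bounded A" shows "finite {p \<in> \<Lambda>. fst p \<in> A}"
proof -
  have "uniform_discrete (support \<Lambda> \<inter> A)"
    using delone by (auto simp: delone_kset_def delone_def intro: uniform_discrete_subset)
  moreover have "bounded (support \<Lambda> \<inter> A)" using assms by (auto intro: bounded_subset)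
  ultimately have "finite (support \<Lambda> \<inter> A)" using uniform_discrete_finite_iff by blast
  then have "finite ((support \<Lambda> \<inter> A) \<times> (UNIV :: 'k set))" by simp
  then show ?thesis by (rule rev_finite_subset) (auto simp: support_def colour_class_def)
qed

lemma countable_points: "countable \<Lambda>"
proof -
  have "\<Lambda> = (\<Union>n::nat. {p \<in> \<Lambda>. fst p \<in> cball 0 (real n)})" using real_arch_simple by auto
  moreover have "countable (\<Union>n::nat. {p \<in> \<Lambda>. fst p \<in> cball 0 (real n)})"
  proof (rule countable_UN)
    show "countable {p \<in> \<Lambda>. fst p \<in> cball 0 (real n)}" for n
      by (intro countable_finite finite_bounded_part bounded_cball)
  qed simp
  ultimately show ?thesis by simp
qed

text \<open>Inside a translate of \<open>\<Lambda>\<close> no cube holds two points, so "exactly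
  one" reduces to "at least one". The cubes partition the big cube, so avoiding those outside
  \<open>D\<close> means staying within \<open>D\<close>.\<close>

lemma patterns_iff:
  assumes P: "P \<subseteq> translate t \<Lambda>" "finite P" and D: "D \<in> cube_families m"
  shows "P \<in> patterns m D \<longleftrightarrow> P \<subseteq> \<Union>(cube_points ` D) \<and> D \<subseteq> hit m P"
proof
  assume pat: "P \<in> patterns m D"
  have "D \<subseteq> hit m P"
    using D pat by (fastforce simp: cube_families_def patterns_def hit_def)
  moreover have "p \<in> \<Union>(cube_points ` D)" if "p \<in> P" for p
  proof -
    have "fst p \<in> big_cube m" using pat that by (auto simp: patterns_def)
    then obtain B where B: "B \<in> grid_cubes m" "fst p \<in> B" by (auto simp: Union_grid_cubes[symmetric])
    then have "(B, snd p) \<in> coloured_cubes m" "p \<in> cube_points (B, snd p)"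
      by (auto simp: coloured_cubes_def cube_points_def mem_Times_iff)
    then have "(B, snd p) \<in> D" using pat that by (auto simp: patterns_def)
    then show ?thesis using \<open>p \<in> cube_points (B, snd p)\<close> by blast
  qed
  ultimately show "P \<subseteq> \<Union>(cube_points ` D) \<and> D \<subseteq> hit m P" by blast
next
  assume h: "P \<subseteq> \<Union>(cube_points ` D) \<and> D \<subseteq> hit m P"
  have Dc: "C \<in> coloured_cubes m" "fst C \<in> grid_cubes m" if "C \<in> D" for C
    using D that by (auto simp: cube_families_def coloured_cubes_def mem_Times_iff)
  show "P \<in> patterns m D"
    unfolding patterns_def
  proof (intro CollectI conjI ballI)
    show "P \<subseteq> big_cube m \<times> UNIV"
    proof
      fix p assume "p \<in> P"
      then obtain C where "C \<in> D" "p \<in> cube_points C" using h by blast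
      then show "p \<in> big_cube m \<times> UNIV"
        using Dc(2)[of C] unfolding Union_grid_cubes[symmetric] by (auto simp: cube_points_def mem_Times_iff)
    qed
    show "\<exists>p. P \<inter> cube_points C = {p}" if C: "C \<in> D" for C
    proof -
      obtain p where p: "p \<in> P" "p \<in> cube_points C"
        using subsetD[OF conjunct2[OF h] C] unfolding hit_def by blast
      have "q = p" if q: "q \<in> P" "q \<in> cube_points C" for q
        using same_coloured_cube_unique[OF _ _ q(2) p(2) Dc(2)[OF C]] P(1) p q by blast
      then show ?thesis using p by blast
    qed
    show "P \<inter> cube_points C = {}" if C: "C \<in> coloured_cubes m - D" for C
    proof (rule ccontr)
      assume "P \<inter> cube_points C \<noteq> {}"
      then obtain p C' where p: "p \<in> cube_points C" "C' \<in> D" "p \<in> cube_points C'" using h by blast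
      have "fst C \<in> grid_cubes m" using C by (auto simp: coloured_cubes_def)
      then have "fst C = fst C'" "snd C = snd C'"
        using grid_cubes_eq[of "fst C" m "fst C'" "fst p"] Dc(2)[OF p(2)] p by (auto simp: cube_points_def mem_Times_iff)
      then have "C = C'" by (simp add: prod_eq_iff)
      then show False using C p(2) by simp
    qed
  qed (rule P(2))
qed

text \<open>Each point of either pattern lies in a cube of \<open>D\<close>, the other pattern has a
  point in the same coloured cube, and the common translate has only one there.\<close>

lemma patterns_unique:
  assumes P: "P \<subseteq> translate t \<Lambda>" "P \<in> patterns m D" and Q: "Q \<subseteq> translate t \<Lambda>" "Q \<in> patterns m D"
    and D: "D \<in> cube_families m"
  shows "P = Q"
proof -
  have "P \<subseteq> Q" if P: "P \<subseteq> translate t \<Lambda>" "P \<in> patterns m D" and Q: "Q \<subseteq> translate t \<Lambda>" "Q \<in> patterns m D"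
    for P Q
  proof
    fix p assume p: "p \<in> P"
    have fin: "finite P" "finite Q" using P Q by (auto simp: patterns_def)
    obtain C where C: "C \<in> D" "p \<in> cube_points C"
      using P(2) p patterns_iff[OF P(1) fin(1) D] by blast
    have "C \<in> hit m Q" using Q(2) C(1) patterns_iff[OF Q(1) fin(2) D] by blast
    then obtain q where q: "q \<in> Q" "q \<in> cube_points C" unfolding hit_def by blast
    have "fst C \<in> grid_cubes m"
      using D C(1) by (auto simp: cube_families_def coloured_cubes_def mem_Times_iff)
    then have "p = q"
      using same_coloured_cube_unique[OF _ _ C(2) q(2)] P(1) Q(1) p q by blast
    then show "p \<in> Q" using q by simp
  qed
  then show ?thesis using P Q by blast
qed

text \<open>The witness keeps the points of the translate in the cubes of \<open>D\<close> and
  discards the others, so cubes outside \<open>D\<close> may be hit by the translate.\<close>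

lemma pattern_exists:
  assumes D: "D \<in> cube_families m" and hit: "D \<subseteq> hit m (translate t \<Lambda>)"
  obtains P where "P \<in> patterns m D" "P \<subseteq> translate t \<Lambda>"
proof -
  define P where "P = translate t \<Lambda> \<inter> \<Union>(cube_points ` D)"
  have "finite D"
    using D finite_subset[OF _ finite_coloured_cubes] by (auto simp: cube_families_def)
  moreover have "finite (translate t \<Lambda> \<inter> cube_points C)" if "C \<in> D" for C
  proof -
    have "fst C \<in> grid_cubes m"
      using D that by (auto simp: cube_families_def coloured_cubes_def mem_Times_iff)
    then have "p = q" if "p \<in> translate t \<Lambda> \<inter> cube_points C" "q \<in> translate t \<Lambda> \<inter> cube_points C" for p q
      using same_coloured_cube_unique[of p t q C] that by blast
    then show ?thesis by (metis finite.emptyI finite.insertI finite_subset singletonI subsetI)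
  qed
  ultimately have "finite (\<Union>C\<in>D. translate t \<Lambda> \<inter> cube_points C)" by blast
  moreover have "P = (\<Union>C\<in>D. translate t \<Lambda> \<inter> cube_points C)" by (auto simp: P_def)
  ultimately have fin: "finite P" by simp
  have "D \<subseteq> hit m P" using hit by (fastforce simp: P_def hit_def)
  then have "P \<in> patterns m D"
    using patterns_iff[OF _ fin D] by (auto simp: P_def)
  then show thesis using that by (auto simp: P_def)
qed

text \<open>\<open>\<Lambda>\<close> is countable, so hitting one cube is a countable union of Borel
  conditions, one for each point of \<open>\<Lambda>\<close>; the family \<open>D\<close> is
  finite.\<close>

lemma hit_set_borel:
  assumes "D \<subseteq> coloured_cubes m"
  shows "{x. D \<subseteq> hit m (translate (- x) \<Lambda>)} \<in> sets borel"
proof -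
  have fin: "finite D" using assms finite_coloured_cubes finite_subset by blast
  have eq: "{x. D \<subseteq> hit m (translate (- x) \<Lambda>)} = {x \<in> space borel. \<forall>C\<in>D. \<exists>p\<in>\<Lambda>. snd p = snd C \<and> fst p - x \<in> fst C}"
  proof -
    have "C \<in> hit m (translate (- x) \<Lambda>) \<longleftrightarrow> (\<exists>p\<in>\<Lambda>. snd p = snd C \<and> fst p - x \<in> fst C)" if "C \<in> D" for C x
    proof -
      have "C \<in> hit m (translate (- x) \<Lambda>) \<longleftrightarrow> (\<exists>y. (y, snd C) \<in> translate (- x) \<Lambda> \<and> y \<in> fst C)"
        using that assms by (auto simp: hit_def cube_points_def)
      also have "\<dots> \<longleftrightarrow> (\<exists>y. (y, snd C) \<in> \<Lambda> \<and> y - x \<in> fst C)"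
        unfolding mem_translate_iff by (metis add_diff_cancel diff_add_cancel diff_minus_eq_add)
      also have "\<dots> \<longleftrightarrow> (\<exists>p\<in>\<Lambda>. snd p = snd C \<and> fst p - x \<in> fst C)" by force
      finally show ?thesis .
    qed
    then show ?thesis unfolding subset_iff space_borel by (intro Collect_cong) blast
  qed
  have "{x \<in> space borel. snd p = snd C \<and> fst p - x \<in> fst C} \<in> sets borel" if "C \<in> D" for p C
  proof -
    have "fst C \<in> sets borel"
      using that assms by (intro grid_cube_borel[of _ m]) (auto simp: coloured_cubes_def mem_Times_iff)
    then have "(\<lambda>x. fst p - x) -` fst C \<inter> space borel \<in> sets borel"
      by (intro measurable_sets[where A = borel]) auto
    moreover have "{x \<in> space borel. snd p = snd C \<and> fst p - x \<in> fst C} =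
        (if snd p = snd C then (\<lambda>x. fst p - x) -` fst C \<inter> space borel else {})" by auto
    ultimately show ?thesis by simp
  qed
  then show ?thesis
    unfolding eq by (intro sets.sets_Collect_finite_All sets.sets_Collect_countable_Ex' countable_points fin)
qed

text \<open>A point of \<open>P\<close> moved by an admissible shift lies in the big cube, which
  bounds the shift. Since a translate of \<open>P\<close> lies in \<open>\<Lambda>\<close>,
  \<open>patterns_iff\<close> turns admissibility into finitely many membership conditions in Borel
  cubes.\<close>

lemma admissible_shifts_bounded_borel:
  assumes P: "translate g P \<subseteq> \<Lambda>" "finite P" "P \<noteq> {}" and D: "D \<in> cube_families m"
  shows "bounded (admissible_shifts m D P)" "admissible_shifts m D P \<in> sets borel"
proof -
  obtain p where p: "p \<in> P" using P(3) by blast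
  have "norm t \<le> CARD('d) * 2 ^ m + norm (fst p)" if "t \<in> admissible_shifts m D P" for t
  proof -
    have "(fst p + t, snd p) \<in> translate t P" using p by (simp add: mem_translate_iff)
    then have "fst p + t \<in> big_cube m" using that by (auto simp: admissible_shifts_def patterns_def)
    then show ?thesis using norm_big_cube[of "fst p + t" m] norm_triangle_ineq4[of "fst p + t" "fst p"] by simp
  qed
  then show "bounded (admissible_shifts m D P)" by (auto simp: bounded_iff)
  have fin: "finite D"
    using D finite_subset[OF _ finite_coloured_cubes] by (auto simp: cube_families_def)
  have Dc: "C \<in> coloured_cubes m" "fst C \<in> sets borel" if "C \<in> D" for C
  proof -
    show "C \<in> coloured_cubes m" using D that by (auto simp: cube_families_def)
    then show "fst C \<in> sets borel"
      by (intro grid_cube_borel[of _ m]) (auto simp: coloured_cubes_def mem_Times_iff)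
  qed
  have mem: "(\<exists>p\<in>translate t P. p \<in> cube_points C) \<longleftrightarrow> (\<exists>p\<in>P. snd p = snd C \<and> fst p + t \<in> fst C)" for t C
    by (force simp: translate_def cube_points_def)
  have "t \<in> admissible_shifts m D P \<longleftrightarrow>
      (\<forall>p\<in>P. \<exists>C\<in>D. snd p = snd C \<and> fst p + t \<in> fst C) \<and> (\<forall>C\<in>D. \<exists>p\<in>P. snd p = snd C \<and> fst p + t \<in> fst C)" for t
  proof -
    have "translate (t - g) (translate g P) \<subseteq> translate (t - g) \<Lambda>"
      using P(1) by (auto simp: translate_def)
    then have "translate t P \<subseteq> translate (t - g) \<Lambda>" by (simp add: translate_translate)
    moreover have "finite (translate t P)" using P(2) by (simp add: translate_def)
    ultimately have "t \<in> admissible_shifts m D P \<longleftrightarrow>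
        translate t P \<subseteq> \<Union>(cube_points ` D) \<and> D \<subseteq> hit m (translate t P)"
      unfolding admissible_shifts_def using patterns_iff[OF _ _ D] by blast
    also have "translate t P \<subseteq> \<Union>(cube_points ` D) \<longleftrightarrow> (\<forall>p\<in>P. \<exists>C\<in>D. snd p = snd C \<and> fst p + t \<in> fst C)"
      by (force simp: translate_def cube_points_def)
    also have "D \<subseteq> hit m (translate t P) \<longleftrightarrow> (\<forall>C\<in>D. \<exists>p\<in>translate t P. p \<in> cube_points C)"
      using Dc(1) unfolding hit_def by blast
    finally show ?thesis by (simp only: mem)
  qed
  then have eq: "admissible_shifts m D P = {t \<in> space borel. (\<forall>p\<in>P. \<exists>C\<in>D. snd p = snd C \<and> fst p + t \<in> fst C) \<and>
      (\<forall>C\<in>D. \<exists>p\<in>P. snd p = snd C \<and> fst p + t \<in> fst C)}" by auto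
  have m: "{t \<in> space borel. snd p = snd C \<and> fst p + t \<in> fst C} \<in> sets borel" if "C \<in> D" for p C
  proof -
    have "(\<lambda>x. fst p + x) -` fst C \<inter> space borel \<in> sets borel"
      using Dc(2)[OF that] by (intro measurable_sets[where A = borel]) auto
    moreover have "{x \<in> space borel. snd p = snd C \<and> fst p + x \<in> fst C} =
        (if snd p = snd C then (\<lambda>x. fst p + x) -` fst C \<inter> space borel else {})" by auto
    ultimately show ?thesis by simp
  qed
  show "admissible_shifts m D P \<in> sets borel"
    unfolding eq
    by (rule sets.sets_Collect_conj; intro sets.sets_Collect_finite_All sets.sets_Collect_finite_Ex P(2) fin m)
qed

end

text \<open>The sum of the points changes by \<open>card P\<close> times \<open>t\<close> under
  translation, so a finite nonempty set has no period.\<close>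

lemma translate_eq_self:
  assumes "translate t P = P" "finite P" "P \<noteq> {}"
  shows "t = 0"
proof -
  have inj: "inj_on (\<lambda>(x, i). (x + t, i)) P" by (auto simp: inj_on_def)
  have "(\<Sum>p\<in>P. fst p) = (\<Sum>p\<in>translate t P. fst p)" by (simp add: assms(1))
  also have "\<dots> = (\<Sum>p\<in>P. fst p + t)"
    unfolding translate_def sum.reindex[OF inj] by (intro sum.cong) auto
  also have "\<dots> = (\<Sum>p\<in>P. fst p) + real (card P) *\<^sub>R t" by (simp add: sum.distrib scaleR_conv_of_real sum_constant_scaleR)
  finally show ?thesis using assms by simp
qed

lemma translate_subset_iff: "translate g P \<subseteq> translate h Q \<longleftrightarrow> translate (g - h) P \<subseteq> Q"
proof -
  have "translate s P \<subseteq> translate s Q" if "P \<subseteq> Q" for s and P Q :: "('a, 'b) coloured"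
    using that by (auto simp: translate_def)
  from this[of "translate g P" "translate h Q" "- h"] this[of "translate (g - h) P" Q h]
  show ?thesis by (auto simp: translate_translate translate_0)
qed

locale enumerated_patterns = separated_delone \<Lambda> m
  for \<Lambda> :: "('d::finite, 'k::finite) coloured" and m +
  fixes D :: "((real^'d) set \<times> 'k) set" and J :: "nat set" and G :: "nat \<Rightarrow> ('d, 'k) coloured"
  assumes D: "D \<in> cube_families m"
    and enum: "enumerates_representatives (occurring_patterns \<Lambda> m D) J G"
begin

definition visits :: "(real^'d) set" where
  "visits = {x. D \<subseteq> hit m (translate (- x) \<Lambda>)}"

definition places :: "(real^'d) set \<Rightarrow> nat \<Rightarrow> (real^'d) set" where
  "places A j = {g. translate g (G j) \<subseteq> \<Lambda> \<and> (\<lambda>x. g + x) ` support (G j) \<subseteq> A}"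

text \<open>The base points \<open>x\<close> from which the copy of \<open>G j\<close> placed at
  \<open>g\<close> is seen as a pattern of \<open>D\<close>: the admissible shifts reflected and
  moved to \<open>g\<close>, hence of the same volume.\<close>

definition window :: "nat \<Rightarrow> real^'d \<Rightarrow> (real^'d) set" where
  "window j g = {x. translate (g - x) (G j) \<in> patterns m D}"

definition shift_vol :: "nat \<Rightarrow> real" where
  "shift_vol j = measure lebesgue (admissible_shifts m D (G j))"

definition radius :: real where "radius = CARD('d) * 2 ^ m"

lemma G_occurring: "j \<in> J \<Longrightarrow> G j \<in> occurring_patterns \<Lambda> m D"
  using enum by (auto simp: enumerates_representatives_def)

lemma G_pattern: "j \<in> J \<Longrightarrow> G j \<in> patterns m D"
  using G_occurring by (auto simp: occurring_patterns_def)

lemma G_finite: "j \<in> J \<Longrightarrow> finite (G j)"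
  using G_pattern by (auto simp: patterns_def)

lemma G_nonempty: assumes "j \<in> J" shows "G j \<noteq> {}"
proof -
  obtain C where "C \<in> D" using D by (auto simp: cube_families_def)
  then obtain p where "G j \<inter> cube_points C = {p}" using G_pattern[OF assms] by (auto simp: patterns_def)
  then show ?thesis by blast
qed

lemma G_in_Lambda: assumes "j \<in> J" obtains g where "translate g (G j) \<subseteq> \<Lambda>"
  using G_occurring[OF assms] by (auto simp: occurring_patterns_def)

lemma G_cluster: assumes "j \<in> J" shows "cluster (G j)"
proof -
  obtain g where g: "translate g (G j) \<subseteq> \<Lambda>" using G_in_Lambda[OF assms] .
  have "i = i'" if "(y, i) \<in> G j" "(y, i') \<in> G j" for y i i'
  proof -
    have "(y + g, i) \<in> \<Lambda>" "(y + g, i') \<in> \<Lambda>" using that g by (auto simp: mem_translate_iff subset_iff)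
    then show ?thesis by (rule kset_unique)
  qed
  then show ?thesis using G_finite[OF assms] G_nonempty[OF assms]
    by (auto simp: cluster_def kset_def colour_class_def)
qed

text \<open>Equal translates belong to one class, which has a single index; then the difference of
  the shifts is a period of a finite nonempty set.\<close>

lemma G_translate_inj:
  assumes "j \<in> J" "j' \<in> J" "translate g (G j) = translate g' (G j')"
  shows "j = j' \<and> g = g'"
proof -
  have "translate (- g') (translate g (G j)) = translate (- g') (translate g' (G j'))" using assms(3) by simp
  then have eq: "G j' = translate (g - g') (G j)" by (simp add: translate_translate translate_0)
  have "\<exists>!k. k \<in> J \<and> (\<exists>t. G j' = translate t (G k))"
    using enum G_occurring[OF assms(2)] by (auto simp: enumerates_representatives_def)
  moreover have "G j' = translate 0 (G j')" by (simp add: translate_0)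
  ultimately have "j = j'" using assms(1,2) eq by blast
  then have "g - g' = 0" using eq translate_eq_self[of "g - g'" "G j"] G_finite G_nonempty assms(1) by simp
  then show ?thesis using \<open>j = j'\<close> by simp
qed

lemma window_lmeasurable:
  assumes j: "j \<in> J"
  shows "window j g \<in> lmeasurable" "measure lebesgue (window j g) = shift_vol j"
proof -
  obtain h where h: "translate h (G j) \<subseteq> \<Lambda>" using G_in_Lambda[OF j] .
  let ?V = "admissible_shifts m D (G j)"
  have V: "bounded ?V" "?V \<in> sets borel"
    using admissible_shifts_bounded_borel[OF h G_finite[OF j] G_nonempty[OF j] D] by auto
  have eq: "window j g = (\<lambda>t. (-1) *\<^sub>R t + g) ` ?V"
  proof (intro set_eqI iffI)
    fix x assume "x \<in> window j g"
    then show "x \<in> (\<lambda>t. (-1) *\<^sub>R t + g) ` ?V"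
      by (intro image_eqI[of _ _ "g - x"]) (auto simp: window_def admissible_shifts_def)
  qed (auto simp: window_def admissible_shifts_def)
  have eq2: "window j g = (\<lambda>x. g - x) -` ?V \<inter> space borel"
    by (auto simp: window_def admissible_shifts_def)
  have "window j g \<in> sets borel" unfolding eq2 using V(2) by (intro measurable_sets[where A = borel]) auto
  moreover have "bounded (window j g)"
  proof -
    obtain K where "\<And>t. t \<in> ?V \<Longrightarrow> norm t \<le> K" using V(1) by (auto simp: bounded_iff)
    then have "norm (g - t) \<le> norm g + K" if "t \<in> ?V" for t
      using norm_triangle_ineq4[of g t] that by fastforce
    then show ?thesis unfolding eq by (intro boundedI[of _ "norm g + K"]) auto
  qed
  ultimately show "window j g \<in> lmeasurable" by (intro bounded_set_imp_lmeasurable) auto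
  show "measure lebesgue (window j g) = shift_vol j"
    unfolding eq shift_vol_def by (subst measure_lebesgue_affine) simp
qed

lemma window_visits:
  assumes "j \<in> J" "translate g (G j) \<subseteq> \<Lambda>" "x \<in> window j g"
  shows "x \<in> visits"
proof -
  let ?P = "translate (g - x) (G j)"
  have sub: "?P \<subseteq> translate (- x) \<Lambda>" using assms(2) by (simp add: translate_subset_iff)
  have "finite ?P" using G_finite[OF assms(1)] by (simp add: translate_def)
  then have "D \<subseteq> hit m ?P" using patterns_iff[OF sub _ D] assms(3) by (auto simp: window_def)
  also have "\<dots> \<subseteq> hit m (translate (- x) \<Lambda>)" using sub by (auto simp: hit_def)
  finally show ?thesis by (simp add: visits_def)
qed

text \<open>The points of \<open>\<Lambda> - x\<close> in the cubes of \<open>D\<close> form an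
  occurring pattern, which is \<open>t + G j\<close> for some representative; seen from the origin,
  this copy sits at \<open>g = t + x\<close>.\<close>

lemma visits_window:
  assumes "x \<in> visits"
  obtains j g where "j \<in> J" "translate g (G j) \<subseteq> \<Lambda>" "x \<in> window j g"
proof -
  obtain P where P: "P \<in> patterns m D" "P \<subseteq> translate (- x) \<Lambda>"
    using assms pattern_exists[OF D, of "- x"] by (auto simp: visits_def)
  have "translate (- (- x)) P \<subseteq> \<Lambda>" using P(2) translate_subset_iff[of 0 P "- x" \<Lambda>] by (simp add: translate_0)
  then have "P \<in> occurring_patterns \<Lambda> m D" using P(1) unfolding occurring_patterns_def by blast
  then have "\<exists>!j. j \<in> J \<and> (\<exists>t. P = translate t (G j))"
    using enum by (simp add: enumerates_representatives_def)
  then obtain j t where j: "j \<in> J" "P = translate t (G j)" by (elim ex1E) blast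
  have "translate (t + x) (G j) \<subseteq> \<Lambda>" using P(2) translate_subset_iff[of t "G j" "- x" \<Lambda>] j(2) by simp
  moreover have "x \<in> window j (t + x)" using P(1) j(2) by (simp add: window_def)
  ultimately show thesis using that j(1) by blast
qed

text \<open>Both copies, seen from \<open>x\<close>, are patterns of \<open>D\<close> inside the
  same translate of \<open>\<Lambda>\<close>, so they coincide, and a translate of a representative
  determines index and position.\<close>

lemma window_disjoint:
  assumes "j \<in> J" "translate g (G j) \<subseteq> \<Lambda>" "x \<in> window j g"
    "j' \<in> J" "translate g' (G j') \<subseteq> \<Lambda>" "x \<in> window j' g'"
  shows "j = j' \<and> g = g'"
proof -
  have "translate (g - x) (G j) = translate (g' - x) (G j')"
    using assms by (intro patterns_unique[OF _ _ _ _ D, of _ "- x"]) (auto simp: translate_subset_iff window_def)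
  then have "j = j' \<and> g - x = g' - x" using G_translate_inj[OF assms(1,4)] by blast
  then show ?thesis by simp
qed

lemma window_near:
  assumes "x \<in> window j g" "q \<in> support (G j)"
  shows "dist x (g + q) \<le> radius"
proof -
  obtain i where "(q, i) \<in> G j" using assms(2) by (auto simp: support_def colour_class_def)
  then have "(q + (g - x), i) \<in> translate (g - x) (G j)" by (simp add: mem_translate_iff)
  then have "q + (g - x) \<in> big_cube m" using assms(1) by (auto simp: window_def patterns_def)
  then have "norm (q + (g - x)) \<le> radius" unfolding radius_def by (rule norm_big_cube)
  then show ?thesis by (simp add: dist_norm norm_minus_commute algebra_simps)
qed

text \<open>\<open>J\<close> may be infinite, but distinct pairs of index and position give distinct
  subsets of the finitely many points of \<open>\<Lambda>\<close> in \<open>A\<close>. Hence only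
  finitely many classes occur in a bounded region.\<close>

lemma finite_places:
  assumes "bounded A"
  shows "finite (SIGMA j:J. places A j)"
proof (rule finite_imageD)
  have "translate g (G j) \<subseteq> {p \<in> \<Lambda>. fst p \<in> A}" if "g \<in> places A j" for j g
    using that by (auto simp: places_def translate_def support_def colour_class_def image_subset_iff add.commute)
  then have "(\<lambda>(j, g). translate g (G j)) ` (SIGMA j:J. places A j) \<subseteq> Pow {p \<in> \<Lambda>. fst p \<in> A}" by auto
  then show "finite ((\<lambda>(j, g). translate g (G j)) ` (SIGMA j:J. places A j))"
    by (rule finite_subset) (simp add: finite_bounded_part assms)
  show "inj_on (\<lambda>(j, g). translate g (G j)) (SIGMA j:J. places A j)"
    using G_translate_inj by (auto simp: inj_on_def)
qed

lemma finite_places_at: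
  assumes "bounded A" "j \<in> J" shows "finite (places A j)"
proof -
  have "finite (Pair j -` (SIGMA j:J. places A j))"
    by (intro finite_vimageI finite_places assms) (auto simp: inj_on_def)
  moreover have "Pair j -` (SIGMA j:J. places A j) = places A j" using assms by auto
  ultimately show ?thesis by simp
qed

lemma visits_borel: "visits \<in> sets borel"
  unfolding visits_def using D by (intro hit_set_borel) (simp add: cube_families_def)

lemma visits_lmeasurable: "averaging_set A \<Longrightarrow> visits \<inter> A \<in> lmeasurable"
  using visits_borel by (intro bounded_set_imp_lmeasurable) (auto simp: averaging_set_def intro: bounded_subset)

section \<open>Volume of visits and cluster counts\<close>

lemma measure_windows:
  assumes A: "averaging_set A" and J': "J' \<subseteq> J" "finite J'"
  defines "U \<equiv> \<Union>(j, g)\<in>(SIGMA j:J'. places A j). window j g"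
  shows "U \<in> lmeasurable" "measure lebesgue U = (\<Sum>j\<in>J'. shift_vol j * card (places A j))"
proof -
  have bA: "bounded A" using A by (simp add: averaging_set_def)
  let ?K = "SIGMA j:J'. places A j" and ?W = "\<lambda>(j, g). window j g"
  have fp: "finite (places A j)" if "j \<in> J'" for j using finite_places_at[OF bA] that J' by auto
  then have fin: "finite ?K" using J'(2) by blast
  have W: "?W k \<in> lmeasurable" if "k \<in> ?K" for k using that J' window_lmeasurable by auto
  show "U \<in> lmeasurable" unfolding U_def by (intro fmeasurable.finite_UN fin W)
  have "disjoint_family_on ?W ?K"
    unfolding disjoint_family_on_def
  proof (intro ballI impI, rule ccontr)
    fix k l assume kl: "k \<in> ?K" "l \<in> ?K" "k \<noteq> l" and "?W k \<inter> ?W l \<noteq> {}"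
    then obtain x where x: "x \<in> window (fst k) (snd k)" "x \<in> window (fst l) (snd l)"
      by (auto simp: split_def)
    have "fst p \<in> J \<and> translate (snd p) (G (fst p)) \<subseteq> \<Lambda>" if "p \<in> ?K" for p
      using that J'(1) by (auto simp: places_def)
    then have "fst k = fst l \<and> snd k = snd l"
      using window_disjoint[OF _ _ x(1) _ _ x(2)] kl by blast
    then show False using kl(3) by (simp add: prod_eq_iff)
  qed
  then have "measure lebesgue U = (\<Sum>k\<in>?K. measure lebesgue (?W k))"
    unfolding U_def using W by (intro measure_finite_Union fin) (auto simp: fmeasurable_def less_top simp del: emeasure_completion)
  also have "\<dots> = (\<Sum>j\<in>J'. \<Sum>g\<in>places A j. measure lebesgue (window j g))"
    using sum.Sigma[OF J'(2), of "places A" "\<lambda>j g. measure lebesgue (window j g)"] fp by (simp add: split_def)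
  also have "\<dots> = (\<Sum>j\<in>J'. shift_vol j * card (places A j))"
    using J'(1) by (intro sum.cong refl) (auto simp: window_lmeasurable(2) subset_iff mult.commute)
  finally show "measure lebesgue U = (\<Sum>j\<in>J'. shift_vol j * card (places A j))" .
qed

text \<open>If \<open>x\<close> lies in the window of a copy inside \<open>A\<close> but outside
  \<open>A\<close> itself, the frontier separates it from a point of the copy at distance at most
  \<open>radius\<close>.\<close>

lemma visits_lower:
  assumes A: "averaging_set A" and J': "J' \<subseteq> J" "finite J'"
  shows "(\<Sum>j\<in>J'. shift_vol j * card (places A j)) \<le>
    measure lebesgue (visits \<inter> A) + measure lebesgue (boundary_collar radius A)"
proof -
  let ?U = "\<Union>(j, g)\<in>(SIGMA j:J'. places A j). window j g"
  have "?U \<subseteq> (visits \<inter> A) \<union> boundary_collar radius A"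
  proof clarify
    fix x j g assume h: "j \<in> J'" "g \<in> places A j" "x \<in> window j g" "x \<notin> boundary_collar radius A"
    then have j: "j \<in> J" using J' by auto
    obtain q where q: "q \<in> support (G j)"
      using G_nonempty[OF j] by (auto simp: support_def colour_class_def)
    then have "g + q \<in> A" using h(2) by (auto simp: places_def)
    then have "x \<in> A"
      using h(4) infdist_frontier_le[of x A "g + q"] window_near[OF h(3) q] by (force simp: boundary_collar_def)
    then show "x \<in> visits \<inter> A" using window_visits[OF j _ h(3)] h(2) by (auto simp: places_def)
  qed
  then have "measure lebesgue ?U \<le> measure lebesgue ((visits \<inter> A) \<union> boundary_collar radius A)"
    using measure_windows(1)[OF A J'] visits_lmeasurable[OF A] boundary_collar_lmeasurable[OF A]
    by (intro measure_mono_fmeasurable) auto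
  also have "\<dots> \<le> measure lebesgue (visits \<inter> A) + measure lebesgue (boundary_collar radius A)"
    using visits_lmeasurable[OF A] boundary_collar_lmeasurable[OF A] by (intro measure_Un_le) auto
  finally show ?thesis by (simp only: measure_windows(2)[OF A J'])
qed

text \<open>Away from the collar, every point of the copy seen from \<open>x\<close> lies on the
  same side of the frontier as \<open>x\<close>, so the copy is contained in \<open>A\<close> and is
  counted.\<close>

lemma visits_upper:
  assumes A: "averaging_set A"
  defines "J' \<equiv> {j \<in> J. places A j \<noteq> {}}"
  shows "finite J'" "measure lebesgue (visits \<inter> A) \<le>
    (\<Sum>j\<in>J'. shift_vol j * card (places A j)) + measure lebesgue (boundary_collar radius A)"
proof -
  have "J' \<subseteq> fst ` (SIGMA j:J. places A j)" by (force simp: J'_def image_iff)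
  then show fin: "finite J'"
    using finite_places[of A] A by (auto simp: averaging_set_def intro: finite_subset)
  have J': "J' \<subseteq> J" by (auto simp: J'_def)
  let ?U = "\<Union>(j, g)\<in>(SIGMA j:J'. places A j). window j g"
  have "visits \<inter> A \<subseteq> ?U \<union> boundary_collar radius A"
  proof clarify
    fix x assume x: "x \<in> visits" "x \<in> A" "x \<notin> boundary_collar radius A"
    obtain j g where j: "j \<in> J" "translate g (G j) \<subseteq> \<Lambda>" "x \<in> window j g" using visits_window[OF x(1)] .
    have "g + q \<in> A" if "q \<in> support (G j)" for q
      using x(2,3) infdist_frontier_le[of x A "g + q"] window_near[OF j(3) that] by (force simp: boundary_collar_def)
    then have "g \<in> places A j" using j(2) by (auto simp: places_def)
    then show "x \<in> ?U" using j by (auto simp: J'_def)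
  qed
  then have "measure lebesgue (visits \<inter> A) \<le> measure lebesgue (?U \<union> boundary_collar radius A)"
    using measure_windows(1)[OF A J' fin] visits_lmeasurable[OF A] boundary_collar_lmeasurable[OF A]
    by (intro measure_mono_fmeasurable) auto
  also have "\<dots> \<le> measure lebesgue ?U + measure lebesgue (boundary_collar radius A)"
    using measure_windows(1)[OF A J' fin] boundary_collar_lmeasurable[OF A] by (intro measure_Un_le) auto
  finally show "measure lebesgue (visits \<inter> A) \<le>
      (\<Sum>j\<in>J'. shift_vol j * card (places A j)) + measure lebesgue (boundary_collar radius A)"
    by (simp only: measure_windows(2)[OF A J' fin])
qed

text \<open>From below the error is the collar plus the deviation of finitely many frequencies, from
  above the tail is added. Each contributes at most \<open>e\<close>, three in all, so
  \<open>\<epsilon> / 4\<close> leaves slack. Translation invariance makes the collar term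
  independent of \<open>h\<close>.\<close>

lemma uniform_mean_visits:
  assumes F: "van_hove F" and ucf: "uniform_cluster_frequencies F \<Lambda>"
    and tail: "\<And>\<epsilon>::real. \<epsilon> > 0 \<Longrightarrow> \<exists>k\<^sub>0. \<forall>n\<ge>k\<^sub>0. \<forall>h. \<exists>s\<le>\<epsilon>.
      ((\<lambda>j. shift_vol j * real (occurrences (G j) ((\<lambda>y. h + y) ` F n) \<Lambda>) / measure lebesgue (F n))
        has_sum s) {j \<in> J. j \<ge> k\<^sub>0}"
  shows "uniform_mean F (indicator visits)"
  unfolding uniform_mean_def
proof (intro conjI allI impI)
  show "bounded_borel (indicator visits :: real^'d \<Rightarrow> real)" by (intro bounded_borel_indicator visits_borel)
  have averaging_set: "averaging_set (F n)" for n using F by (simp add: van_hove_def averaging_set_def)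
  have occ: "occurrences (G j) A \<Lambda> = card (places A j)" for j A
    by (simp add: occurrences_def places_def)
  fix \<epsilon> :: real assume "\<epsilon> > 0"
  define e where "e = \<epsilon> / 4"
  have e: "e > 0" using \<open>\<epsilon> > 0\<close> by (simp add: e_def)
  obtain k\<^sub>0 where k\<^sub>0: "\<And>n h. n \<ge> k\<^sub>0 \<Longrightarrow> \<exists>s\<le>e.
      ((\<lambda>j. shift_vol j * real (card (places ((+) h ` F n) j)) / measure lebesgue (F n)) has_sum s) {j \<in> J. j \<ge> k\<^sub>0}"
    using tail[OF e] unfolding occ by auto
  \<comment> \<open>\<open>k\<^sub>0\<close> is independent of \<open>n\<close> and
    \<open>h\<close>, so the head of the sum has a fixed finite index set and the finitely many
    uniform limits can be added. The resulting \<open>c\<close> depends on \<open>\<epsilon>\<close>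
    through \<open>k\<^sub>0\<close>, as \<open>uniform_mean\<close> allows.\<close>
  define J' where "J' = {j \<in> J. j < k\<^sub>0}"
  have J': "J' \<subseteq> J" "finite J'" by (auto simp: J'_def)
  define S where "S = (\<lambda>n h. \<Sum>j\<in>J'. shift_vol j * (real (card (places ((+) h ` F n) j)) / measure lebesgue (F n)))"
  define Lim where "Lim = (\<lambda>j f. uniform_limit UNIV
      (\<lambda>n h. real (card (places ((+) h ` F n) j)) / measure lebesgue (F n)) (\<lambda>_. f) sequentially)"
  have "\<exists>f. Lim j f" if "j \<in> J" for j
    using ucf[unfolded uniform_cluster_frequencies_def, rule_format, OF G_cluster[OF that]]
    unfolding occ Lim_def .
  then obtain f where f: "\<And>j. j \<in> J \<Longrightarrow> Lim j (f j)" by metis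
  define c where "c = (\<Sum>j\<in>J'. shift_vol j * f j)"
  have "uniform_limit UNIV S (\<lambda>_. c) sequentially"
    unfolding S_def c_def using J'(2,1)
  proof (induction J' rule: finite_induct)
    case empty
    then show ?case by (simp add: uniform_limit_const)
  next
    case (insert j K)
    have 1: "uniform_limit UNIV (\<lambda>n h. shift_vol j * (real (card (places ((+) h ` F n) j)) / measure lebesgue (F n)))
        (\<lambda>_. shift_vol j * f j) sequentially"
      using insert f[of j] unfolding Lim_def
      by (intro bounded_linear.uniform_limit[OF bounded_linear_mult_right]) auto
    show ?case
      using uniform_limit_add[OF 1 insert.IH] insert by (simp del: times_divide_eq_right)
  qed
  then have lim: "\<forall>\<^sub>F n in sequentially. \<forall>h. dist (S n h) c < e"
    using uniform_limitD[OF _ e] by fastforce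
  have "radius > 0" by (simp add: radius_def)
  then have "(\<lambda>n. measure lebesgue (boundary_collar radius (F n)) / measure lebesgue (F n)) \<longlonglongrightarrow> 0"
    using F unfolding van_hove_def boundary_collar_def by blast
  then have col: "\<forall>\<^sub>F n in sequentially. measure lebesgue (boundary_collar radius (F n)) / measure lebesgue (F n) < e"
    using order_tendstoD(2) e by blast
  have "\<forall>\<^sub>F n in sequentially. \<forall>h. \<bar>set_avg (F n) (indicator visits) h - c\<bar> \<le> \<epsilon>"
    using lim col eventually_ge_at_top[of k\<^sub>0]
  proof eventually_elim
    case (elim n)
    show ?case
    proof
      fix h
      let ?A = "(+) h ` F n" and ?V = "measure lebesgue (F n)"
      have A: "averaging_set ?A" by (rule averaging_set_translation[OF averaging_set])
      have V: "?V > 0" using averaging_set[of n] by (simp add: averaging_set_def)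
      have colA: "measure lebesgue (boundary_collar radius ?A) / ?V < e"
        using elim(2) by (simp add: boundary_collar_translation measure_translation)
      have avg: "set_avg (F n) (indicator visits) h = measure lebesgue (visits \<inter> ?A) / ?V"
        by (rule set_avg_indicator[OF averaging_set visits_borel])
      have Seq: "S n h = (\<Sum>j\<in>J'. shift_vol j * card (places ?A j)) / ?V"
        by (simp add: S_def sum_divide_distrib)
      have lower: "S n h \<le> set_avg (F n) (indicator visits) h + e"
        using divide_right_mono[OF visits_lower[OF A J'], of ?V] V colA
        unfolding Seq avg add_divide_distrib by simp
      obtain s where s: "s \<le> e" "((\<lambda>j. shift_vol j * real (card (places ?A j)) / ?V) has_sum s) {j \<in> J. j \<ge> k\<^sub>0}"
        using k\<^sub>0[OF elim(3)] by blast
      define J0 where "J0 = {j \<in> J. places ?A j \<noteq> {}}"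
      have J0: "finite J0" "measure lebesgue (visits \<inter> ?A) \<le>
          (\<Sum>j\<in>J0. shift_vol j * card (places ?A j)) + measure lebesgue (boundary_collar radius ?A)"
        using visits_upper[OF A] by (auto simp: J0_def)
      have nn: "0 \<le> shift_vol j * real (card (places ?A j)) / ?V" for j
        using V by (simp add: shift_vol_def)
      have finhi: "finite {j \<in> J0. j \<ge> k\<^sub>0}" using J0(1) by simp
      have "(\<Sum>j\<in>J0. shift_vol j * card (places ?A j)) / ?V =
          (\<Sum>j\<in>J0. shift_vol j * card (places ?A j) / ?V)" by (simp add: sum_divide_distrib)
      also have "\<dots> \<le> (\<Sum>j\<in>J' \<union> {j \<in> J0. j \<ge> k\<^sub>0}. shift_vol j * card (places ?A j) / ?V)"
        using finhi J' nn by (intro sum_mono2) (auto simp: J0_def J'_def)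
      also have "\<dots> = (\<Sum>j\<in>J'. shift_vol j * card (places ?A j) / ?V) +
          (\<Sum>j\<in>{j \<in> J0. j \<ge> k\<^sub>0}. shift_vol j * card (places ?A j) / ?V)"
        using finhi J'(2) by (intro sum.union_disjoint) (auto simp: J'_def)
      also have "(\<Sum>j\<in>J'. shift_vol j * card (places ?A j) / ?V) = S n h"
        by (simp add: S_def)
      \<comment> \<open>The classes present in this region with index at least
        \<open>k\<^sub>0\<close> form a finite part of the tail series, whose terms are
        nonnegative.\<close>
      also have "(\<Sum>j\<in>{j \<in> J0. j \<ge> k\<^sub>0}. shift_vol j * card (places ?A j) / ?V) \<le> s"
        using finhi nn by (intro finite_sum_le_has_sum[OF s(2)]) (auto simp: J0_def)
      finally have "(\<Sum>j\<in>J0. shift_vol j * card (places ?A j)) / ?V \<le> S n h + e" using s(1) by simp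
      then have upper: "set_avg (F n) (indicator visits) h \<le> S n h + 2 * e"
        using divide_right_mono[OF J0(2), of ?V] V colA
        unfolding avg add_divide_distrib by simp
      have "dist (S n h) c < e" using elim(1) by blast
      then have "S n h < c + e" "c - e < S n h" unfolding dist_real_def by linarith+
      with lower upper show "\<bar>set_avg (F n) (indicator visits) h - c\<bar> \<le> \<epsilon>"
        unfolding e_def by linarith
    qed
  qed
  then show "\<exists>c. \<forall>\<^sub>F n in sequentially. \<forall>h. \<bar>set_avg (F n) (indicator visits) h - c\<bar> \<le> \<epsilon>" ..
qed

end

section \<open>Unique ergodicity\<close>

text \<open>Moebius inversion on subsets, downwards: the indicator of code exactly \<open>D\<close>
  is that of the superset event minus those of all exact codes strictly above \<open>D\<close>. A
  function of the code is then a finite combination of exact indicators.\<close>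

lemma uniform_mean_finite_code:
  fixes H :: "real^'d::finite \<Rightarrow> 'c set"
  assumes F: "\<And>n. averaging_set (F n)" and fin: "finite \<Delta>" and H: "\<And>x. H x \<subseteq> \<Delta>"
    and up: "\<And>D. D \<subseteq> \<Delta> \<Longrightarrow> uniform_mean F (indicator {x. D \<subseteq> H x})"
  shows "uniform_mean F (\<lambda>x. \<psi> (H x))"
proof -
  have exact: "uniform_mean F (indicator {x. H x = D})" if "D \<subseteq> \<Delta>" for D
    using that
  proof (induction "card (\<Delta> - D)" arbitrary: D rule: less_induct)
    case less
    let ?S = "{D'. D \<subset> D' \<and> D' \<subseteq> \<Delta>}"
    have finS: "finite ?S" using fin by (auto intro: finite_subset[of _ "Pow \<Delta>"])
    have mean: "uniform_mean F (\<lambda>x. (-1) * indicator {x. H x = D'} x)" if "D' \<in> ?S" for D'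
    proof -
      have "card (\<Delta> - D') < card (\<Delta> - D)" using that fin less.prems by (intro psubset_card_mono) auto
      then show ?thesis using less.hyps that by (intro uniform_mean_scale F) auto
    qed
    have eq: "indicator {x. H x = D} x =
        indicator {x. D \<subseteq> H x} x + (\<Sum>D'\<in>?S. (-1) * indicator {x. H x = D'} x :: real)" for x
    proof -
      have "(\<Sum>D'\<in>?S. indicator {x. H x = D'} x :: real) = (\<Sum>D'\<in>?S. if D' = H x then 1 else 0)"
        by (intro sum.cong) (auto simp: indicator_def)
      also have "\<dots> = (if D \<subset> H x then 1 else 0)" using finS H[of x] by simp
      finally show ?thesis by (auto simp: indicator_def sum_negf)
    qed
    show ?case
      unfolding eq[abs_def] by (intro uniform_mean_add uniform_mean_sum up less.prems F finS mean)
  qed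
  have eq: "\<psi> (H x) = (\<Sum>D\<in>Pow \<Delta>. \<psi> D * indicator {x. H x = D} x)" for x
  proof -
    have "(\<Sum>D\<in>Pow \<Delta>. \<psi> D * indicator {x. H x = D} x) = (\<Sum>D\<in>Pow \<Delta>. if D = H x then \<psi> D else 0)"
      by (intro sum.cong) (auto simp: indicator_def)
    then show ?thesis using fin H[of x] by simp
  qed
  show ?thesis
    unfolding eq[abs_def] using fin by (intro uniform_mean_sum uniform_mean_scale exact F) auto
qed

section \<open>From uniform means along the orbit to unique ergodicity\<close>

lemma topspace_orbit_closure:
  assumes "delone_kset \<Lambda>"
  shows "topspace (subtopology delone_topology (orbit_closure \<Lambda>)) = orbit_closure \<Lambda>"
    and "translate g \<Lambda> \<in> orbit_closure \<Lambda>"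
proof -
  show "topspace (subtopology delone_topology (orbit_closure \<Lambda>)) = orbit_closure \<Lambda>"
    by (simp add: topspace_subtopology orbit_closure_def closure_of_subset_topspace Int_absorb1)
  have "range (\<lambda>g. translate (- g) \<Lambda>) \<subseteq> topspace delone_topology"
    using assms delone_kset_translate by (auto simp: topspace_delone)
  then have "range (\<lambda>g. translate (- g) \<Lambda>) \<subseteq> orbit_closure \<Lambda>"
    unfolding orbit_closure_def by (rule closure_of_subset)
  then have "translate (- (- g)) \<Lambda> \<in> orbit_closure \<Lambda>" by blast
  then show "translate g \<Lambda> \<in> orbit_closure \<Lambda>" by simp
qed

lemma orbit_function_uniformly_continuous:
  assumes \<Lambda>: "delone_kset \<Lambda>"
    and f: "continuous_map (subtopology delone_topology (orbit_closure \<Lambda>)) euclideanreal f" and "e > 0"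
  obtains \<delta> where "\<delta> > 0"
    "\<And>P Q. P \<in> orbit_closure \<Lambda> \<Longrightarrow> Q \<in> orbit_closure \<Lambda> \<Longrightarrow> delone_dist P Q < \<delta> \<Longrightarrow> \<bar>f P - f Q\<bar> < e"
proof -
  interpret X: Submetric "{P :: ('a, 'b) coloured. delone_kset P}" delone_dist "orbit_closure \<Lambda>"
    by unfold_locales (simp add: orbit_closure_def closure_of_subset_topspace topspace_delone[symmetric])
  have top: "X.sub.mtopology = subtopology delone_topology (orbit_closure \<Lambda>)"
    by (simp add: X.mtopology_submetric delone_topology_def)
  show thesis
    using compact_metric_uniform_continuity[OF X.sub.Metric_space_axioms, of f e]
      compact_space_orbit_closure[OF \<Lambda>] f \<open>e > 0\<close> that unfolding top by blast
qed

lemma orbit_function_bounded_borel: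
  assumes \<Lambda>: "delone_kset \<Lambda>"
    and f: "continuous_map (subtopology delone_topology (orbit_closure \<Lambda>)) euclideanreal f"
  shows "bounded_borel (\<lambda>h. f (translate (- h) \<Lambda>))"
    and "e > 0 \<Longrightarrow> \<exists>\<delta>>0. \<forall>x y. dist x y < \<delta> \<longrightarrow> \<bar>f (translate (- x) \<Lambda>) - f (translate (- y) \<Lambda>)\<bar> < e"
proof -
  show uc: "\<exists>\<delta>>0. \<forall>x y. dist x y < \<delta> \<longrightarrow> \<bar>f (translate (- x) \<Lambda>) - f (translate (- y) \<Lambda>)\<bar> < e"
    if "e > 0" for e
  proof -
    obtain \<delta> where \<delta>: "\<delta> > 0"
      "\<And>P Q. P \<in> orbit_closure \<Lambda> \<Longrightarrow> Q \<in> orbit_closure \<Lambda> \<Longrightarrow> delone_dist P Q < \<delta> \<Longrightarrow> \<bar>f P - f Q\<bar> < e"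
      by (rule orbit_function_uniformly_continuous[OF \<Lambda> f \<open>e > 0\<close>]) blast
    have "\<bar>f (translate (- x) \<Lambda>) - f (translate (- y) \<Lambda>)\<bar> < e" if "dist x y < \<delta> / 2" for x y
    proof -
      have "norm (- x - - y) < \<delta> / 2" using that by (simp add: dist_norm norm_minus_commute)
      then have "delone_dist (translate (- x) \<Lambda>) (translate (- y) \<Lambda>) \<le> \<delta> / 2"
        by (rule delone_dist_translate[OF \<Lambda>])
      then show ?thesis using \<delta> by (intro \<delta>(2) topspace_orbit_closure(2)[OF \<Lambda>]) auto
    qed
    then show ?thesis using \<delta>(1) by (intro exI[of _ "\<delta> / 2"]) auto
  qed
  have "continuous_on UNIV (\<lambda>h. f (translate (- h) \<Lambda>))"
    unfolding continuous_on_iff using uc by (metis dist_commute dist_real_def)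
  then have meas: "(\<lambda>h. f (translate (- h) \<Lambda>)) \<in> borel_measurable borel" by (rule borel_measurable_continuous_onI)
  have "compact (f ` orbit_closure \<Lambda>)"
  proof -
    have "compactin (subtopology delone_topology (orbit_closure \<Lambda>)) (orbit_closure \<Lambda>)"
      using compact_space_orbit_closure[OF \<Lambda>]
      unfolding compact_space_def topspace_orbit_closure(1)[OF \<Lambda>] .
    from image_compactin[OF this f] show ?thesis by simp
  qed
  then have "bounded (f ` orbit_closure \<Lambda>)" by (rule compact_imp_bounded)
  then obtain K where "\<And>P. P \<in> orbit_closure \<Lambda> \<Longrightarrow> \<bar>f P\<bar> \<le> K" by (auto simp: bounded_iff)
  then have "\<bar>f (translate (- h) \<Lambda>)\<bar> \<le> K" for h
    using topspace_orbit_closure(2)[OF \<Lambda>] by blast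
  then show "bounded_borel (\<lambda>h. f (translate (- h) \<Lambda>))" using meas unfolding bounded_borel_def by blast
qed

text \<open>Uniformity in the base point serves twice. The limit \<open>I f\<close>, read off at 0,
  is the same from every base point, which makes \<open>I\<close> invariant; and one set
  \<open>F n\<close> gives averages near \<open>I f\<close> along the whole orbit, a bound that
  survives passage to the closure, where an arbitrary invariant measure lives.\<close>

theorem uniquely_ergodic_if_uniform_means:
  fixes \<Lambda> :: "('d::finite, 'k::finite) coloured"
  assumes \<Lambda>: "delone_kset \<Lambda>" and F: "\<And>n. averaging_set (F n)"
    and mean: "\<And>f. continuous_map (subtopology delone_topology (orbit_closure \<Lambda>)) euclideanreal f \<Longrightarrow>
      uniform_mean F (\<lambda>h. f (translate (- h) \<Lambda>))"
  shows "uniquely_ergodic (subtopology delone_topology (orbit_closure \<Lambda>)) (\<lambda>g. translate (- g))"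
proof -
  define X where "X = subtopology delone_topology (orbit_closure \<Lambda>)"
  define \<phi> where "\<phi> = (\<lambda>(f :: ('d, 'k) coloured \<Rightarrow> real) h. f (translate (- h) \<Lambda>))"
  define I where "I = (\<lambda>f. lim (\<lambda>n. set_avg (F n) (\<phi> f) 0))"
  have top: "topspace X = orbit_closure \<Lambda>" unfolding X_def by (rule topspace_orbit_closure(1)[OF \<Lambda>])
  have orb: "translate h \<Lambda> \<in> topspace X" for h unfolding top by (rule topspace_orbit_closure(2)[OF \<Lambda>])
  have um: "uniform_mean F (\<phi> f)" if "continuous_map X euclideanreal f" for f
    using mean that unfolding X_def \<phi>_def by blast
  have bb: "bounded_borel (\<phi> f)" if "continuous_map X euclideanreal f" for f
    using um[OF that] by (simp add: uniform_mean_def)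
  have unif: "\<forall>\<^sub>F n in sequentially. \<forall>h. \<bar>set_avg (F n) (\<phi> f) h - I f\<bar> \<le> e"
    if f: "continuous_map X euclideanreal f" and "e > 0" for f e
  proof -
    obtain c where c: "\<And>\<epsilon>. \<epsilon> > 0 \<Longrightarrow> \<forall>\<^sub>F n in sequentially. \<forall>h. \<bar>set_avg (F n) (\<phi> f) h - c\<bar> \<le> \<epsilon>"
      using uniform_mean_limit[OF F um[OF f]] by blast
    have "(\<lambda>n. set_avg (F n) (\<phi> f) 0) \<longlonglongrightarrow> c"
    proof (rule tendstoI)
      fix e :: real assume "e > 0"
      then have "\<forall>\<^sub>F n in sequentially. \<forall>h. \<bar>set_avg (F n) (\<phi> f) h - c\<bar> \<le> e / 2" by (intro c) simp
      then show "\<forall>\<^sub>F n in sequentially. dist (set_avg (F n) (\<phi> f) 0) c < e"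
        by eventually_elim (use \<open>e > 0\<close> in \<open>force simp: dist_real_def dest: spec[of _ 0]\<close>)
    qed
    then have "I f = c" unfolding I_def by (rule limI)
    then show ?thesis using c \<open>e > 0\<close> by blast
  qed
  have lim: "(\<lambda>n. set_avg (F n) (\<phi> f) h) \<longlonglongrightarrow> I f" if f: "continuous_map X euclideanreal f" for f h
  proof (rule tendstoI)
    fix e :: real assume "e > 0"
    then have "\<forall>\<^sub>F n in sequentially. \<forall>h. \<bar>set_avg (F n) (\<phi> f) h - I f\<bar> \<le> e / 2" by (intro unif f) simp
    then show "\<forall>\<^sub>F n in sequentially. dist (set_avg (F n) (\<phi> f) h) (I f) < e"
      by eventually_elim (use \<open>e > 0\<close> in \<open>force simp: dist_real_def dest: spec[of _ h]\<close>)
  qed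
  have act: "continuous_map X X (translate g)" for g
    unfolding X_def by (rule continuous_map_orbit_closure)
  have metr: "metrizable_space X"
    unfolding X_def by (rule metrizable_space_subtopology[OF metrizable_delone])
  interpret invariant_mean X "\<lambda>g. translate (- g)" I
  proof
    show "compact_space X" unfolding X_def by (rule compact_space_orbit_closure[OF \<Lambda>])
    show "metrizable_space X" by (rule metr)
    show "continuous_map X X (translate (- g))" for g by (rule act)
    show "I (\<lambda>x. f x + h x) = I f + I h"
      if f: "continuous_map X euclideanreal f" and h: "continuous_map X euclideanreal h" for f h
    proof (rule LIMSEQ_unique[OF lim])
      show "continuous_map X euclideanreal (\<lambda>x. f x + h x)" by (intro continuous_map_add f h)
      have "set_avg (F n) (\<phi> (\<lambda>x. f x + h x)) 0 = set_avg (F n) (\<phi> f) 0 + set_avg (F n) (\<phi> h) 0" for n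
        using set_avg_add[OF F bb[OF f] bb[OF h]] by (simp add: \<phi>_def)
      then show "(\<lambda>n. set_avg (F n) (\<phi> (\<lambda>x. f x + h x)) 0) \<longlonglongrightarrow> I f + I h"
        using tendsto_add[OF lim[OF f] lim[OF h]] by simp
    qed
    show "I (\<lambda>x. c * f x) = c * I f" if f: "continuous_map X euclideanreal f" for c f
    proof (rule LIMSEQ_unique[OF lim])
      show "continuous_map X euclideanreal (\<lambda>x. c * f x)" by (intro continuous_map_real_mult_left f)
      have "set_avg (F n) (\<phi> (\<lambda>x. c * f x)) 0 = c * set_avg (F n) (\<phi> f) 0" for n
        using set_avg_scale by (simp add: \<phi>_def)
      then show "(\<lambda>n. set_avg (F n) (\<phi> (\<lambda>x. c * f x)) 0) \<longlonglongrightarrow> c * I f"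
        using tendsto_mult_left[OF lim[OF f]] by simp
    qed
    show "0 \<le> I f" if f: "continuous_map X euclideanreal f" "\<And>x. x \<in> topspace X \<Longrightarrow> 0 \<le> f x" for f
      using f(2)[OF orb] by (intro LIMSEQ_le_const[OF lim[OF f(1)]]) (auto intro!: set_avg_nonneg F simp: \<phi>_def)
    show "I (\<lambda>_. 1) = 1"
      using set_avg_const[OF F] by (intro LIMSEQ_unique[OF lim]) (auto simp: \<phi>_def)
    show "I (\<lambda>x. f (translate (- g) x)) = I f" if f: "continuous_map X euclideanreal f" for g f
    proof (rule LIMSEQ_unique[OF lim])
      show "continuous_map X euclideanreal (\<lambda>x. f (translate (- g) x))"
        using continuous_map_compose[OF act f] by (simp add: o_def)
      have "\<phi> (\<lambda>x. f (translate (- g) x)) = (\<lambda>h. \<phi> f (h + g))"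
        by (simp add: \<phi>_def translate_translate algebra_simps)
      then show "(\<lambda>n. set_avg (F n) (\<phi> (\<lambda>x. f (translate (- g) x))) 0) \<longlonglongrightarrow> I f"
        using lim[OF f] by (simp add: set_avg_shift)
    qed
  qed
  have int: "integral\<^sup>L \<mu> f = I f"
    if inv: "invariant_prob X (\<lambda>g. translate (- g)) \<mu>" and f: "continuous_map X euclideanreal f"
      and f01: "\<And>x. x \<in> topspace X \<Longrightarrow> 0 \<le> f x \<and> f x \<le> 1" for \<mu> f
  proof -
    have sets: "sets \<mu> = sets (borel_sigma X)" and m: "translate (- g) \<in> measurable \<mu> \<mu>"
      and d: "distr \<mu> \<mu> (translate (- g)) = \<mu>" for g
      using inv by (auto simp: invariant_prob_def)
    interpret prob_space \<mu> using inv by (simp add: invariant_prob_def)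
    have "space \<mu> = topspace X"
    proof -
      have "{U. openin X U} \<subseteq> Pow (topspace X)" using openin_subset by auto
      then show ?thesis using sets_eq_imp_space_eq[OF sets] by (simp add: borel_sigma_def space_measure_of)
    qed
    have fm: "f \<in> borel_measurable \<mu>" by (rule borel_sigma_measurable[OF sets f])
    have gm: "(\<lambda>Q. f (translate (- g) Q)) \<in> borel_measurable \<mu>" for g
      by (rule measurable_compose[OF m fm])
    have gi: "integrable \<mu> (\<lambda>Q. f (translate (- g) Q))" for g
    proof (rule integrable_const_bound[of _ 1])
      show "AE Q in \<mu>. norm (f (translate (- g) Q)) \<le> 1"
        using f01 act[of "- g"] by (intro AE_I2) (auto simp: \<open>space \<mu> = topspace X\<close> continuous_map_def Pi_iff)
    qed (rule gm)
    \<comment> \<open>Invariance of \<open>\<mu>\<close> enters here. Since the weights sum to 1, a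
      convex combination of translates of \<open>f\<close> has the same integral as
      \<open>f\<close>.\<close>
    have ge: "integral\<^sup>L \<mu> (\<lambda>Q. f (translate (- g) Q)) = integral\<^sup>L \<mu> f" for g
      using integral_distr[OF m fm, of g] by (simp add: d)
    have "\<bar>integral\<^sup>L \<mu> f - I f\<bar> \<le> e" if "e > 0" for e
    proof -
      have "e / 2 > 0" using \<open>e > 0\<close> by simp
      then obtain n where n: "\<And>h. \<bar>set_avg (F n) (\<phi> f) h - I f\<bar> \<le> e / 2"
        using eventually_happens'[OF sequentially_bot unif[OF f]] by blast
      have "\<exists>S w (p :: (real^'d) set \<Rightarrow> real^'d). finite S \<and> (\<forall>B\<in>S. 0 \<le> w B) \<and> sum w S = 1 \<and>
          (\<forall>h. \<bar>(\<Sum>B\<in>S. w B * \<phi> f (h + p B)) - set_avg (F n) (\<phi> f) h\<bar> \<le> e / 2)"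
        using orbit_function_bounded_borel(2)[OF \<Lambda> f[unfolded X_def]]
        by (intro set_avg_discretize F bb f \<open>e / 2 > 0\<close>) (simp add: \<phi>_def)
      then obtain S w and p :: "(real^'d) set \<Rightarrow> real^'d" where S: "finite S" "sum w S = 1"
        "\<And>h. \<bar>(\<Sum>B\<in>S. w B * \<phi> f (h + p B)) - set_avg (F n) (\<phi> f) h\<bar> \<le> e / 2" by blast
      \<comment> \<open>On the orbit the error is at most \<open>e / 2\<close> from discretization
        and \<open>e / 2\<close> from the uniform mean. As a finite combination \<open>g\<close> is
        continuous, so the set where it is bounded by \<open>e\<close> is closed and contains the
        orbit closure.\<close>
      define g where "g = (\<lambda>Q. (\<Sum>B\<in>S. w B * f (translate (- p B) Q)) - I f)"
      have gc: "continuous_map X euclideanreal g"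
      proof -
        have "continuous_map X euclideanreal (\<lambda>Q. f (translate (- p B) Q))" for B
          using continuous_map_compose[OF act f] by (simp add: o_def)
        then show ?thesis unfolding g_def
          by (intro continuous_map_diff continuous_map_sum continuous_map_real_mult_left S) auto
      qed
      have orbg: "\<bar>g (translate (- h) \<Lambda>)\<bar> \<le> e" for h
      proof -
        have "g (translate (- h) \<Lambda>) = (\<Sum>B\<in>S. w B * \<phi> f (h + p B)) - I f"
          by (simp add: g_def \<phi>_def translate_translate algebra_simps)
        then show ?thesis using S(3)[of h] n[of h] by linarith
      qed
      have "closedin X {Q \<in> topspace X. g Q \<in> {- e..e}}"
        by (rule closedin_continuous_map_preimage[OF gc]) simp
      then have "closedin delone_topology {Q \<in> topspace X. g Q \<in> {- e..e}}"
        unfolding X_def by (rule closedin_trans_full) (simp add: orbit_closure_def)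
      moreover have "range (\<lambda>g. translate (- g) \<Lambda>) \<subseteq> {Q \<in> topspace X. g Q \<in> {- e..e}}"
        using orb orbg by (auto simp: abs_le_iff minus_le_iff)
      ultimately have "orbit_closure \<Lambda> \<subseteq> {Q \<in> topspace X. g Q \<in> {- e..e}}"
        unfolding orbit_closure_def by (intro closure_of_minimal)
      then have ge': "\<bar>g Q\<bar> \<le> e" if "Q \<in> topspace X" for Q
        using that unfolding top by (auto simp: abs_le_iff)
      have "integral\<^sup>L \<mu> g = (\<Sum>B\<in>S. w B * integral\<^sup>L \<mu> f) - I f"
        unfolding g_def using gi by (simp add: Bochner_Integration.integral_diff Bochner_Integration.integral_sum ge prob_space)
      then have eq: "integral\<^sup>L \<mu> g = integral\<^sup>L \<mu> f - I f"
        by (simp add: sum_distrib_right[symmetric] S(2))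
      have gm': "g \<in> borel_measurable \<mu>" by (rule borel_sigma_measurable[OF sets gc])
      have "integrable \<mu> g"
        using ge' by (intro integrable_const_bound[of _ e] AE_I2 gm') (simp add: \<open>space \<mu> = topspace X\<close>)
      then have "\<bar>integral\<^sup>L \<mu> g\<bar> \<le> (\<integral>Q. e \<partial>\<mu>)"
        using ge' by (intro order_trans[OF integral_abs_bound] integral_mono) (auto simp: \<open>space \<mu> = topspace X\<close>)
      then show ?thesis by (simp add: eq prob_space)
    qed
    then have "\<bar>integral\<^sup>L \<mu> f - I f\<bar> \<le> 0" by (rule field_le_epsilon) simp
    then show ?thesis by simp
  qed
  show ?thesis
    unfolding uniquely_ergodic_def X_def[symmetric]
  proof (rule ex_ex1I[OF exists_invariant_prob])
    fix \<mu> \<nu> assume *: "invariant_prob X (\<lambda>g. translate (- g)) \<mu>" "invariant_prob X (\<lambda>g. translate (- g)) \<nu>"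
    show "\<mu> = \<nu>"
      using * int by (intro prob_eqI_integral_continuous[OF metr]) (auto simp: invariant_prob_def)
  qed
qed

context separated_delone
begin

text \<open>Outside the cube families two cases remain. The empty \<open>D\<close> is always hit,
  which gives the constant 1. Otherwise \<open>D\<close> contains one cube in two colours, which
  cannot both be hit, and the indicator is constantly 0.\<close>

lemma uniform_mean_hit_superset:
  assumes F: "\<And>n. averaging_set (F n)" and D: "D \<subseteq> coloured_cubes m"
    and fam: "D \<in> cube_families m \<Longrightarrow> uniform_mean F (indicator {x. D \<subseteq> hit m (translate (- x) \<Lambda>)})"
  shows "uniform_mean F (indicator {x. D \<subseteq> hit m (translate (- x) \<Lambda>)})"
proof (cases "D = {} \<or> D \<in> cube_families m")
  case True
  then show ?thesis using fam uniform_mean_const[of F 1, OF F] by (auto simp: indicator_def[abs_def])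
next
  case False
  then have "\<not> pairwise (\<lambda>C C'. fst C \<inter> fst C' = {}) D" using D by (auto simp: cube_families_def)
  then obtain C C' x where C: "C \<in> D" "C' \<in> D" "C \<noteq> C'" "x \<in> fst C" "x \<in> fst C'"
    unfolding pairwise_def by blast
  have g: "fst C \<in> grid_cubes m" "fst C' \<in> grid_cubes m"
    using subsetD[OF D C(1)] subsetD[OF D C(2)] by (auto simp: coloured_cubes_def mem_Times_iff)
  then have eq: "fst C = fst C'" using C grid_cubes_eq by blast
  have "\<not> D \<subseteq> hit m (translate t \<Lambda>)" for t
  proof
    assume "D \<subseteq> hit m (translate t \<Lambda>)"
    then have "C \<in> hit m (translate t \<Lambda>)" "C' \<in> hit m (translate t \<Lambda>)" using C by auto
    then obtain y z where "(y, snd C) \<in> translate t \<Lambda>" "y \<in> fst C" "(z, snd C') \<in> translate t \<Lambda>" "z \<in> fst C"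
      by (auto simp: hit_def cube_points_def eq)
    then have "snd C = snd C'" using same_cube_unique[OF _ _ g(1)] by blast
    then show False using C(3) eq by (simp add: prod_eq_iff)
  qed
  then show ?thesis using uniform_mean_const[of F 0, OF F] by (simp add: indicator_def[abs_def])
qed

end

text \<open>Each \<open>D\<close> in \<open>cube_families m\<close> plays the role of one set of
  coloured cubes indexed by \<open>m\<close> and \<open>\<alpha>\<close>. The tail is stated by
  \<open>has_sum\<close>, so convergence is part of the condition; for nonnegative terms this agrees
  with bounding a sum with values up to infinity.\<close>

theorem corollary3p3:
  fixes \<Lambda> :: "('d::finite, 'k::finite) coloured"
    and F :: "nat \<Rightarrow> (real^'d) set"
    and \<eta> :: real and m\<^sub>0 :: nat
    and J :: "nat \<Rightarrow> ((real^'d) set \<times> 'k) set \<Rightarrow> nat set"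
    and G :: "nat \<Rightarrow> ((real^'d) set \<times> 'k) set \<Rightarrow> nat \<Rightarrow> ('d, 'k) coloured"
  assumes "delone_kset \<Lambda>"
    and "van_hove F"
    and "uniform_cluster_frequencies F \<Lambda>"
    and "\<eta> > 0"
    and "\<And>x y z. y \<in> support \<Lambda> \<Longrightarrow> z \<in> support \<Lambda> \<Longrightarrow>
           infnorm (y - x) < \<eta> / 2 \<Longrightarrow> infnorm (z - x) < \<eta> / 2 \<Longrightarrow> y = z"
    and "1 / 2 ^ m\<^sub>0 < \<eta> / 2"
    and "\<And>m D. m \<ge> m\<^sub>0 \<Longrightarrow> D \<in> cube_families m \<Longrightarrow>
           enumerates_representatives (occurring_patterns \<Lambda> m D) (J m D) (G m D)"
    and "\<And>m D \<epsilon>::real. m \<ge> m\<^sub>0 \<Longrightarrow> D \<in> cube_families m \<Longrightarrow> \<epsilon> > 0 \<Longrightarrow>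
           \<exists>k\<^sub>0. \<forall>n\<ge>k\<^sub>0. \<forall>h.
             \<exists>s\<le>\<epsilon>. ((\<lambda>j. measure lebesgue (admissible_shifts m D (G m D j)) *
                        real (occurrences (G m D j) ((\<lambda>y. h + y) ` F n) \<Lambda>) /
                        measure lebesgue (F n)) has_sum s) {j \<in> J m D. j \<ge> k\<^sub>0}"
  shows "uniquely_ergodic (subtopology delone_topology (orbit_closure \<Lambda>)) (\<lambda>g. translate (- g))"
proof (rule uniquely_ergodic_if_uniform_means)
  show F: "averaging_set (F n)" for n using assms(2) by (simp add: van_hove_def averaging_set_def)
  have sep: "separated_delone \<Lambda> m" if m: "m \<ge> m\<^sub>0" for m
  proof
    fix y z assume yz: "y \<in> support \<Lambda>" "z \<in> support \<Lambda>" "infnorm (y - z) < 1 / 2 ^ m"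
    have "1 / 2 ^ m \<le> (1 / 2 ^ m\<^sub>0 :: real)" using m by (intro divide_left_mono power_increasing) auto
    then have "infnorm (y - z) < \<eta> / 2" using yz(3) assms(6) by linarith
    \<comment> \<open>The ball is centred at \<open>z\<close>, so its membership for
      \<open>z\<close> is trivial.\<close>
    then show "y = z" using assms(4) by (intro assms(5)[OF yz(1,2), of z]) (auto simp: infnorm_0)
  qed (rule assms(1))
  fix f assume f: "continuous_map (subtopology delone_topology (orbit_closure \<Lambda>)) euclideanreal f"
  show "uniform_mean F (\<lambda>h. f (translate (- h) \<Lambda>))"
  proof (rule uniform_mean_approx[OF F orbit_function_bounded_borel(1)[OF assms(1) f]])
    fix \<epsilon> :: real assume "\<epsilon> > 0"
    obtain \<delta> where \<delta>: "\<delta> > 0"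
      "\<And>P Q. P \<in> orbit_closure \<Lambda> \<Longrightarrow> Q \<in> orbit_closure \<Lambda> \<Longrightarrow> delone_dist P Q < \<delta> \<Longrightarrow> \<bar>f P - f Q\<bar> < \<epsilon>"
      by (rule orbit_function_uniformly_continuous[OF assms(1) f \<open>\<epsilon> > 0\<close>]) blast
    have "\<forall>\<^sub>F m in sequentially. m \<ge> m\<^sub>0 \<and> (real CARD('d) + 1) / 2 ^ m < \<delta>"
      using order_tendstoD(2)[OF inverse_power2_tendsto \<delta>(1), of "real CARD('d) + 1"] eventually_ge_at_top[of m\<^sub>0]
      by eventually_elim simp
    then obtain m where m: "m \<ge> m\<^sub>0" "(real CARD('d) + 1) / 2 ^ m < \<delta>"
      using eventually_happens'[OF sequentially_bot] by blast
    interpret separated_delone \<Lambda> m by (rule sep[OF m(1)])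
    define H where "H = (\<lambda>x. hit m (translate (- x) \<Lambda>))"
    \<comment> \<open>The value of \<open>f\<close> at some orbit point with code \<open>S\<close>.
      For codes that never occur the choice is arbitrary, but \<open>\<psi>\<close> is evaluated
      only at codes \<open>H x\<close>.\<close>
    define \<psi> where "\<psi> = (\<lambda>S. f (translate (- (SOME x. H x = S)) \<Lambda>))"
    have "uniform_mean F (indicator {x. D \<subseteq> H x})" if D: "D \<subseteq> coloured_cubes m" for D
      unfolding H_def
    proof (rule uniform_mean_hit_superset[OF F D])
      assume fam: "D \<in> cube_families m"
      interpret enumerated_patterns \<Lambda> m D "J m D" "G m D"
        by unfold_locales (use fam assms(7)[OF m(1)] in auto)
      show "uniform_mean F (indicator {x. D \<subseteq> hit m (translate (- x) \<Lambda>)})"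
        using uniform_mean_visits[OF assms(2,3)] assms(8)[OF m(1) fam]
        unfolding visits_def shift_vol_def by blast
    qed
    then have "uniform_mean F (\<lambda>x. \<psi> (H x))"
      by (intro uniform_mean_finite_code[OF F finite_coloured_cubes[of m]]) (auto simp: H_def hit_def)
    moreover have "\<bar>f (translate (- x) \<Lambda>) - \<psi> (H x)\<bar> \<le> \<epsilon>" for x
    proof -
      let ?y = "SOME y. H y = H x"
      have "H ?y = H x" by (rule someI[of _ x]) simp
      then have "delone_dist (translate (- x) \<Lambda>) (translate (- ?y) \<Lambda>) \<le> (real CARD('d) + 1) / 2 ^ m"
        by (intro delone_dist_hit_eq delone_kset_translate assms(1)) (simp add: H_def)
      then have "\<bar>f (translate (- x) \<Lambda>) - f (translate (- ?y) \<Lambda>)\<bar> < \<epsilon>"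
        using m(2) by (intro \<delta>(2) topspace_orbit_closure(2) assms(1)) auto
      then show ?thesis by (simp add: \<psi>_def)
    qed
    ultimately show "\<exists>\<rho>. uniform_mean F \<rho> \<and> (\<forall>x. \<bar>f (translate (- x) \<Lambda>) - \<rho> x\<bar> \<le> \<epsilon>)" by blast
  qed
qed (rule assms(1))

end
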